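(* (1) For each $r\in\mathbb N$, the modules $W(\infty,\mu)$ with $\mu\in\Lambda^+(r')$ and $r'\le r$ form a complete set of pairwise non-isomorphic irreducible $\mathbf U(\infty,r)$-modules in the category $\mathcal C_r$. (2) The modules $W(\infty,\mu)$ with $\mu\in\Lambda^+(r)$, $r\in\mathbb N$, form a complete set of pairwise non-isomorphic irreducible $\mathbf U(\infty)$-modules in the category $\mathcal C^{pol}$. Moreover, the only irreducible $\mathbf U(\infty)$-module (up to isomorphism) in the category $\mathcal C^{pol}\cap\mathcal C^{hi}$ is the trivial module $L(0)$.
   Context: $v$ indeterminate. $\mathbf U(\infty)$ is the $\mathbb Q(v)$-algebra with generators $E_i,F_i,K_i,K_i^{-1}$ ($i\in\mathbb Z$) and relations: $K_iK_j=K_jK_i$, $K_iK_i^{-1}=1$; $K_iE_j=v^{\delta_{i,j}-\delta_{i,j+1}}E_jK_i$; $K_iF_j=v^{\delta_{i,j+1}-\delta_{i,j}}F_jK_i$; $E_iE_j=E_jE_i$, $F_iF_j=F_jF_i$ if $|i-j|>1$; $E_iF_j-F_jE_i=\delta_{i,j}\frac{\widetilde K_i-\widetilde K_i^{-1}}{v-v^{-1}}$, $\widetilde K_i=K_iK_{i+1}^{-1}$; $E_i^2E_j-(v+v^{-1})E_iE_jE_i+E_jE_i^2=0$ and likewise for $F$ if $|i-j|=1$; coproduct $\Delta(E_i)=E_i\otimes\widetilde K_i+1\otimes E_i$, $\Delta(F_i)=F_i\otimes1+\widetilde K_i^{-1}\otimes F_i$, $\Delta(K_j)=K_j\otimes K_j$.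 ${\bf\Omega}_\infty$ has basis $\{\omega_i\}_{i\in\mathbb Z}$ with $K_a\omega_b=v^{\delta_{a,b}}\omega_b$, $E_a\omega_b=\delta_{a+1,b}\omega_a$, $F_a\omega_b=\delta_{a,b}\omega_{a+1}$; ${\bf\Omega}_\infty^{\otimes r}$ is a $\mathbf U(\infty)$-module via $\Delta$. The Hecke algebra ${\boldsymbol{\mathcal H}}$ of $\mathfrak S_r$ over $\mathbb Q(v)$ (basis $\mathcal T_w$, $\mathcal T_s\mathcal T_w=\mathcal T_{sw}$ if $\ell(sw)>\ell(w)$, else $(v-v^{-1})\mathcal T_w+\mathcal T_{sw}$; $T_w=v^{\ell(w)}\mathcal T_w$) acts on the right by $(\omega_{i_1}\cdots\omega_{i_r})\mathcal T_{(j,j+1)}=\omega_{i_1}\cdots\omega_{i_{j+1}}\omega_{i_j}\cdots\omega_{i_r}$ if $i_j<i_{j+1}$; $=v\,\omega_{i_1}\cdots\omega_{i_r}$ if $i_j=i_{j+1}$; $=(v-v^{-1})\omega_{i_1}\cdots\omega_{i_r}+\omega_{i_1}\cdots\omega_{i_{j+1}}\omega_{i_j}\cdots\omega_{i_r}$ if $i_j>i_{j+1}$. ${\boldsymbol{\mathcal S}}(\infty,r)=\operatorname{End}_{\boldsymbol{\mathcal H}}({\bf\Omega}_\infty^{\otimes r})$; the commuting actions give $\zeta_r:\mathbf U(\infty)\to{\boldsymbol{\mathcal S}}(\infty,r)$; $\mathbf U(\infty,r)=\zeta_r(\mathbf U(\infty))$. For $r'\le r$ there is a surjective algebra homomorphism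 $\mathbf U(\infty,r)\to\mathbf U(\infty,r')$ with $\zeta_r(x)\mapsto\zeta_{r'}(x)$ for $x\in\mathbf U(\infty)$. Weights: $X(\infty)$ is the set of all integer sequences indexed by $\mathbb Z$; $\mathbb N^\infty\subseteq X(\infty)$ the finitely supported nonnegative ones. For a $\mathbf U(\infty)$-module $M$, $M_\lambda=\{x:K_ix=v^{\lambda_i}x\ \forall i\}$; weight module: $M=\bigoplus_\lambda M_\lambda$. $\mathcal C^{pol}$: weight modules all of whose weights lie in $\mathbb N^\infty$. $\mathcal C^{hi}$: weight modules such that every $x$ is killed by all monomials in the $E_i$'s with sufficiently many factors. $\mathcal C_r$: $\mathbf U(\infty,r)$-modules which are weight $\mathbf U(\infty)$-modules via $\zeta_r$. $L(0)$ is the one-dimensional module on which $E_i,F_i$ act by $0$ and $K_i$ by $1$. Weyl modules: $\Lambda(\infty,r)$ finitely supported $\lambda\in\mathbb N^{\mathbb Z}$ with $\sum\lambda_i=r$; $\Lambda^+(r)$ the partitions of $r$ in it ($\lambda_i=0$ for $i\le0$, nonincreasing for $i\ge1$). $\Omega_\lambda$ is the span of tensors $\omega_{i_1}\otimes\cdots\otimes\omega_{i_r}$ with $\#\{j:i_j=k\}=\lambda_k$; $\omega_\lambda$ the one with weakly increasing indices. $\mathfrak S_\lambda$ Young subgroup for consecutive blocks of sizes $\lambda_i$; $\varpi_i=1$ for $1\le i\le r$, else $0$; $\omega_\varpi=\omega_1\otimes\cdots\otimes\omega_r$ (a free generator of $\Omega_\varpi$ over ${\boldsymbol{\mathcal H}}$).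 $\lambda^t_i=\#\{j:\lambda_j\ge i\}$ ($i\ge1$), $0$ for $i\le0$; $w_\lambda$ the unique distinguished $(\mathfrak S_\lambda,\mathfrak S_{\lambda^t})$-double coset representative with $w_\lambda^{-1}\mathfrak S_\lambda w_\lambda\cap\mathfrak S_{\lambda^t}=\{1\}$; $y_{\lambda^t}=\sum_{w\in\mathfrak S_{\lambda^t}}(-v^2)^{-\ell(w)}T_w$. $z_\mu\in{\boldsymbol{\mathcal S}}(\infty,r)$ vanishes on $\Omega_\nu$, $\nu\ne\varpi$, and $z_\mu(\omega_\varpi h)=\omega_\mu T_{w_\mu}y_{\mu^t}h$. $W(\infty,\mu)={\boldsymbol{\mathcal S}}(\infty,r)z_\mu$ for $\mu\in\Lambda^+(r)$; it is a $\mathbf U(\infty)$-module via $\zeta_r$ and a $\mathbf U(\infty,r)$-module; for $\mu\in\Lambda^+(r')$, $r'\le r$, it is a $\mathbf U(\infty,r)$-module via the surjection $\mathbf U(\infty,r)\to\mathbf U(\infty,r')$. *)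

theory Defs
  imports "HOL-Computational_Algebra.Polynomial" "HOL-Computational_Algebra.Fraction_Field"
    "HOL-Library.Function_Algebras" "HOL-Combinatorics.Permutations" "HOL-Combinatorics.Transposition"
begin

type_synonym qv = "rat poly fract"

definition vq :: qv where "vq = Fract [:0, 1:] 1"

definition dl :: "int \<Rightarrow> int \<Rightarrow> int" where "dl i j = (if i = j then 1 else 0)"

datatype gen = E int | F int | Kp int | Km int

definition umod :: "(qv \<Rightarrow> 'm::ab_group_add \<Rightarrow> 'm) \<Rightarrow> 'm set \<Rightarrow> (gen \<Rightarrow> 'm \<Rightarrow> 'm) \<Rightarrow> bool" where
  "umod sc M act \<longleftrightarrow>
     vector_space sc \<and> 0 \<in> M \<and> (\<forall>x\<in>M. \<forall>y\<in>M. x + y \<in> M) \<and> (\<forall>c. \<forall>x\<in>M. sc c x \<in> M) \<and>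
     (\<forall>g. \<forall>x\<in>M. act g x \<in> M) \<and>
     (\<forall>g c. \<forall>x\<in>M. \<forall>y\<in>M. act g (x + y) = act g x + act g y \<and> act g (sc c x) = sc c (act g x)) \<and>
     (\<forall>x\<in>M. \<forall>i j.
        act (Kp i) (act (Kp j) x) = act (Kp j) (act (Kp i) x) \<and>
        act (Kp i) (act (Km i) x) = x \<and> act (Km i) (act (Kp i) x) = x \<and>
        act (Kp i) (act (E j) x) = sc (vq powi (dl i j - dl i (j + 1))) (act (E j) (act (Kp i) x)) \<and>
        act (Kp i) (act (F j) x) = sc (vq powi (dl i (j + 1) - dl i j)) (act (F j) (act (Kp i) x)) \<and>
        (\<bar>i - j\<bar> > 1 \<longrightarrow> act (E i) (act (E j) x) = act (E j) (act (E i) x) \<and>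
                           act (F i) (act (F j) x) = act (F j) (act (F i) x)) \<and>
        act (E i) (act (F j) x) - act (F j) (act (E i) x) =
          (if i = j then sc (inverse (vq - inverse vq))
                (act (Kp i) (act (Km (i + 1)) x) - act (Km i) (act (Kp (i + 1)) x)) else 0) \<and>
        (\<bar>i - j\<bar> = 1 \<longrightarrow>
           act (E i) (act (E i) (act (E j) x)) - sc (vq + inverse vq) (act (E i) (act (E j) (act (E i) x)))
             + act (E j) (act (E i) (act (E i) x)) = 0 \<and>
           act (F i) (act (F i) (act (F j) x)) - sc (vq + inverse vq) (act (F i) (act (F j) (act (F i) x)))
             + act (F j) (act (F i) (act (F i) x)) = 0))"

text \<open>Elements of U(infinity) are represented by noncommutative polynomials in the generators:
  finite lists of (coefficient, word); a word [g1,...,gn] acts as g1 o ... o gn.\<close>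

definition evalp :: "(qv \<Rightarrow> 'm::ab_group_add \<Rightarrow> 'm) \<Rightarrow> (gen \<Rightarrow> 'm \<Rightarrow> 'm) \<Rightarrow> (qv \<times> gen list) list \<Rightarrow> 'm \<Rightarrow> 'm" where
  "evalp sc act p x = sum_list (map (\<lambda>(c, w). sc c (foldr act w x)) p)"

definition wspace :: "(qv \<Rightarrow> 'm::ab_group_add \<Rightarrow> 'm) \<Rightarrow> 'm set \<Rightarrow> (gen \<Rightarrow> 'm \<Rightarrow> 'm) \<Rightarrow> (int \<Rightarrow> int) \<Rightarrow> 'm set" where
  "wspace sc M act la = {x \<in> M. \<forall>i. act (Kp i) x = sc (vq powi la i) x}"

definition wmod :: "(qv \<Rightarrow> 'm::ab_group_add \<Rightarrow> 'm) \<Rightarrow> 'm set \<Rightarrow> (gen \<Rightarrow> 'm \<Rightarrow> 'm) \<Rightarrow> bool" where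
  "wmod sc M act \<longleftrightarrow> umod sc M act \<and>
     (\<forall>x\<in>M. \<exists>ys. x = sum_list ys \<and> (\<forall>y\<in>set ys. \<exists>la. y \<in> wspace sc M act la))"

definition Cpol :: "(qv \<Rightarrow> 'm::ab_group_add \<Rightarrow> 'm) \<Rightarrow> 'm set \<Rightarrow> (gen \<Rightarrow> 'm \<Rightarrow> 'm) \<Rightarrow> bool" where
  "Cpol sc M act \<longleftrightarrow> wmod sc M act \<and>
     (\<forall>la x. x \<in> wspace sc M act la \<and> x \<noteq> 0 \<longrightarrow> (\<forall>i. 0 \<le> la i) \<and> finite {i. la i \<noteq> 0})"

definition Chi :: "(qv \<Rightarrow> 'm::ab_group_add \<Rightarrow> 'm) \<Rightarrow> 'm set \<Rightarrow> (gen \<Rightarrow> 'm \<Rightarrow> 'm) \<Rightarrow> bool" where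
  "Chi sc M act \<longleftrightarrow> wmod sc M act \<and>
     (\<forall>x\<in>M. \<exists>N. \<forall>is. N \<le> length is \<longrightarrow> foldr (\<lambda>i. act (E i)) is x = 0)"

definition irred :: "(qv \<Rightarrow> 'm::ab_group_add \<Rightarrow> 'm) \<Rightarrow> 'm set \<Rightarrow> (gen \<Rightarrow> 'm \<Rightarrow> 'm) \<Rightarrow> bool" where
  "irred sc M act \<longleftrightarrow> umod sc M act \<and> M \<noteq> {0} \<and>
     (\<forall>N. N \<subseteq> M \<and> 0 \<in> N \<and> (\<forall>x\<in>N. \<forall>y\<in>N. x + y \<in> N) \<and> (\<forall>c. \<forall>x\<in>N. sc c x \<in> N) \<and>
          (\<forall>g. \<forall>x\<in>N. act g x \<in> N) \<longrightarrow> N = {0} \<or> N = M)"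

definition umod_iso :: "(qv \<Rightarrow> 'm::ab_group_add \<Rightarrow> 'm) \<Rightarrow> 'm set \<Rightarrow> (gen \<Rightarrow> 'm \<Rightarrow> 'm) \<Rightarrow>
                   (qv \<Rightarrow> 'n::ab_group_add \<Rightarrow> 'n) \<Rightarrow> 'n set \<Rightarrow> (gen \<Rightarrow> 'n \<Rightarrow> 'n) \<Rightarrow> bool" where
  "umod_iso sc1 M1 act1 sc2 M2 act2 \<longleftrightarrow> (\<exists>f. bij_betw f M1 M2 \<and>
     (\<forall>x\<in>M1. \<forall>y\<in>M1. f (x + y) = f x + f y) \<and> (\<forall>c. \<forall>x\<in>M1. f (sc1 c x) = sc2 c (f x)) \<and>
     (\<forall>g. \<forall>x\<in>M1. f (act1 g x) = act2 g (f x)))"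

definition actL0 :: "gen \<Rightarrow> qv \<Rightarrow> qv" where
  "actL0 g x = (case g of E _ \<Rightarrow> 0 | F _ \<Rightarrow> 0 | Kp _ \<Rightarrow> x | Km _ \<Rightarrow> x)"

text \<open>Vectors are finitely supported functions on words; the word [i1,...,ir] is the basis
  tensor omega_{i1} \<otimes> ... \<otimes> omega_{ir}.\<close>

type_synonym tv = "int list \<Rightarrow> qv"

definition tens :: "nat \<Rightarrow> tv set" where
  "tens r = {f. finite {w. f w \<noteq> 0} \<and> (\<forall>w. f w \<noteq> 0 \<longrightarrow> length w = r)}"

definition bas :: "int list \<Rightarrow> tv" where "bas w = (\<lambda>u. if u = w then 1 else 0)"

definition scT :: "qv \<Rightarrow> tv \<Rightarrow> tv" where "scT c f = (\<lambda>w. c * f w)"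

definition lin :: "(int list \<Rightarrow> tv) \<Rightarrow> tv \<Rightarrow> tv" where
  "lin g f = (\<lambda>u. \<Sum>w\<in>{w. f w \<noteq> 0}. f w * g w u)"

text \<open>pre a f = omega_a \<otimes> f\<close>
definition pre :: "int \<Rightarrow> tv \<Rightarrow> tv" where
  "pre a f = (\<lambda>w. case w of [] \<Rightarrow> 0 | b # u \<Rightarrow> if b = a then f u else 0)"

text \<open>exponent of Ktilde_i = K_i K_{i+1}^{-1} on a basis tensor\<close>
definition kt :: "int \<Rightarrow> int list \<Rightarrow> int" where
  "kt i u = int (count_list u i) - int (count_list u (i + 1))"

text \<open>Generator action on basis tensors, via the coproduct applied to
  omega_a \<otimes> (omega_u):  Delta(E_i) = E_i \<otimes> Kt_i + 1 \<otimes> E_i,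
  Delta(F_i) = F_i \<otimes> 1 + Kt_i^{-1} \<otimes> F_i,  Delta(K_j) = K_j \<otimes> K_j;
  on the empty tensor (r = 0) the counit acts.\<close>
fun gb :: "gen \<Rightarrow> int list \<Rightarrow> tv" where
  "gb (E i) [] = 0"
| "gb (F i) [] = 0"
| "gb (Kp j) [] = bas []"
| "gb (Km j) [] = bas []"
| "gb (E i) (a # u) =
     (if a = i + 1 then scT (vq powi kt i u) (pre i (bas u)) else 0) + pre a (gb (E i) u)"
| "gb (F i) (a # u) =
     (if a = i then pre (i + 1) (bas u) else 0) + scT (vq powi (- kt i [a])) (pre a (gb (F i) u))"
| "gb (Kp j) (a # u) = scT (vq powi dl j a) (pre a (gb (Kp j) u))"
| "gb (Km j) (a # u) = scT (vq powi (- dl j a)) (pre a (gb (Km j) u))"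

definition actT :: "gen \<Rightarrow> tv \<Rightarrow> tv" where "actT g f = lin (gb g) f"

text \<open>Right action of the generator T_{(j,j+1)} (1 \<le> j < r) on basis tensors.\<close>
definition hb :: "nat \<Rightarrow> int list \<Rightarrow> tv" where
  "hb j w = (let a = w ! (j - 1); b = w ! j; sw = w[j - 1 := b, j := a] in
     if a < b then bas sw
     else if a = b then scT vq (bas w)
     else scT (vq - inverse vq) (bas w) + bas sw)"

definition hs :: "nat \<Rightarrow> tv \<Rightarrow> tv" where "hs j f = lin (hb j) f"

text \<open>S(infinity,r) = End_H(Omega^{\<otimes> r}); endomorphisms are taken to be 0 outside the space.\<close>
definition Send :: "nat \<Rightarrow> (tv \<Rightarrow> tv) set" where
  "Send r = {\<phi>. (\<forall>f. f \<notin> tens r \<longrightarrow> \<phi> f = 0) \<and> (\<forall>f\<in>tens r. \<phi> f \<in> tens r) \<and>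
     (\<forall>f\<in>tens r. \<forall>g\<in>tens r. \<phi> (f + g) = \<phi> f + \<phi> g) \<and>
     (\<forall>c. \<forall>f\<in>tens r. \<phi> (scT c f) = scT c (\<phi> f)) \<and>
     (\<forall>j. \<forall>f\<in>tens r. 1 \<le> j \<and> j < r \<longrightarrow> \<phi> (hs j f) = hs j (\<phi> f))}"

definition perms :: "nat \<Rightarrow> (nat \<Rightarrow> nat) set" where "perms r = {s. s permutes {1..r}}"

definition ell :: "nat \<Rightarrow> (nat \<Rightarrow> nat) \<Rightarrow> nat" where
  "ell r s = card {(i, j). 1 \<le> i \<and> i < j \<and> j \<le> r \<and> s j < s i}"

definition redword :: "nat \<Rightarrow> (nat \<Rightarrow> nat) \<Rightarrow> nat list \<Rightarrow> bool" where
  "redword r s js \<longleftrightarrow> set js \<subseteq> {1..<r} \<and> length js = ell r s \<and>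
     foldr (\<lambda>j t. transpose j (j + 1) \<circ> t) js id = s"

text \<open>f |-> f Tcal_s, computed from a reduced expression s = s_{j1} ... s_{jk}.\<close>
definition heckT :: "nat \<Rightarrow> (nat \<Rightarrow> nat) \<Rightarrow> tv \<Rightarrow> tv" where
  "heckT r s f = fold hs (SOME js. redword r s js) f"

definition TT :: "nat \<Rightarrow> (nat \<Rightarrow> nat) \<Rightarrow> tv \<Rightarrow> tv" where
  "TT r s f = scT (vq ^ ell r s) (heckT r s f)"

definition psum :: "(int \<Rightarrow> nat) \<Rightarrow> int \<Rightarrow> nat" where
  "psum la k = (\<Sum>i\<in>{i. i < k \<and> la i \<noteq> 0}. la i)"

definition blockset :: "(int \<Rightarrow> nat) \<Rightarrow> int \<Rightarrow> nat set" where
  "blockset la k = {psum la k + 1 .. psum la k + la k}"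

definition young :: "nat \<Rightarrow> (int \<Rightarrow> nat) \<Rightarrow> (nat \<Rightarrow> nat) set" where
  "young r la = {s \<in> perms r. \<forall>k. s ` blockset la k = blockset la k}"

definition yv :: "nat \<Rightarrow> (int \<Rightarrow> nat) \<Rightarrow> tv \<Rightarrow> tv" where
  "yv r la f = (\<Sum>s\<in>young r la. scT ((- (vq ^ 2)) powi (- int (ell r s))) (TT r s f))"

definition rk :: "(int \<Rightarrow> nat) \<Rightarrow> nat" where
  "rk la = (\<Sum>i\<in>{i. la i \<noteq> 0}. la i)"

definition is_partition :: "nat \<Rightarrow> (int \<Rightarrow> nat) \<Rightarrow> bool" where
  "is_partition r mu \<longleftrightarrow> (\<forall>i. i \<le> 0 \<longrightarrow> mu i = 0) \<and> (\<forall>i j. 1 \<le> i \<and> i \<le> j \<longrightarrow> mu j \<le> mu i) \<and>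
     finite {i. mu i \<noteq> 0} \<and> rk mu = r"

definition conj :: "(int \<Rightarrow> nat) \<Rightarrow> int \<Rightarrow> nat" where
  "conj mu k = (if k \<le> 0 then 0 else card {j. nat k \<le> mu j})"

definition omw :: "(int \<Rightarrow> nat) \<Rightarrow> int list" where
  "omw la = (THE w. sorted w \<and> (\<forall>k. count_list w k = la k))"

text \<open>w_mu: the distinguished (S_mu, S_{mu^t}) double coset representative with trivial intersection\<close>
definition wmu :: "nat \<Rightarrow> (int \<Rightarrow> nat) \<Rightarrow> (nat \<Rightarrow> nat)" where
  "wmu r mu = (THE w. w \<in> perms r \<and>
      (\<forall>x\<in>young r mu. \<forall>y\<in>young r (conj mu). ell r w \<le> ell r (x \<circ> w \<circ> y)) \<and>
      {inv w \<circ> x \<circ> w | x. x \<in> young r mu} \<inter> young r (conj mu) = {id})"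

definition umu :: "nat \<Rightarrow> (int \<Rightarrow> nat) \<Rightarrow> tv" where
  "umu r mu = yv r (conj mu) (TT r (wmu r mu) (bas (omw mu)))"

text \<open>z_mu: the element of S(infinity,r) vanishing on Omega_nu (nu \<noteq> varpi) and sending
  omega_varpi = omega_1...omega_r to omega_mu T_{w_mu} y_{mu^t} (hence omega_varpi h to ... h).\<close>
definition zmu :: "nat \<Rightarrow> (int \<Rightarrow> nat) \<Rightarrow> tv \<Rightarrow> tv" where
  "zmu r mu = (THE z. z \<in> Send r \<and>
      (\<forall>w. length w = r \<and> mset w \<noteq> mset [1..int r] \<longrightarrow> z (bas w) = 0) \<and>
      z (bas [1..int r]) = umu r mu)"

definition Wc :: "(int \<Rightarrow> nat) \<Rightarrow> (tv \<Rightarrow> tv) set" where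
  "Wc mu = (\<lambda>\<phi>. \<phi> \<circ> zmu (rk mu) mu) ` Send (rk mu)"

text \<open>action of x through zeta_r: left multiplication by zeta_r(x)\<close>
definition actW :: "gen \<Rightarrow> (tv \<Rightarrow> tv) \<Rightarrow> (tv \<Rightarrow> tv)" where
  "actW g \<psi> = actT g \<circ> \<psi>"

definition scW :: "qv \<Rightarrow> (tv \<Rightarrow> tv) \<Rightarrow> (tv \<Rightarrow> tv)" where
  "scW c \<psi> = (\<lambda>f. scT c (\<psi> f))"

text \<open>Weight U(infinity)-modules on which ker zeta_r acts trivially (= U(infinity,r)-modules).\<close>
definition Cr :: "nat \<Rightarrow> (qv \<Rightarrow> 'm::ab_group_add \<Rightarrow> 'm) \<Rightarrow> 'm set \<Rightarrow> (gen \<Rightarrow> 'm \<Rightarrow> 'm) \<Rightarrow> bool" where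
  "Cr r sc M act \<longleftrightarrow> wmod sc M act \<and>
     (\<forall>p. (\<forall>f\<in>tens r. evalp scT actT p f = 0) \<longrightarrow> (\<forall>x\<in>M. evalp sc act p x = 0))"

end

theory Submission
  imports Defs "HOL-Library.Product_Plus"
begin

text \<open>
  A polynomial module contains a nonzero weight vector \<open>x\<close> whose weight \<open>mu\<close> is supported on the
  positive integers with \<open>\<Sum>i. i * mu i\<close> minimal. It is killed by \<open>E i\<close> for \<open>i \<ge> 1\<close>, and \<open>mu\<close> is a
  partition by the representation theory of \<open>sl\<^sub>2\<close>. A full \<open>sl\<^sub>2\<close>-string moves all of \<open>la i\<close> to an empty
  neighbouring place reversibly, so weights may be shifted along the integers. Shifting \<open>mu\<close> far to
  the left turns \<open>x\<close> into a highest weight vector for the finitely many generators in any given word;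
  hence the weight space of \<open>U x\<close> at \<open>mu\<close> is a line, and irreducible modules with the same \<open>mu\<close> are
  isomorphic.

  Evaluation at \<open>omega_varpi\<close> identifies \<open>W(mu)\<close> with \<open>S u = U u\<close>, where \<open>u = omega_mu T_w y\<close>. As
  \<open>omega_varpi\<close> generates tensor space over \<open>U\<close>, identities between operators commuting with \<open>U\<close> need
  only be checked there. The vectors of \<open>U u\<close> alternate along the blocks of the conjugate partition,
  so the weights of \<open>U u\<close> are dominated by \<open>mu\<close>. The standard bilinear form is contravariant, and
  it is anisotropic because \<open>rat poly fract\<close> is an ordered field; so \<open>U u\<close> is irreducible.
\<close>

section \<open>The quantum parameter\<close>

text \<open>Ordinary highest weight theory does not apply: letters can move to the left forever, so
  outside the trivial module no nonzero vector of an irreducible polynomial module is killed by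
  every \<open>E i\<close>. A vector killed by \<open>E i\<close> for \<open>i \<ge> 1\<close> is
  highest only relatively. The shift supplies the rest: a given word uses finitely many indices, and
  a full string is invertible on a whole weight space, so the question about that word is carried to
  a place where all its \<open>E i\<close> kill the vector. This needs only the relations between
  generators, neither a PBW basis nor a triangular decomposition. Isomorphisms come from graphs
  inside product modules, non-isomorphism from the dominance order on weights. The bound
  \<open>r' \<le> r\<close> comes from products of factors K_A - v^j, with K_A a product of
  \<open>Kp i\<close>: they vanish on r-fold tensors and so restrict the weights of modules in
  \<open>Cr\<close>. Under \<open>Chi\<close> some vector is killed by every \<open>E i\<close>; its
  weight then decreases weakly along all integers and, having finite support, is zero.\<close>

lemma vq_gt1: "1 < vq"
proof -
  \<comment> \<open>Polynomials are ordered by the sign of the leading coefficient, so the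
    indeterminate exceeds every constant.\<close>
  have "(1::rat poly) < [:0, 1:]"
    by (simp add: less_poly_def one_pCons pos_poly_pCons)
  then show ?thesis
    unfolding vq_def One_fract_def by (simp add: less_fract)
qed

lemma vq_nz [simp]: "vq \<noteq> 0"
  using vq_gt1 by auto

text \<open>\<open>vq\<close> is not a root of unity: the eigenvalues of the \<open>Kp i\<close>
  determine the weight, and quantum integers vanish only at 0.\<close>

lemma vq_powi_eq_iff [simp]: "vq powi m = vq powi n \<longleftrightarrow> m = n"
  using power_int_strict_increasing[OF _ vq_gt1] by (metis linorder_neqE less_irrefl)

lemma vq_diff_pos: "0 < vq - inverse vq"
  using vq_gt1 by (simp add: inverse_less_1_iff less_trans[of "inverse vq" 1])

lemma vq_diff_nz [simp]: "vq - inverse vq \<noteq> 0"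
  using vq_diff_pos by (metis less_irrefl)

text \<open>The Gaussian integer, odd in \<open>n\<close>. Negative arguments occur because
  \<open>la i - la (i + 1)\<close> may be negative.\<close>

definition qint :: "int \<Rightarrow> qv" where
  "qint n = (vq powi n - vq powi (- n)) / (vq - inverse vq)"

lemma qint_eq_0_iff [simp]: "qint n = 0 \<longleftrightarrow> n = 0"
  using vq_diff_nz by (simp add: qint_def del: vq_diff_nz)

lemma qint_1 [simp]: "qint 1 = 1"
  unfolding qint_def using vq_diff_nz by (simp add: power_int_minus)

text \<open>Induction step for the coefficients [k+1][m-k] in E F^(k+1) x = [k+1][m-k] F^k x: moving
  E past one more F adds [m-2k]. After clearing denominators both sides are the same Laurent
  polynomial.\<close>

lemma qint_rec: "qint (k + 1) * qint (m - k) = qint k * qint (m - k + 1) + qint (m - 2 * k)"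
proof -
  let ?d = "vq - inverse vq"
  define p where "p n = vq powi n" for n
  have pp: "p a * p b = p (a + b)" for a b by (simp add: p_def power_int_add)
  have d: "?d = p 1 - p (-1)" by (simp add: p_def power_int_minus)
  have "(p (k + 1) - p (- (k + 1))) * (p (m - k) - p (- (m - k)))
      = (p k - p (- k)) * (p (m - k + 1) - p (- (m - k + 1))) + (p (m - 2 * k) - p (- (m - 2 * k))) * ?d"
    unfolding d by (simp add: algebra_simps pp)
  moreover have "c / d * (e / d) = f / d * (g / d) + h / d" if "c * e = f * g + h * d" "d \<noteq> 0" for c d e f g h :: qv
    using that by (simp add: add_divide_distrib)
  ultimately show ?thesis
    unfolding qint_def p_def[symmetric] using vq_diff_nz by blast
qed

lemma qint_rec_Suc: "qint (int (Suc k) + 1) * qint (m - int (Suc k))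
    = qint (int k + 1) * qint (m - int k) + qint (m - 2 * int (Suc k))"
proof -
  have "m - int (Suc k) + 1 = m - int k" "int (Suc k) = int k + 1" by simp_all
  then show ?thesis using qint_rec[of "int (Suc k)" m] by metis
qed

section \<open>Weight spaces of modules\<close>

definition up :: "int \<Rightarrow> (int \<Rightarrow> int) \<Rightarrow> int \<Rightarrow> int" where
  "up i la = (\<lambda>j. la j + dl j i - dl j (i + 1))"

definition dn :: "int \<Rightarrow> (int \<Rightarrow> int) \<Rightarrow> int \<Rightarrow> int" where
  "dn i la = (\<lambda>j. la j + dl j (i + 1) - dl j i)"

fun gsh :: "gen \<Rightarrow> (int \<Rightarrow> int) \<Rightarrow> int \<Rightarrow> int" where
  "gsh (E i) la = up i la"
| "gsh (F i) la = dn i la"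
| "gsh (Kp i) la = la"
| "gsh (Km i) la = la"

fun gok :: "int \<Rightarrow> gen \<Rightarrow> bool" where
  "gok L (E i) \<longleftrightarrow> L \<le> i"
| "gok L (F i) \<longleftrightarrow> L \<le> i"
| "gok L (Kp i) \<longleftrightarrow> True"
| "gok L (Km i) \<longleftrightarrow> True"

text \<open>The action is constrained only on the subset \<open>M\<close>, hence the membership
  hypotheses everywhere; \<open>span\<close> is nevertheless taken in the whole type.\<close>

locale umodule = vector_space sc for sc :: "qv \<Rightarrow> 'm::ab_group_add \<Rightarrow> 'm" +
  fixes M :: "'m set" and act :: "gen \<Rightarrow> 'm \<Rightarrow> 'm"
  assumes umod: "umod sc M act"

lemma umodule_if_umod: "umod sc M act \<Longrightarrow> umodule sc M act"
  by (simp add: umodule_def umodule_axioms_def umod_def)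

context umodule
begin

abbreviation ws :: "(int \<Rightarrow> int) \<Rightarrow> 'm set" where "ws \<equiv> wspace sc M act"

lemma M_0 [simp, intro]: "0 \<in> M"
  and M_add [intro]: "x \<in> M \<Longrightarrow> y \<in> M \<Longrightarrow> x + y \<in> M"
  and M_sc [intro]: "x \<in> M \<Longrightarrow> sc c x \<in> M"
  and M_act [intro]: "x \<in> M \<Longrightarrow> act g x \<in> M"
  and act_add: "x \<in> M \<Longrightarrow> y \<in> M \<Longrightarrow> act g (x + y) = act g x + act g y"
  and act_sc: "x \<in> M \<Longrightarrow> act g (sc c x) = sc c (act g x)"
  using umod unfolding umod_def by blast+

lemma
  assumes x: "x \<in> M"
  shows KKm: "act (Kp i) (act (Km i) x) = x"
    and KmK: "act (Km i) (act (Kp i) x) = x"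
    and KE: "act (Kp i) (act (E j) x) = sc (vq powi (dl i j - dl i (j + 1))) (act (E j) (act (Kp i) x))"
    and KF: "act (Kp i) (act (F j) x) = sc (vq powi (dl i (j + 1) - dl i j)) (act (F j) (act (Kp i) x))"
    and EF: "act (E i) (act (F j) x) - act (F j) (act (E i) x) =
          (if i = j then sc (inverse (vq - inverse vq))
                (act (Kp i) (act (Km (i + 1)) x) - act (Km i) (act (Kp (i + 1)) x)) else 0)"
    and KK: "act (Kp i) (act (Kp j) x) = act (Kp j) (act (Kp i) x)"
  using umod x unfolding umod_def by blast+

lemma act_0 [simp]: "act g 0 = 0"
  using act_sc[of 0 g 0] by simp

lemma M_neg [intro]: "x \<in> M \<Longrightarrow> - x \<in> M"
  using M_sc[of x "-1"] by simp

lemma M_sum: "(\<And>a. a \<in> A \<Longrightarrow> f a \<in> M) \<Longrightarrow> sum f A \<in> M"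
  by (induction A rule: infinite_finite_induct) auto

lemma act_sum: "(\<And>a. a \<in> A \<Longrightarrow> f a \<in> M) \<Longrightarrow> act g (sum f A) = (\<Sum>a\<in>A. act g (f a))"
  by (induction A rule: infinite_finite_induct) (auto simp: act_add M_sum)

lemma word_M [intro]: "x \<in> M \<Longrightarrow> foldr act w x \<in> M"
  by (induction w) auto

lemma word_add: "x \<in> M \<Longrightarrow> y \<in> M \<Longrightarrow> foldr act w (x + y) = foldr act w x + foldr act w y"
  by (induction w) (auto simp: act_add word_M)

lemma word_sc: "x \<in> M \<Longrightarrow> foldr act w (sc c x) = sc c (foldr act w x)"
  by (induction w) (auto simp: act_sc word_M)

lemma word_0 [simp]: "foldr act w 0 = 0"
  by (induction w) auto

lemma ws_M: "x \<in> ws la \<Longrightarrow> x \<in> M"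
  and ws_K: "x \<in> ws la \<Longrightarrow> act (Kp i) x = sc (vq powi la i) x"
  by (auto simp: wspace_def)

lemma ws_0 [simp]: "0 \<in> ws la"
  by (simp add: wspace_def)

lemma ws_add: "x \<in> ws la \<Longrightarrow> y \<in> ws la \<Longrightarrow> x + y \<in> ws la"
  by (auto simp: wspace_def act_add scale_right_distrib)

lemma ws_sc: "x \<in> ws la \<Longrightarrow> sc c x \<in> ws la"
  by (auto simp: wspace_def act_sc scale_left_commute)

lemma ws_neg: "x \<in> ws la \<Longrightarrow> - x \<in> ws la"
  using ws_sc[of x la "-1"] by simp

lemma ws_Km:
  assumes "x \<in> ws la" shows "act (Km i) x = sc (vq powi (- la i)) x"
proof -
  have x: "x \<in> M" using assms by (rule ws_M)
  have "x = sc (vq powi la i) (act (Km i) x)"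
    using KmK[OF x, of i] ws_K[OF assms, of i] act_sc[OF x, of "Km i" "vq powi la i"] by simp
  then have "sc (vq powi (- la i)) x = sc (vq powi (- la i)) (sc (vq powi la i) (act (Km i) x))"
    by simp
  then show ?thesis by (simp add: power_int_minus)
qed

lemma ws_act:
  assumes "x \<in> ws la" shows "act g x \<in> ws (gsh g la)"
proof -
  have x: "x \<in> M" using assms by (rule ws_M)
  have K: "act (Kp i) x = sc (vq powi la i) x" for i using ws_K[OF assms] .
  show ?thesis
  proof (cases g)
    case (E j)
    then show ?thesis using x
      by (auto simp: wspace_def KE K act_sc up_def power_int_add power_int_diff mult.commute)
  next
    case (F j)
    then show ?thesis using x
      by (auto simp: wspace_def KF K act_sc dn_def power_int_add power_int_diff mult.commute)
  next
    case (Kp j)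
    then show ?thesis using assms by (simp add: K ws_sc)
  next
    case (Km j)
    then show ?thesis using assms by (simp add: ws_Km[OF assms] ws_sc)
  qed
qed

lemma ws_word: "x \<in> ws la \<Longrightarrow> foldr act w x \<in> ws (foldr gsh w la)"
  by (induction w) (auto intro: ws_act)

lemma EF_ws:
  assumes "x \<in> ws la"
  shows "act (E i) (act (F i) x) = act (F i) (act (E i) x) + sc (qint (la i - la (i + 1))) x"
proof -
  have x: "x \<in> M" using assms by (rule ws_M)
  have "act (Kp i) (act (Km (i + 1)) x) = sc (vq powi (la i - la (i + 1))) x"
    using assms x by (simp add: ws_Km[OF assms] act_sc ws_K power_int_diff power_int_minus divide_inverse mult.commute)
  moreover have "act (Km i) (act (Kp (i + 1)) x) = sc (vq powi (- (la i - la (i + 1)))) x"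
    using assms x by (simp add: ws_Km[OF assms] act_sc ws_K power_int_diff power_int_minus divide_inverse mult.commute)
  ultimately have "act (E i) (act (F i) x) - act (F i) (act (E i) x) = sc (qint (la i - la (i + 1))) x"
    using EF[OF x, of i i] by (simp add: qint_def scale_left_diff_distrib[symmetric] divide_inverse mult.commute del: minus_diff_eq)
  then show ?thesis by (simp add: algebra_simps)
qed

lemma ws_unique: "x \<in> ws la \<Longrightarrow> x \<in> ws mu \<Longrightarrow> la \<noteq> mu \<Longrightarrow> x = 0"
  by (auto simp: wspace_def fun_eq_iff)

definition subm :: "'m set \<Rightarrow> bool" where
  "subm N \<longleftrightarrow> N \<subseteq> M \<and> 0 \<in> N \<and> (\<forall>x\<in>N. \<forall>y\<in>N. x + y \<in> N) \<and> (\<forall>c. \<forall>x\<in>N. sc c x \<in> N) \<and>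
     (\<forall>g. \<forall>x\<in>N. act g x \<in> N)"

lemma subm_0 [simp]: "subm {0}"
  by (simp add: subm_def)

lemma subm_sum: "subm N \<Longrightarrow> (\<And>a. a \<in> A \<Longrightarrow> f a \<in> N) \<Longrightarrow> sum f A \<in> N"
  by (induction A rule: infinite_finite_induct) (auto simp: subm_def)

lemma subm_diff: "subm N \<Longrightarrow> x \<in> N \<Longrightarrow> y \<in> N \<Longrightarrow> x - y \<in> N"
proof -
  assume N: "subm N" "x \<in> N" "y \<in> N"
  then have "x + sc (- 1) y \<in> N" unfolding subm_def by blast
  then show ?thesis by simp
qed

text \<open>Weight components of an element of a submodule stay in it. Instead of a Vandermonde
  argument, one component is removed at a time by an operator \<open>Kp i - vq powi l0 i\<close>
  with \<open>i\<close> separating two given weights.\<close>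

lemma subm_component:
  assumes N: "subm N" and "finite A" and "\<forall>la\<in>A. y la \<in> ws la" and "(\<Sum>la\<in>A. y la) \<in> N"
  shows "\<forall>la\<in>A. y la \<in> N"
  using assms(2-4)
proof (induction A arbitrary: y rule: finite_induct)
  case (insert l0 A)
  let ?s = "\<Sum>la\<in>insert l0 A. y la"
  have sN: "?s \<in> N" using insert.prems by simp
  have yM: "y la \<in> M" if "la \<in> insert l0 A" for la using that insert.prems ws_M by blast
  have "y la \<in> N" if la: "la \<in> A" for la
  proof -
    have "la \<noteq> l0" using la insert.hyps by auto
    then obtain i where i: "la i \<noteq> l0 i" by auto
    let ?y' = "\<lambda>la. sc (vq powi la i - vq powi l0 i) (y la)"
    \<comment> \<open>This kills the component of weight \<open>l0\<close> and multiplies that of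
      weight \<open>la\<close> by a nonzero scalar. Other components may be killed as well, which is
      harmless since \<open>i\<close> is chosen anew for each \<open>la\<close>.\<close>
    have "act (Kp i) ?s - sc (vq powi l0 i) ?s = (\<Sum>la\<in>A. ?y' la)"
    proof -
      have "act (Kp i) ?s = (\<Sum>la\<in>insert l0 A. sc (vq powi la i) (y la))"
        using insert.prems yM by (subst act_sum) (auto intro!: sum.cong simp: ws_K)
      then have "act (Kp i) ?s - sc (vq powi l0 i) ?s = (\<Sum>la\<in>insert l0 A. ?y' la)"
        by (simp add: scale_sum_right sum_subtractf[symmetric] scale_left_diff_distrib)
      then show ?thesis using insert.hyps by simp
    qed
    moreover have "act (Kp i) ?s - sc (vq powi l0 i) ?s \<in> N"
      using N sN by (intro subm_diff) (auto simp: subm_def)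
    ultimately have "(\<Sum>la\<in>A. ?y' la) \<in> N" by argo
    moreover have "\<forall>la\<in>A. ?y' la \<in> ws la" using insert.prems(1) ws_sc by blast
    ultimately have "\<forall>la\<in>A. ?y' la \<in> N" by (intro insert.IH)
    then have "?y' la \<in> N" using la by blast
    then have "sc (inverse (vq powi la i - vq powi l0 i)) (?y' la) \<in> N"
      using N unfolding subm_def by blast
    then show ?thesis using i by simp
  qed
  moreover have "y l0 \<in> N"
  proof -
    have "y l0 = ?s - (\<Sum>la\<in>A. y la)" using insert.hyps by simp
    moreover have "(\<Sum>la\<in>A. y la) \<in> N"
      using \<open>\<And>la. la \<in> A \<Longrightarrow> y la \<in> N\<close> by (rule subm_sum[OF N])
    ultimately show ?thesis using subm_diff[OF N sN] by metis
  qed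
  ultimately show ?case by auto
qed simp

lemma span_weights:
  assumes "x \<in> span {y. \<exists>la\<in>S. y \<in> ws la}"
  shows "\<exists>A f. finite A \<and> A \<subseteq> S \<and> (\<forall>la\<in>A. f la \<in> ws la) \<and> x = (\<Sum>la\<in>A. f la)"
  using assms
proof (induction rule: span_induct_alt)
  case base
  then show ?case by (intro exI[of _ "{}"]) simp
next
  case (step c x y)
  then obtain A f la where A: "finite A" "A \<subseteq> S" "\<forall>la\<in>A. f la \<in> ws la" "y = (\<Sum>la\<in>A. f la)"
    and la: "la \<in> S" "x \<in> ws la" by blast
  define f' where "f' = (\<lambda>nu. (if nu \<in> A then f nu else 0) + (if nu = la then sc c x else 0))"
  have "(\<Sum>nu\<in>insert la A. f' nu) = (\<Sum>nu\<in>insert la A. if nu \<in> A then f nu else 0) + sc c x"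
    unfolding f'_def sum.distrib using A(1) by simp
  also have "(\<Sum>nu\<in>insert la A. if nu \<in> A then f nu else 0) = (\<Sum>nu\<in>A. f nu)"
    using A(1) by (intro sum.mono_neutral_cong_right) auto
  finally have "(\<Sum>nu\<in>insert la A. f' nu) = sc c x + y" using A(4) by (simp add: add.commute)
  moreover have "\<forall>nu\<in>insert la A. f' nu \<in> ws nu"
    using A la by (auto simp: f'_def intro!: ws_add ws_sc)
  ultimately show ?case using A la by (intro exI[of _ "insert la A"] exI[of _ f']) auto
qed

text \<open>The sum of weight spaces is direct. This is \<open>subm_component\<close> for the zero
  submodule, with \<open>- x\<close> as the component of weight \<open>mu\<close> that makes the
  total vanish.\<close>

lemma span_other_weights_zero:
  assumes "x \<in> span {y. \<exists>la\<in>- {mu}. y \<in> ws la}" "x \<in> ws mu"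
  shows "x = 0"
proof -
  obtain A f where A: "finite A" "A \<subseteq> - {mu}" "\<forall>la\<in>A. f la \<in> ws la" "x = (\<Sum>la\<in>A. f la)"
    using span_weights[OF assms(1)] by auto
  have "(\<Sum>la\<in>insert mu A. (f(mu := - x)) la) = - x + (\<Sum>la\<in>A. f la)"
    using A by (subst sum.insert) (auto intro!: sum.cong)
  then have "(\<Sum>la\<in>insert mu A. (f(mu := - x)) la) \<in> {0}" using A by simp
  from subm_component[OF subm_0 _ _ this] have "(f(mu := - x)) mu \<in> {0}"
    using A(1,3) ws_neg[OF assms(2)] by (metis (no_types, lifting) finite_insert fun_upd_apply insert_iff)
  then show ?thesis by simp
qed

text \<open>The submodule U x. It does not mention \<open>M\<close>, so the submodule generated in
  tensor space and the one generated inside a submodule are the same term.\<close>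

definition cyc :: "'m \<Rightarrow> 'm set" where "cyc x = span (range (\<lambda>w. foldr act w x))"

lemma cyc_self: "x \<in> cyc x"
  unfolding cyc_def by (rule span_base) (auto intro: range_eqI[of _ _ "[]"])

lemma cyc_word: "foldr act w x \<in> cyc x"
  unfolding cyc_def by (rule span_base) simp

lemma cyc_least: "subm N \<Longrightarrow> x \<in> N \<Longrightarrow> cyc x \<subseteq> N"
proof -
  assume N: "subm N" and x: "x \<in> N"
  have "foldr act w x \<in> N" for w using N x by (induction w) (auto simp: subm_def)
  moreover have "subspace N" using N by (auto simp: subm_def subspace_def)
  ultimately show ?thesis unfolding cyc_def by (intro span_minimal) auto
qed

lemma subm_M: "subm M"
  by (auto simp: subm_def)

lemma subm_cyc:
  assumes x: "x \<in> M" shows "subm (cyc x)"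
proof -
  have sub: "cyc x \<subseteq> M" using cyc_least[OF subm_M x] .
  have "y \<in> M \<and> act g y \<in> cyc x" if "y \<in> cyc x" for g y
    using that[unfolded cyc_def]
  proof (induction rule: span_induct_alt)
    case base
    then show ?case by (simp add: cyc_def span_zero)
  next
    case (step c u y)
    then obtain w where u: "u = foldr act w x" by auto
    have "y \<in> M" using step.IH by blast
    then have "act g (sc c u + y) = sc c (act g u) + act g y"
      using u x by (simp add: act_add act_sc word_M M_sc)
    moreover have "act g u \<in> cyc x" using cyc_word[of "g # w"] u by simp
    ultimately show ?case using step.IH u x by (auto simp: cyc_def span_add span_scale)
  qed
  then show ?thesis using sub by (auto simp: subm_def cyc_def span_zero span_add span_scale)
qed

text \<open>The quantum sl2 string of a vector killed by \<open>E i\<close>; its coefficient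
  vanishes only when \<open>k\<close> reaches \<open>la i - la (i + 1)\<close>.\<close>

lemma EFk:
  assumes x: "x \<in> ws la" and e: "act (E i) x = 0"
  shows "act (E i) (foldr act (replicate (Suc k) (F i)) x)
     = sc (qint (int k + 1) * qint (la i - la (i + 1) - int k)) (foldr act (replicate k (F i)) x)"
proof -
  have W: "foldr act (replicate k (F i)) x \<in> ws (foldr gsh (replicate k (F i)) la)" for k
    using ws_word[OF x] .
  have d: "foldr gsh (replicate k (F i)) la i - foldr gsh (replicate k (F i)) la (i + 1)
      = la i - la (i + 1) - 2 * int k" for k
    unfolding foldr_replicate by (induction k) (auto simp: dn_def dl_def)
  show ?thesis
  proof (induction k)
    case 0
    then show ?case using EF_ws[OF x, of i] e by simp
  next
    case (Suc k)
    let ?y = "foldr act (replicate (Suc k) (F i)) x"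
    have "act (E i) (act (F i) ?y) = act (F i) (act (E i) ?y) + sc (qint (la i - la (i + 1) - 2 * int (Suc k))) ?y"
      using EF_ws[OF W[of "Suc k"], of i] unfolding d .
    also have "act (F i) (act (E i) ?y) = sc (qint (int k + 1) * qint (la i - la (i + 1) - int k)) ?y"
      unfolding Suc.IH by (subst act_sc[OF word_M[OF ws_M[OF x]]]) simp
    finally show ?case
      by (simp only: replicate_Suc[of "Suc k"] foldr.simps o_apply qint_rec_Suc scale_left_distrib)
  qed
qed

lemma FEk:
  assumes x: "x \<in> ws la" and e: "act (F i) x = 0"
  shows "act (F i) (foldr act (replicate (Suc k) (E i)) x)
     = sc (qint (int k + 1) * qint (la (i + 1) - la i - int k)) (foldr act (replicate k (E i)) x)"
proof -
  have W: "foldr act (replicate k (E i)) x \<in> ws (foldr gsh (replicate k (E i)) la)" for k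
    using ws_word[OF x] .
  have d: "foldr gsh (replicate k (E i)) la (i + 1) - foldr gsh (replicate k (E i)) la i
      = la (i + 1) - la i - 2 * int k" for k
    unfolding foldr_replicate by (induction k) (auto simp: up_def dl_def)
  \<comment> \<open>Exchanging the roles of E and F exchanges \<open>i\<close> and
    \<open>i + 1\<close>, because [-n] = -[n].\<close>
  have FE: "act (F i) (act (E i) y) = act (E i) (act (F i) y) + sc (qint (nu (i + 1) - nu i)) y" if "y \<in> ws nu" for y nu
  proof -
    have "qint (nu (i + 1) - nu i) = - qint (nu i - nu (i + 1))" by (simp add: qint_def minus_divide_left)
    then show ?thesis using EF_ws[OF that, of i] by simp
  qed
  show ?thesis
  proof (induction k)
    case 0
    then show ?case using FE[OF x] e by simp
  next
    case (Suc k)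
    let ?y = "foldr act (replicate (Suc k) (E i)) x"
    have "act (F i) (act (E i) ?y) = act (E i) (act (F i) ?y) + sc (qint (la (i + 1) - la i - 2 * int (Suc k))) ?y"
      using FE[OF W[of "Suc k"]] unfolding d .
    also have "act (E i) (act (F i) ?y) = sc (qint (int k + 1) * qint (la (i + 1) - la i - int k)) ?y"
      unfolding Suc.IH by (subst act_sc[OF word_M[OF ws_M[OF x]]]) simp
    finally show ?case
      by (simp only: replicate_Suc[of "Suc k"] foldr.simps o_apply qint_rec_Suc scale_left_distrib)
  qed
qed

end

section \<open>Reversible moves between weight spaces\<close>

context umodule
begin

text \<open>One pair of words works for the entire weight space, with \<open>w'\<close> a left
  inverse of \<open>w\<close> up to the scalar \<open>c\<close>. The bound \<open>L\<close> is
  carried along because conjugating a word by such a pair must not introduce smaller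
  indices.\<close>

definition ws_embeds :: "int \<Rightarrow> (int \<Rightarrow> int) \<Rightarrow> (int \<Rightarrow> int) \<Rightarrow> bool" where
  "ws_embeds L la mu \<longleftrightarrow> (\<exists>w w' c. list_all (gok L) w \<and> list_all (gok L) w' \<and>
     (\<forall>x\<in>ws la. foldr act w x \<in> ws mu \<and> sc c (foldr act w' (foldr act w x)) = x))"

lemma ws_embeds_refl: "ws_embeds L la la"
  unfolding ws_embeds_def by (intro exI[of _ "[]"] exI[of _ 1]) simp

lemma ws_embeds_trans:
  assumes "ws_embeds L la mu" "ws_embeds L mu nu" shows "ws_embeds L la nu"
proof -
  obtain w1 v1 c where 1: "list_all (gok L) w1" "list_all (gok L) v1"
    "\<And>x. x \<in> ws la \<Longrightarrow> foldr act w1 x \<in> ws mu" "\<And>x. x \<in> ws la \<Longrightarrow> sc c (foldr act v1 (foldr act w1 x)) = x"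
    using assms(1) unfolding ws_embeds_def by metis
  obtain w2 v2 d where 2: "list_all (gok L) w2" "list_all (gok L) v2"
    "\<And>x. x \<in> ws mu \<Longrightarrow> foldr act w2 x \<in> ws nu" "\<And>x. x \<in> ws mu \<Longrightarrow> sc d (foldr act v2 (foldr act w2 x)) = x"
    using assms(2) unfolding ws_embeds_def by metis
  have "sc (c * d) (foldr act (v1 @ v2) (foldr act (w2 @ w1) x)) = x" if x: "x \<in> ws la" for x
  proof -
    let ?y = "foldr act w1 x"
    have y: "?y \<in> M" using x by (metis ws_M word_M)
    have "sc d (foldr act v1 (foldr act v2 (foldr act w2 ?y))) = foldr act v1 ?y"
      using 2(4)[OF 1(3)[OF x]] y by (metis word_M word_sc)
    then show ?thesis using 1(4)[OF x] by (simp flip: scale_scale)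
  qed
  then show ?thesis unfolding ws_embeds_def using 1 2
    by (intro exI[of _ "w2 @ w1"] exI[of _ "v1 @ v2"] exI[of _ "c * d"]) auto
qed

lemma ws_embeds_nonzero: "ws_embeds L la mu \<Longrightarrow> x \<in> ws la \<Longrightarrow> x \<noteq> 0 \<Longrightarrow> \<exists>y\<in>ws mu. y \<noteq> 0"
  unfolding ws_embeds_def by (metis scale_zero_right word_0)

text \<open>The innermost \<open>E i\<close> meets F^k x and \<open>EFk\<close> turns it into a
  scalar, so the constants of the string multiply up.\<close>

lemma EkFk:
  assumes x: "x \<in> ws la" and e: "act (E i) x = 0"
  shows "foldr act (replicate k (E i)) (foldr act (replicate k (F i)) x)
     = sc (\<Prod>j<k. qint (int j + 1) * qint (la i - la (i + 1) - int j)) x"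
proof (induction k)
  case (Suc k)
  have "foldr act (replicate (Suc k) (E i)) y = foldr act (replicate k (E i)) (act (E i) y)" for y
    using replicate_append_same[of k "E i"] by (metis foldr.simps foldr_append id_apply o_apply replicate_Suc)
  then have "foldr act (replicate (Suc k) (E i)) (foldr act (replicate (Suc k) (F i)) x)
    = foldr act (replicate k (E i)) (sc (qint (int k + 1) * qint (la i - la (i + 1) - int k)) (foldr act (replicate k (F i)) x))"
    using EFk[OF x e, of k] by metis
  also have "\<dots> = sc (qint (int k + 1) * qint (la i - la (i + 1) - int k))
     (foldr act (replicate k (E i)) (foldr act (replicate k (F i)) x))"
    by (rule word_sc) (use x ws_M in blast)
  finally show ?case unfolding Suc.IH by (simp add: mult.commute)
qed simp

lemma FkEk:
  assumes x: "x \<in> ws la" and e: "act (F i) x = 0"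
  shows "foldr act (replicate k (F i)) (foldr act (replicate k (E i)) x)
     = sc (\<Prod>j<k. qint (int j + 1) * qint (la (i + 1) - la i - int j)) x"
proof (induction k)
  case (Suc k)
  have "foldr act (replicate (Suc k) (F i)) y = foldr act (replicate k (F i)) (act (F i) y)" for y
    using replicate_append_same[of k "F i"] by (metis foldr.simps foldr_append id_apply o_apply replicate_Suc)
  then have "foldr act (replicate (Suc k) (F i)) (foldr act (replicate (Suc k) (E i)) x)
    = foldr act (replicate k (F i)) (sc (qint (int k + 1) * qint (la (i + 1) - la i - int k)) (foldr act (replicate k (E i)) x))"
    using FEk[OF x e, of k] by metis
  also have "\<dots> = sc (qint (int k + 1) * qint (la (i + 1) - la i - int k))
     (foldr act (replicate k (F i)) (foldr act (replicate k (E i)) x))"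
    by (rule word_sc) (use x ws_M in blast)
  finally show ?case unfolding Suc.IH by (simp add: mult.commute)
qed simp

end

text \<open>The condition on weights alone, separated from decomposability so that it passes
  directly to submodules and products.\<close>

definition polw :: "(qv \<Rightarrow> 'm::ab_group_add \<Rightarrow> 'm) \<Rightarrow> 'm set \<Rightarrow> (gen \<Rightarrow> 'm \<Rightarrow> 'm) \<Rightarrow> bool" where
  "polw sc M act \<longleftrightarrow> (\<forall>la x. x \<in> wspace sc M act la \<and> x \<noteq> 0 \<longrightarrow> (\<forall>i. 0 \<le> la i) \<and> finite {i. la i \<noteq> 0})"

locale polmod = umodule +
  assumes pol: "polw sc M act"
begin

lemma pol_nonneg: "x \<in> ws la \<Longrightarrow> la i < 0 \<Longrightarrow> x = 0"
  using pol unfolding polw_def by (metis not_less)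

lemma pol_finite: "x \<in> ws la \<Longrightarrow> x \<noteq> 0 \<Longrightarrow> finite {i. la i \<noteq> 0}"
  using pol unfolding polw_def by blast

lemma foldr_gsh_F: "foldr gsh (replicate k (F i)) la = (\<lambda>j. la j + int k * dl j (i + 1) - int k * dl j i)"
  by (induction k) (auto simp: dn_def algebra_simps)

lemma foldr_gsh_E: "foldr gsh (replicate k (E i)) la = (\<lambda>j. la j + int k * dl j i - int k * dl j (i + 1))"
  by (induction k) (auto simp: up_def algebra_simps)

text \<open>The place \<open>i + 1\<close> is empty, so \<open>E i\<close> would create a negative
  entry there and kills the weight space. By \<open>EkFk\<close> the move is undone up to a product
  of [j+1][la i - j] with \<open>j < k \<le> la i\<close>, in which no factor vanishes.\<close>

lemma ws_embeds_F:
  assumes "L \<le> i" "la (i + 1) = 0" "int k \<le> la i"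
  shows "ws_embeds L la (\<lambda>j. la j + int k * dl j (i + 1) - int k * dl j i)"
proof -
  let ?C = "\<Prod>j<k. qint (int j + 1) * qint (la i - la (i + 1) - int j)"
  have C: "?C \<noteq> 0" using assms by auto
  have "act (E i) x = 0" if "x \<in> ws la" for x
    using pol_nonneg[OF ws_act[OF that, of "E i"], of "i + 1"] assms(2) by (simp add: up_def dl_def)
  then have "sc (inverse ?C) (foldr act (replicate k (E i)) (foldr act (replicate k (F i)) x)) = x" if "x \<in> ws la" for x
    using that C by (subst EkFk[OF that]) auto
  then show ?thesis unfolding ws_embeds_def using assms(1) ws_word[of _ la "replicate k (F i)"]
    by (intro exI[of _ "replicate k (F i)"] exI[of _ "replicate k (E i)"] exI[of _ "inverse ?C"])
       (auto simp: list_all_iff foldr_gsh_F simp del: foldr_replicate)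
qed

lemma ws_embeds_E:
  assumes "L \<le> i" "la i = 0" "int k \<le> la (i + 1)"
  shows "ws_embeds L la (\<lambda>j. la j + int k * dl j i - int k * dl j (i + 1))"
proof -
  let ?C = "\<Prod>j<k. qint (int j + 1) * qint (la (i + 1) - la i - int j)"
  have C: "?C \<noteq> 0" using assms by auto
  have "act (F i) x = 0" if "x \<in> ws la" for x
    using pol_nonneg[OF ws_act[OF that, of "F i"], of "i"] assms(2) by (simp add: dn_def dl_def)
  then have "sc (inverse ?C) (foldr act (replicate k (F i)) (foldr act (replicate k (E i)) x)) = x" if "x \<in> ws la" for x
    using that C by (subst FkEk[OF that]) auto
  then show ?thesis unfolding ws_embeds_def using assms(1) ws_word[of _ la "replicate k (E i)"]
    by (intro exI[of _ "replicate k (E i)"] exI[of _ "replicate k (F i)"] exI[of _ "inverse ?C"])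
       (auto simp: list_all_iff foldr_gsh_E simp del: foldr_replicate)
qed

text \<open>A gap is inserted at place \<open>k\<close>, pushing the entries from there on one place
  to the right. Moving the gap from beyond the support to below it shifts the whole weight by
  one.\<close>

definition ins0 :: "int \<Rightarrow> (int \<Rightarrow> int) \<Rightarrow> int \<Rightarrow> int" where
  "ins0 k la = (\<lambda>j. if j < k then la j else if j = k then 0 else la (j - 1))"

lemma ins0_step:
  "ins0 k la = (\<lambda>j. ins0 (k + 1) la j + la k * dl j (k + 1) - la k * dl j k)"
  "ins0 (k + 1) la = (\<lambda>j. ins0 k la j + la k * dl j k - la k * dl j (k + 1))"
  by (auto simp: ins0_def dl_def)

lemma ins0_large: "(\<And>j. B \<le> j \<Longrightarrow> la j = 0) \<Longrightarrow> ins0 B la = la"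
  by (auto simp: ins0_def fun_eq_iff)

lemma ins0_small: "(\<And>j. j < L \<Longrightarrow> la j = 0) \<Longrightarrow> ins0 L la = (\<lambda>j. la (j - 1))"
  by (auto simp: ins0_def fun_eq_iff)

lemma ws_embeds_ins0:
  assumes "L \<le> k" "\<And>j. 0 \<le> la j"
  shows "ws_embeds L (ins0 (k + 1) la) (ins0 k la)" "ws_embeds L (ins0 k la) (ins0 (k + 1) la)"
proof -
  have k: "int (nat (la k)) = la k" using assms by simp
  have s: "ins0 (k + 1) la (k + 1) = 0" "ins0 (k + 1) la k = la k" "ins0 k la k = 0" "ins0 k la (k + 1) = la k"
    by (auto simp: ins0_def)
  show "ws_embeds L (ins0 (k + 1) la) (ins0 k la)"
    using ws_embeds_F[OF assms(1), of "ins0 (k + 1) la" "nat (la k)"] s k unfolding ins0_step(1)[of k la] by simp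
  show "ws_embeds L (ins0 k la) (ins0 (k + 1) la)"
    using ws_embeds_E[OF assms(1), of "ins0 k la" "nat (la k)"] s k unfolding ins0_step(2)[of k la] by simp
qed

lemma ws_embeds_shift:
  assumes nn: "\<And>j. 0 \<le> la j" and fin: "finite {i. la i \<noteq> 0}" and low: "\<And>j. j < L \<Longrightarrow> la j = 0"
  shows "ws_embeds L la (\<lambda>j. la (j - 1))" "ws_embeds L (\<lambda>j. la (j - 1)) la"
proof -
  obtain B0 where B0: "\<forall>i\<in>{i. la i \<noteq> 0}. i \<le> B0"
    using fin by (meson bdd_above_finite bdd_above_def)
  define B where "B = max L (B0 + 1)"
  have B: "ins0 B la = la"
  proof (rule ins0_large)
    fix j assume "B \<le> j"
    then have "B0 < j" unfolding B_def by simp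
    then show "la j = 0" using B0 by (metis mem_Collect_eq not_less)
  qed
  have LB: "L \<le> B" by (simp add: B_def)
  \<comment> \<open>The gap travels downwards from \<open>B\<close>, where inserting it changes
    nothing, to \<open>L\<close>, where it shifts everything; all moves use indices at least
    \<open>L\<close>.\<close>
  have "ws_embeds L (ins0 B la) (ins0 k la) \<and> ws_embeds L (ins0 k la) (ins0 B la)" if "k \<le> B" "L \<le> k" for k
    using that
  proof (induction k rule: int_le_induct)
    case (step k)
    then have "ws_embeds L (ins0 B la) (ins0 k la)" "ws_embeds L (ins0 k la) (ins0 B la)" by simp_all
    moreover have "ws_embeds L (ins0 k la) (ins0 (k - 1) la)" "ws_embeds L (ins0 (k - 1) la) (ins0 k la)"
      using ws_embeds_ins0[of L "k - 1" la] nn step.prems by simp_all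
    ultimately show ?case by (meson ws_embeds_trans)
  qed (simp add: ws_embeds_refl)
  from this[OF LB] show "ws_embeds L la (\<lambda>j. la (j - 1))" "ws_embeds L (\<lambda>j. la (j - 1)) la"
    unfolding B using ins0_small[OF low] by simp_all
qed

lemma ws_embeds_shifts:
  assumes nn: "\<And>j. 0 \<le> la j" and fin: "finite {i. la i \<noteq> 0}" and low: "\<And>j. j < L \<Longrightarrow> la j = 0"
  shows "ws_embeds L la (\<lambda>j. la (j - int n))" "ws_embeds L (\<lambda>j. la (j - int n)) la"
proof -
  have "ws_embeds L la (\<lambda>j. la (j - int n)) \<and> ws_embeds L (\<lambda>j. la (j - int n)) la"
  proof (induction n)
    case (Suc n)
    let ?l = "\<lambda>j. la (j - int n)"
    have f: "finite {i. ?l i \<noteq> 0}"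
      by (rule finite_subset[OF _ finite_imageI[OF fin, of "\<lambda>i. i + int n"]]) (auto intro: image_eqI[of _ _ "_ - int n"])
    have "ws_embeds L ?l (\<lambda>j. ?l (j - 1))" "ws_embeds L (\<lambda>j. ?l (j - 1)) ?l"
      by (rule ws_embeds_shift; use nn f low in simp)+
    moreover have "(\<lambda>j. ?l (j - 1)) = (\<lambda>j. la (j - int (Suc n)))" by (auto simp: algebra_simps)
    ultimately show ?case using Suc ws_embeds_trans by metis
  qed (simp add: ws_embeds_refl)
  then show "ws_embeds L la (\<lambda>j. la (j - int n))" "ws_embeds L (\<lambda>j. la (j - int n)) la" by auto
qed

text \<open>Vectors killed by all \<open>E i\<close> with \<open>i \<ge> L\<close> generate by words with indices at least \<open>L\<close> just
  the span of the \<open>F\<close>-words, and a nonempty \<open>F\<close>-word lowers the weight at its smallest index.\<close>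

lemma F_word_weight:
  assumes "w \<noteq> []" "set w \<subseteq> range F" shows "foldr gsh w la \<noteq> la"
proof -
  obtain js where js: "w = map F js" using assms(2) by (metis ex_map_conv subset_eq rangeE)
  define m where "m = Min (set js)"
  have ne: "set js \<noteq> {}" using js assms(1) by auto
  then have m: "m \<in> set js" "\<And>j. j \<in> set js \<Longrightarrow> m \<le> j" by (auto simp: m_def)
  have "(\<And>j. j \<in> set ks \<Longrightarrow> m \<le> j) \<Longrightarrow> foldr gsh (map F ks) la m = la m - int (count_list ks m)" for ks
    by (induction ks) (force simp: dn_def dl_def)+
  from this[of js] m have "foldr gsh w la m < la m"
    unfolding js using count_list_0_iff[of js m] by simp
  then show ?thesis by auto
qed

lemma highest_line:
  assumes x: "x \<in> ws mu" and e: "\<And>i. L \<le> i \<Longrightarrow> act (E i) x = 0"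
    and w: "list_all (gok L) w" and wt: "foldr gsh w mu = mu"
  shows "\<exists>c. foldr act w x = sc c x"
proof -
  have xM: "x \<in> M" using x by (rule ws_M)
  define T where "T = span {foldr act u x | u. set u \<subseteq> F ` {L..}}"
  have gen: "foldr act u x \<in> T" if "set u \<subseteq> F ` {L..}" for u
    unfolding T_def using that by (intro span_base) auto
  have TM: "T \<subseteq> M"
    unfolding T_def using xM by (intro span_minimal) (auto simp: subspace_def)
  have lin: "act g y \<in> T" if g: "\<And>u. set u \<subseteq> F ` {L..} \<Longrightarrow> act g (foldr act u x) \<in> T" and y: "y \<in> T" for g y
  proof -
    have "y \<in> T \<and> act g y \<in> T"
      using y unfolding T_def
    proof (induction rule: span_induct_alt)
      case base
      then show ?case by (simp add: span_zero)
    next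
      case (step c v y)
      then obtain u where u: "v = foldr act u x" "set u \<subseteq> F ` {L..}" by auto
      have "v \<in> T" "act g v \<in> T" using gen[OF u(2)] g[OF u(2)] u(1) by auto
      moreover have "act g (sc c v + y) = sc c (act g v) + act g y"
        using step.IH TM \<open>v \<in> T\<close> unfolding T_def[symmetric] by (subst act_add) (auto simp: act_sc)
      ultimately show ?case using step.IH unfolding T_def by (auto intro: span_add span_scale)
    qed
    then show ?thesis by simp
  qed
  have Fcl: "act (F j) y \<in> T" if "L \<le> j" "y \<in> T" for j y
    using lin[of "F j" y] gen[of "F j # _"] that by auto
  \<comment> \<open>Moving \<open>E i\<close> to the right through the \<open>F\<close>-word only
    creates scalar multiples of shorter words, by the commutator on weight vectors; at the end
    \<open>E i\<close> meets \<open>x\<close> and gives 0.\<close>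
  have Ecl: "act (E i) (foldr act u x) \<in> T" if "L \<le> i" "set u \<subseteq> F ` {L..}" for i u
    using that(2)
  proof (induction u)
    case Nil
    then show ?case using e[OF that(1)] by (simp add: T_def span_zero)
  next
    case (Cons g u)
    then obtain j where j: "g = F j" "L \<le> j" by auto
    let ?y = "foldr act u x"
    have y: "?y \<in> ws (foldr gsh u mu)" "?y \<in> M" using ws_word[OF x] ws_M by blast+
    have "act (F j) (act (E i) ?y) \<in> T" using Fcl j Cons by auto
    moreover have "sc c ?y \<in> T" for c using gen[of u] Cons.prems unfolding T_def by (auto intro: span_scale)
    moreover have "\<exists>c. act (E i) (act (F j) ?y) = act (F j) (act (E i) ?y) + sc c ?y"
    proof (cases "i = j")
      case True
      then show ?thesis using EF_ws[OF y(1), of i] by blast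
    next
      case False
      then show ?thesis using EF[OF y(2), of i j] by (intro exI[of _ 0]) simp
    qed
    ultimately show ?case unfolding j T_def using span_add by fastforce
  qed
  have Kcl: "act (Kp i) (foldr act u x) \<in> T" "act (Km i) (foldr act u x) \<in> T" if "set u \<subseteq> F ` {L..}" for i u
    using ws_K[OF ws_word[OF x, of u]] ws_Km[OF ws_word[OF x, of u]] gen[OF that]
    unfolding T_def by (auto intro: span_scale)
  have cl: "act g y \<in> T" if "gok L g" "y \<in> T" for g y
    using that Fcl lin[of g y] Ecl Kcl by (cases g) auto
  have wT: "foldr act w x \<in> T" using w
  proof (induction w)
    case Nil
    then show ?case using gen[of "[]"] by simp
  next
    case (Cons g w)
    then show ?case using cl by auto
  qed
  let ?O = "{y. \<exists>la\<in>- {mu}. y \<in> ws la}"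
  \<comment> \<open>Among the \<open>F\<close>-words only the empty one preserves \<open>mu\<close>,
    so modulo other weights every element of \<open>T\<close> is a multiple of
    \<open>x\<close>.\<close>
  have "y \<in> T \<Longrightarrow> \<exists>c. y - sc c x \<in> span ?O" for y
    unfolding T_def
  proof (induction rule: span_induct_alt)
    case base
    then show ?case by (intro exI[of _ 0]) (simp add: span_zero)
  next
    case (step c v y)
    then obtain u d where u: "v = foldr act u x" "set u \<subseteq> F ` {L..}" and d: "y - sc d x \<in> span ?O" by auto
    show ?case
    proof (cases "u = []")
      case True
      then have "sc c v + y - sc (c + d) x = y - sc d x"
        using u by (simp add: scale_left_distrib)
      then show ?thesis using d by (metis (no_types, lifting))
    next
      case False
      have "foldr gsh u mu \<noteq> mu" using u(2) by (intro F_word_weight[OF False]) auto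
      then have "v \<in> ?O" using ws_word[OF x, of u] u(1) by blast
      then have "sc c v + (y - sc d x) \<in> span ?O" by (intro span_add[OF span_scale[OF span_base] d])
      then show ?thesis by (intro exI[of _ d]) (simp add: algebra_simps)
    qed
  qed
  from this[OF wT] obtain c where c: "foldr act w x - sc c x \<in> span ?O" by blast
  have "foldr act w x + - sc c x \<in> ws mu"
    using ws_word[OF x, of w] wt x by (intro ws_add ws_neg ws_sc) auto
  then have "foldr act w x - sc c x = 0" using span_other_weights_zero[OF c] by simp
  then show ?thesis by auto
qed

text \<open>The word \<open>w\<close> is conjugated by the shift \<open>v\<close> from
  \<open>mu\<close> to its translate \<open>mt\<close>. With respect to the generators of index at
  least \<open>L\<close> the shifted vector is highest, so \<open>highest_line\<close> applies to
  \<open>v @ w @ v'\<close>; the left inverse \<open>v'\<close> carries the resulting scalar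
  back.\<close>

lemma weight_line:
  assumes x: "x \<in> ws mu" and top: "\<And>i. 1 \<le> i \<Longrightarrow> ws (up i mu) \<subseteq> {0}" and low: "\<And>j. j \<le> 0 \<Longrightarrow> mu j = 0"
    and wt: "foldr gsh w mu = mu"
  shows "\<exists>c. foldr act w x = sc c x"
proof (cases "x = 0")
  case False
  have nn: "0 \<le> mu j" for j using pol_nonneg[OF x, of j] False by (meson not_less)
  have fin: "finite {i. mu i \<noteq> 0}" using pol_finite[OF x False] .
  have gm: "gok a g \<Longrightarrow> b \<le> a \<Longrightarrow> gok b g" for a b g by (cases g) auto
  have "\<exists>n. gok (1 - int n) g" for g
  proof (cases g)
    case (E i)
    then show ?thesis by (intro exI[of _ "nat (1 - i)"]) auto
  next
    case (F i)
    then show ?thesis by (intro exI[of _ "nat (1 - i)"]) auto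
  qed auto
  then obtain N where N: "\<And>g. gok (1 - int (N g)) g" by metis
  \<comment> \<open>A sum instead of a maximum: it bounds every \<open>N g\<close> and makes sense
    for the empty word.\<close>
  define n where "n = sum_list (map N w)"
  have w: "list_all (gok (1 - int n)) w"
    unfolding list_all_iff
  proof
    fix g assume "g \<in> set w"
    then have "N g \<le> n" unfolding n_def by (intro member_le_sum_list) auto
    then show "gok (1 - int n) g" using gm[OF N] by simp
  qed
  define L where "L = 1 - int n"
  define mt where "mt = (\<lambda>j. mu (j + int n))"
  have mt: "(\<lambda>j. mt (j - int n)) = mu" by (auto simp: mt_def)
  have fmt: "finite {i. mt i \<noteq> 0}"
    unfolding mt_def by (rule finite_subset[OF _ finite_imageI[OF fin, of "\<lambda>i. i - int n"]])
      (auto intro: image_eqI[of _ _ "_ + int n"])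
  \<comment> \<open>The shift lemma moves to the right, so it is applied to \<open>mt\<close>, whose
    translate by \<open>n\<close> is \<open>mu\<close>, and used in its backward direction.\<close>
  have "ws_embeds L mu mt"
    using ws_embeds_shifts(2)[of mt L n] nn fmt low unfolding mt by (auto simp: mt_def L_def)
  then obtain v v' c where v: "list_all (gok L) v" "list_all (gok L) v'"
      "\<And>x. x \<in> ws mu \<Longrightarrow> foldr act v x \<in> ws mt"
      "\<And>x. x \<in> ws mu \<Longrightarrow> sc c (foldr act v' (foldr act v x)) = x"
    unfolding ws_embeds_def by metis
  let ?z = "foldr act v x" and ?y = "foldr act w x"
  have z: "?z \<in> ws mt" using v(3)[OF x] .
  have y: "?y \<in> ws mu" using ws_word[OF x, of w] wt by simp
  \<comment> \<open>A nonzero image would have weight \<open>up i mt\<close>. Shifted right by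
    \<open>n\<close> this is \<open>up (i + int n) mu\<close> with \<open>i + n \<ge> 1\<close>, a
    weight excluded by \<open>top\<close>.\<close>
  have e: "act (E i) ?z = 0" if i: "L \<le> i" for i
  proof (rule ccontr)
    assume nz: "act (E i) ?z \<noteq> 0"
    have u: "act (E i) ?z \<in> ws (up i mt)" using ws_act[OF z, of "E i"] by simp
    have "ws_embeds L (up i mt) (\<lambda>j. up i mt (j - int n))"
    proof (rule ws_embeds_shifts(1))
      show "0 \<le> up i mt j" for j using pol_nonneg[OF u, of j] nz by (meson not_less)
      show "finite {j. up i mt j \<noteq> 0}" using pol_finite[OF u nz] .
      show "up i mt j = 0" if "j < L" for j
        using that i low by (auto simp: up_def dl_def mt_def L_def)
    qed
    moreover have "(\<lambda>j. up i mt (j - int n)) = up (i + int n) mu"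
      by (auto simp: up_def dl_def mt_def fun_eq_iff)
    ultimately have "\<exists>y\<in>ws (up (i + int n) mu). y \<noteq> 0" using ws_embeds_nonzero u nz by metis
    then show False using top[of "i + int n"] i by (auto simp: L_def)
  qed
  have vy: "foldr act v ?y = sc c (foldr act (v @ w @ v') ?z)"
    using v(4)[OF x] x by (simp add: word_sc[symmetric] word_M ws_M)
  have c0: "c \<noteq> 0" using v(4)[OF x] False by auto
  have "foldr act (v @ w @ v') ?z \<in> ws mt"
    using v(3)[OF y] c0 ws_sc[of "foldr act v ?y" mt "inverse c"] unfolding vy by simp
  show ?thesis
  proof (cases "?y = 0")
    case True
    then show ?thesis by (intro exI[of _ 0]) simp
  next
    case ynz: False
    have "foldr act (v @ w @ v') ?z \<noteq> 0"
      using v(4)[OF y] ynz unfolding vy by auto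
    then have "foldr gsh (v @ w @ v') mt = mt"
      using ws_unique[OF ws_word[OF z, of "v @ w @ v'"] \<open>foldr act (v @ w @ v') ?z \<in> ws mt\<close>] by auto
    from highest_line[OF z e _ this] v(1,2) w obtain d where d: "foldr act (v @ w @ v') ?z = sc d ?z"
      by (auto simp: L_def)
    have "?y = sc c (foldr act v' (sc c (sc d ?z)))" using v(4)[OF y] unfolding vy d by simp
    also have "\<dots> = sc (c * d) (sc c (foldr act v' ?z))"
      using z by (simp add: word_sc ws_M mult.commute mult.left_commute)
    finally show ?thesis using v(4)[OF x] by auto
  qed
qed (auto intro: exI[of _ 0])

end

section \<open>Irreducible polynomial modules are determined by their top weight\<close>

lemma umod_prod:
  assumes "umod sc1 M1 act1" "umod sc2 M2 act2"
  shows "umod (\<lambda>c. map_prod (sc1 c) (sc2 c)) (M1 \<times> M2) (\<lambda>g. map_prod (act1 g) (act2 g))"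
proof -
  interpret A: umodule sc1 M1 act1 using assms(1) by (rule umodule_if_umod)
  interpret B: umodule sc2 M2 act2 using assms(2) by (rule umodule_if_umod)
  have v: "vector_space (\<lambda>c. map_prod (sc1 c) (sc2 c))"
    by unfold_locales (auto simp: A.scale_right_distrib A.scale_left_distrib B.scale_right_distrib B.scale_left_distrib)
  show ?thesis
    unfolding umod_def using v assms
    by (intro conjI) (auto simp: umod_def zero_prod_def)
qed

lemma wspace_prod:
  "wspace (\<lambda>c. map_prod (sc1 c) (sc2 c)) (M1 \<times> M2) (\<lambda>g. map_prod (act1 g) (act2 g)) la
    = wspace sc1 M1 act1 la \<times> wspace sc2 M2 act2 la"
  by (auto simp: wspace_def)

lemma polw_prod:
  assumes "polw sc1 M1 act1" "polw sc2 M2 act2"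
  shows "polw (\<lambda>c. map_prod (sc1 c) (sc2 c)) (M1 \<times> M2) (\<lambda>g. map_prod (act1 g) (act2 g))"
  using assms unfolding polw_def wspace_prod by (auto simp: zero_prod_def)

lemma polmodI: "umod sc M act \<Longrightarrow> polw sc M act \<Longrightarrow> polmod sc M act"
  by (simp add: polmod_def polmod_axioms_def umodule_if_umod)

context polmod
begin

lemma cyc_weight_line:
  assumes x: "x \<in> ws mu" and top: "\<And>i. 1 \<le> i \<Longrightarrow> ws (up i mu) \<subseteq> {0}" and low: "\<And>j. j \<le> 0 \<Longrightarrow> mu j = 0"
    and y: "y \<in> cyc x" "y \<in> ws mu"
  shows "\<exists>c. y = sc c x"
proof -
  let ?O = "{y. \<exists>la\<in>- {mu}. y \<in> ws la}"
  have "\<exists>c. y - sc c x \<in> span ?O"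
    using y(1) unfolding cyc_def
  proof (induction rule: span_induct_alt)
    case base
    then show ?case by (intro exI[of _ 0]) (simp add: span_zero)
  next
    case (step c v y)
    then obtain w d where w: "v = foldr act w x" and d: "y - sc d x \<in> span ?O" by auto
    show ?case
    proof (cases "foldr gsh w mu = mu")
      case True
      then obtain e where "v = sc e x" using weight_line[OF x top low] w by blast
      then have "sc c v + y - sc (c * e + d) x = y - sc d x" by (simp add: scale_left_distrib)
      then show ?thesis using d by (metis (no_types, lifting))
    next
      case False
      then have v: "v \<in> ?O" using ws_word[OF x, of w] w by blast
      have "sc c v + (y - sc d x) \<in> span ?O" by (intro span_add[OF span_scale[OF span_base] d] v)
      then show ?thesis by (intro exI[of _ d]) (simp add: algebra_simps)
    qed
  qed
  then obtain c where c: "y - sc c x \<in> span ?O" by blast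
  have "y + - sc c x \<in> ws mu" using y x by (intro ws_add ws_neg ws_sc)
  then have "y - sc c x = 0" using span_other_weights_zero[OF c] by simp
  then show ?thesis by auto
qed

text \<open>If \<open>mu i < mu (i + 1)\<close>, no coefficient of the string vanishes, so all
  powers of \<open>F i\<close> keep \<open>x\<close> nonzero; but \<open>mu i + 1\<close> of them
  make the entry at \<open>i\<close> negative.\<close>

lemma dominant_if_killed:
  assumes x: "x \<in> ws mu" "x \<noteq> 0" and e: "act (E i) x = 0"
  shows "mu (i + 1) \<le> mu i"
proof (rule ccontr)
  assume lt: "\<not> mu (i + 1) \<le> mu i"
  have nz: "foldr act (replicate k (F i)) x \<noteq> 0" for k
  proof (induction k)
    case (Suc k)
    have "qint (int k + 1) * qint (mu i - mu (i + 1) - int k) \<noteq> 0" using lt by simp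
    then show ?case using EFk[OF x(1) e, of k] Suc by (metis act_0 scale_eq_0_iff)
  qed (use x in simp)
  let ?k = "nat (mu i + 1)"
  have "0 \<le> mu i" using pol_nonneg[OF x(1), of i] x(2) by (meson not_less)
  then have "foldr gsh (replicate ?k (F i)) mu i < 0" unfolding foldr_gsh_F by (simp add: dl_def)
  then show False using pol_nonneg[OF ws_word[OF x(1)]] nz by blast
qed

text \<open>Shifting makes the support positive, so the moment \<open>ms\<close> is nonnegative and
  a minimum exists. For \<open>i \<ge> 1\<close>, \<open>up i\<close> keeps the support positive and
  lowers the moment by 1, hence cannot give a weight of the module.\<close>

lemma ex_top:
  assumes x: "x \<in> ws la" "x \<noteq> 0"
  shows "\<exists>mu y. y \<in> ws mu \<and> y \<noteq> 0 \<and> (\<forall>j\<le>0. mu j = 0) \<and> (\<forall>i\<ge>1. ws (up i mu) \<subseteq> {0})"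
proof -
  define P where "P mu \<longleftrightarrow> (\<exists>y\<in>ws mu. y \<noteq> 0) \<and> (\<forall>j\<le>0. mu j = 0)" for mu
  define ms where "ms mu = (\<Sum>j\<in>{j. mu j \<noteq> 0}. j * mu j)" for mu :: "int \<Rightarrow> int"
  have nn: "0 \<le> la j" for j using pol_nonneg[OF x(1), of j] x(2) by (meson not_less)
  have fin: "finite {j. la j \<noteq> 0}" using pol_finite[OF x] .
  obtain B where B: "\<forall>i\<in>{i. la i \<noteq> 0}. B \<le> i"
    using fin by (meson bdd_below_finite bdd_below_def)
  define n where "n = nat (1 - B)"
  have low: "j < B \<Longrightarrow> la j = 0" for j using B by force
  have "ws_embeds B la (\<lambda>j. la (j - int n))" by (rule ws_embeds_shifts(1)[OF nn fin low])
  then have "\<exists>y\<in>ws (\<lambda>j. la (j - int n)). y \<noteq> 0" using ws_embeds_nonzero x by blast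
  then have "P (\<lambda>j. la (j - int n))" unfolding P_def using low by (auto simp: n_def)
  then obtain mu where mu: "P mu" "\<And>nu. P nu \<Longrightarrow> nat (ms mu) \<le> nat (ms nu)"
    using ex_has_least_nat[of P _ "\<lambda>mu. nat (ms mu)"] by blast
  obtain y where y: "y \<in> ws mu" "y \<noteq> 0" using mu(1) unfolding P_def by blast
  have low': "mu j = 0" if "j \<le> 0" for j using mu(1) that unfolding P_def by blast
  have "ws (up i mu) \<subseteq> {0}" if i: "1 \<le> i" for i
  proof (rule ccontr)
    assume "\<not> ws (up i mu) \<subseteq> {0}"
    then obtain z where z: "z \<in> ws (up i mu)" "z \<noteq> 0" by blast
    have Pz: "P (up i mu)" unfolding P_def using z low' i by (auto simp: up_def dl_def)
    let ?A = "{j. mu j \<noteq> 0} \<union> {i, i + 1}"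
    have A: "finite ?A" using pol_finite[OF y] by simp
    have 1: "ms mu = (\<Sum>j\<in>?A. j * mu j)"
      unfolding ms_def using A by (intro sum.mono_neutral_left) auto
    have "ms (up i mu) = (\<Sum>j\<in>?A. j * up i mu j)"
      unfolding ms_def using A by (intro sum.mono_neutral_left) (auto simp: up_def dl_def split: if_splits)
    also have "\<dots> = (\<Sum>j\<in>?A. j * mu j + (j * dl j i - j * dl j (i + 1)))"
      by (intro sum.cong) (auto simp: up_def algebra_simps)
    also have "\<dots> = ms mu + ((\<Sum>j\<in>?A. j * dl j i) - (\<Sum>j\<in>?A. j * dl j (i + 1)))"
      unfolding 1 by (simp only: sum.distrib sum_subtractf)
    also have "(\<Sum>j\<in>?A. j * dl j i) = i"
      using sum.remove[OF A, of i "\<lambda>j. j * dl j i"] by (simp add: dl_def)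
    also have "(\<Sum>j\<in>?A. j * dl j (i + 1)) = i + 1"
      using sum.remove[OF A, of "i + 1" "\<lambda>j. j * dl j (i + 1)"] by (simp add: dl_def)
    finally have "ms (up i mu) = ms mu - 1" by simp
    moreover have "0 \<le> ms (up i mu)"
      unfolding ms_def
    proof (rule sum_nonneg)
      fix j assume "j \<in> {j. up i mu j \<noteq> 0}"
      then have "0 < j" using Pz unfolding P_def by (metis (mono_tags) mem_Collect_eq not_less)
      moreover have "0 \<le> up i mu j" using pol_nonneg[OF z(1), of j] z(2) by (meson not_less)
      ultimately show "0 \<le> j * up i mu j" by simp
    qed
    ultimately show False using mu(2)[OF Pz] by simp
  qed
  then show ?thesis using y low' by blast
qed

lemma ex_top_partition:
  assumes x: "x \<in> ws la" "x \<noteq> 0"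
  shows "\<exists>r mu y. is_partition r mu \<and> y \<in> ws (\<lambda>i. int (mu i)) \<and> y \<noteq> 0 \<and>
     (\<forall>i\<ge>1. ws (up i (\<lambda>i. int (mu i))) \<subseteq> {0})"
proof -
  obtain mu y where mu: "y \<in> ws mu" "y \<noteq> 0" "\<forall>j\<le>0. mu j = 0" "\<forall>i\<ge>1. ws (up i mu) \<subseteq> {0}"
    using ex_top[OF x] by blast
  have nn: "0 \<le> mu j" for j using pol_nonneg[OF mu(1), of j] mu(2) by (meson not_less)
  have e: "(\<lambda>i. int (nat (mu i))) = mu" using nn by auto
  have step: "mu (i + 1) \<le> mu i" if "1 \<le> i" for i
  proof (rule dominant_if_killed[OF mu(1,2)])
    show "act (E i) y = 0" using ws_act[OF mu(1), of "E i"] mu(4) that by auto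
  qed
  have "mu j \<le> mu i" if "1 \<le> i" "i \<le> j" for i j
    using that(2) by (induction j rule: int_ge_induct) (use step that(1) in \<open>auto intro: order_trans\<close>)
  moreover have "finite {i. nat (mu i) \<noteq> 0}"
    by (rule finite_subset[OF _ pol_finite[OF mu(1,2)]]) auto
  ultimately have "is_partition (rk (\<lambda>i. nat (mu i))) (\<lambda>i. nat (mu i))"
    unfolding is_partition_def using mu(3) by (auto intro: nat_mono)
  then show ?thesis using mu e by metis
qed

end

lemma wmod_nonzero_weight:
  assumes "wmod sc M act" "M \<noteq> {0}"
  shows "\<exists>la. \<exists>x\<in>wspace sc M act la. x \<noteq> 0"
proof (rule ccontr)
  assume no: "\<not> ?thesis"
  have "0 \<in> M" using assms(1) by (auto simp: wmod_def umod_def)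
  then obtain x where x: "x \<in> M" "x \<noteq> 0" using assms(2) by blast
  then obtain ys where ys: "x = sum_list ys" "\<forall>y\<in>set ys. \<exists>la. y \<in> wspace sc M act la"
    using assms(1) unfolding wmod_def by blast
  then have "\<forall>y\<in>set ys. y = 0" using no by blast
  then have "sum_list ys = 0" by (induction ys) auto
  then show False using ys x by simp
qed

lemma irred_subm:
  assumes "irred sc M act" "umodule.subm sc M act N" shows "N = {0} \<or> N = M"
proof -
  interpret umodule sc M act using assms(1) by (auto simp: irred_def intro: umodule_if_umod)
  show ?thesis using assms unfolding irred_def subm_def by blast
qed

text \<open>The submodule generated by \<open>(x1, x2)\<close> in the product of the two modules meets its weight space
  in a line, so it contains neither factor and is the graph of an isomorphism.\<close>

lemma irred_iso_if_same_top:
  fixes sc1 :: "qv \<Rightarrow> 'm::ab_group_add \<Rightarrow> 'm" and sc2 :: "qv \<Rightarrow> 'n::ab_group_add \<Rightarrow> 'n"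
  assumes irr: "irred sc1 M1 act1" "irred sc2 M2 act2" and pol: "polw sc1 M1 act1" "polw sc2 M2 act2"
    and x1: "x1 \<in> wspace sc1 M1 act1 mu" "x1 \<noteq> 0" and x2: "x2 \<in> wspace sc2 M2 act2 mu" "x2 \<noteq> 0"
    and top: "\<And>i. 1 \<le> i \<Longrightarrow> wspace sc1 M1 act1 (up i mu) \<subseteq> {0}"
      "\<And>i. 1 \<le> i \<Longrightarrow> wspace sc2 M2 act2 (up i mu) \<subseteq> {0}"
    and low: "\<And>j. j \<le> 0 \<Longrightarrow> mu j = 0"
  shows "umod_iso sc1 M1 act1 sc2 M2 act2"
proof -
  let ?sc = "\<lambda>c. map_prod (sc1 c) (sc2 c)" and ?act = "\<lambda>g. map_prod (act1 g) (act2 g)"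
  have um: "umod sc1 M1 act1" "umod sc2 M2 act2" using irr by (auto simp: irred_def)
  interpret A: umodule sc1 M1 act1 using um(1) by (rule umodule_if_umod)
  interpret B: umodule sc2 M2 act2 using um(2) by (rule umodule_if_umod)
  interpret P: polmod ?sc "M1 \<times> M2" ?act
    by (intro polmodI umod_prod polw_prod um pol)
  define N where "N = P.cyc (x1, x2)"
  have x: "(x1, x2) \<in> P.ws mu" using x1 x2 by (simp add: wspace_prod)
  have N: "P.subm N" unfolding N_def by (rule P.subm_cyc[OF P.ws_M[OF x]])
  have xN: "(x1, x2) \<in> N" unfolding N_def by (rule P.cyc_self)
  have N': "N \<subseteq> M1 \<times> M2" "0 \<in> N" "\<And>x y. x \<in> N \<Longrightarrow> y \<in> N \<Longrightarrow> x + y \<in> N"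
    "\<And>c x. x \<in> N \<Longrightarrow> ?sc c x \<in> N" "\<And>g x. x \<in> N \<Longrightarrow> ?act g x \<in> N"
    using N unfolding P.subm_def by blast+
  have NM: "y1 \<in> M1" "y2 \<in> M2" if "(y1, y2) \<in> N" for y1 y2
    using that N'(1) by blast+
  have N0: "(0, 0) \<in> N" using N'(2) by (simp add: zero_prod_def)
  have Nadd: "(a + c, b + d) \<in> N" if "(a, b) \<in> N" "(c, d) \<in> N" for a b c d
    using N'(3)[OF that] by simp
  have Nsc: "(sc1 c a, sc2 c b) \<in> N" if "(a, b) \<in> N" for a b c
    using N'(4)[OF that] by simp
  have Nact: "(act1 g a, act2 g b) \<in> N" if "(a, b) \<in> N" for a b g
    using N'(5)[OF that] by simp
  have line: "\<exists>c. y = ?sc c (x1, x2)" if "y \<in> N" "y \<in> P.ws mu" for y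
  proof (rule P.cyc_weight_line[OF x _ low])
    show "P.ws (up i mu) \<subseteq> {0}" if "1 \<le> i" for i
      using top[OF that] unfolding wspace_prod by (auto simp: zero_prod_def)
  qed (use that in \<open>auto simp: N_def\<close>)
  \<comment> \<open>Either pair has weight \<open>mu\<close> in the product, so it would be a
    multiple of \<open>(x1, x2)\<close>, both of whose components are nonzero.\<close>
  have no1: "(x1, 0) \<notin> N" and no2: "(0, x2) \<notin> N"
    using line[of "(x1, 0)"] line[of "(0, x2)"] x1 x2 by (auto simp: wspace_prod)
  have "A.subm {m \<in> M1. (m, 0) \<in> N}"
    using N0 Nadd[of _ 0 _ 0] Nsc[of _ 0] Nact[of _ 0] by (auto simp: A.subm_def)
  then have k1: "m = 0" if "(m, 0) \<in> N" for m
    using irred_subm[OF irr(1)] no1 NM[OF that] that A.ws_M[OF x1(1)] by blast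
  have "B.subm {m \<in> M2. (0, m) \<in> N}"
    using N0 Nadd[of 0 _ 0] Nsc[of 0] Nact[of 0] by (auto simp: B.subm_def)
  then have k2: "m = 0" if "(0, m) \<in> N" for m
    using irred_subm[OF irr(2)] no2 NM[OF that] that B.ws_M[OF x2(1)] by blast
  have Ndiff: "(a - c, b - d) \<in> N" if "(a, b) \<in> N" "(c, d) \<in> N" for a b c d
    using P.subm_diff[OF N that] by simp
  \<comment> \<open>The projections of \<open>N\<close> are submodules containing \<open>x1\<close>
    and \<open>x2\<close>, hence everything by irreducibility; with the trivial kernels
    \<open>k1\<close> and \<open>k2\<close>, \<open>N\<close> is the graph of a bijection.\<close>
  have "A.subm (fst ` N)"
    unfolding A.subm_def
  proof (intro conjI ballI allI)
    show "fst ` N \<subseteq> M1" using N'(1) by force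
    show "0 \<in> fst ` N" using N0 by force
    fix x assume "x \<in> fst ` N"
    then obtain b where x: "(x, b) \<in> N" by force
    show "sc1 c x \<in> fst ` N" for c using image_eqI[OF _ Nsc[OF x, of c], of _ fst] by simp
    show "act1 g x \<in> fst ` N" for g using image_eqI[OF _ Nact[OF x, of g], of _ fst] by simp
    fix y assume "y \<in> fst ` N"
    then obtain d where y: "(y, d) \<in> N" by force
    show "x + y \<in> fst ` N" using image_eqI[OF _ Nadd[OF x y], of _ fst] by simp
  qed
  then have f1: "fst ` N = M1" using irred_subm[OF irr(1)] xN x1(2) by force
  have "B.subm (snd ` N)"
    unfolding B.subm_def
  proof (intro conjI ballI allI)
    show "snd ` N \<subseteq> M2" using N'(1) by force
    show "0 \<in> snd ` N" using N0 by force
    fix x assume "x \<in> snd ` N"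
    then obtain b where x: "(b, x) \<in> N" by force
    show "sc2 c x \<in> snd ` N" for c using image_eqI[OF _ Nsc[OF x, of c], of _ snd] by simp
    show "act2 g x \<in> snd ` N" for g using image_eqI[OF _ Nact[OF x, of g], of _ snd] by simp
    fix y assume "y \<in> snd ` N"
    then obtain d where y: "(d, y) \<in> N" by force
    show "x + y \<in> snd ` N" using image_eqI[OF _ Nadd[OF x y], of _ snd] by simp
  qed
  then have f2: "snd ` N = M2" using irred_subm[OF irr(2)] xN x2(2) by force
  define f where "f m = (SOME n. (m, n) \<in> N)" for m
  have f: "(m, f m) \<in> N" if "m \<in> M1" for m
    using that f1 unfolding f_def by (metis (mono_tags) imageE prod.collapse someI)
  have fu: "n = f m" if "(m, n) \<in> N" for m n
    using k2[of "n - f m"] Ndiff[OF that f[OF NM(1)[OF that]]] by simp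
  have "bij_betw f M1 M2"
  proof (rule bij_betw_imageI)
    show "inj_on f M1"
    proof (rule inj_onI)
      fix a b assume "a \<in> M1" "b \<in> M1" "f a = f b"
      then show "a = b" using k1[of "a - b"] Ndiff[OF f f, of a b] by simp
    qed
    show "f ` M1 = M2"
    proof (intro equalityI subsetI)
      fix n assume "n \<in> M2"
      then obtain m where "(m, n) \<in> N" using f2 by force
      then show "n \<in> f ` M1" using fu NM by blast
    qed (use f NM in blast)
  qed
  moreover have "f (a + b) = f a + f b" if "a \<in> M1" "b \<in> M1" for a b
    using fu[OF Nadd[OF f f]] that by simp
  moreover have "f (sc1 c a) = sc2 c (f a)" if "a \<in> M1" for a c
    using fu[OF Nsc[OF f]] that by simp
  moreover have "f (act1 g a) = act2 g (f a)" if "a \<in> M1" for a g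
    using fu[OF Nact[OF f]] that by simp
  ultimately show ?thesis unfolding umod_iso_def by blast
qed

section \<open>The trivial module and weights of modules in Cr\<close>

lemma umod_L0: "umod (*) (UNIV :: qv set) actL0"
  unfolding umod_def
  by (intro conjI) (unfold_locales, auto simp: actL0_def algebra_simps split: gen.split)

lemma irred_L0: "irred (*) (UNIV :: qv set) actL0"
  unfolding irred_def
proof (intro conjI allI impI)
  show "(UNIV :: qv set) \<noteq> {0}" by (metis UNIV_I singletonD zero_neq_one)
  fix N :: "qv set"
  assume N: "N \<subseteq> UNIV \<and> 0 \<in> N \<and> (\<forall>x\<in>N. \<forall>y\<in>N. x + y \<in> N) \<and> (\<forall>c. \<forall>x\<in>N. c * x \<in> N) \<and>
          (\<forall>g. \<forall>x\<in>N. actL0 g x \<in> N)"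
  show "N = {0} \<or> N = UNIV"
  proof (cases "\<exists>x\<in>N. x \<noteq> 0")
    case True
    then obtain x where x: "x \<in> N" "x \<noteq> 0" by blast
    have "y \<in> N" for y
    proof -
      have "y / x * x \<in> N" using N x by blast
      then show ?thesis using x by simp
    qed
    then show ?thesis by blast
  qed (use N in blast)
qed (rule umod_L0)

lemma wspace_L0: "x \<in> wspace (*) UNIV actL0 la \<Longrightarrow> x \<noteq> 0 \<Longrightarrow> la = (\<lambda>i. 0)"
proof
  fix i assume "x \<in> wspace (*) UNIV actL0 la" "x \<noteq> 0"
  then have "vq powi la i = vq powi 0" by (auto simp: wspace_def actL0_def)
  then show "la i = 0" by (simp del: power_int_0_right)
qed

lemma wmod_L0: "wmod (*) (UNIV :: qv set) actL0"
  unfolding wmod_def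
proof (intro conjI ballI umod_L0)
  fix x :: qv
  have "x \<in> wspace (*) UNIV actL0 (\<lambda>i. 0)" by (simp add: wspace_def actL0_def)
  then show "\<exists>ys. x = sum_list ys \<and> (\<forall>y\<in>set ys. \<exists>la. y \<in> wspace (*) UNIV actL0 la)"
    by (intro exI[of _ "[x]"]) auto
qed

lemma Cpol_L0: "Cpol (*) (UNIV :: qv set) actL0"
  unfolding Cpol_def
proof (intro conjI allI impI wmod_L0)
  fix la :: "int \<Rightarrow> int" and x i
  assume "x \<in> wspace (*) UNIV actL0 la \<and> x \<noteq> 0"
  then have "la = (\<lambda>i. 0)" using wspace_L0 by blast
  then show "0 \<le> la i" "finite {i. la i \<noteq> 0}" by auto
qed

lemma Chi_L0: "Chi (*) (UNIV :: qv set) actL0"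
  unfolding Chi_def
proof (intro conjI ballI wmod_L0)
  fix x :: qv
  have "foldr (\<lambda>i. actL0 (E i)) is x = 0" if "1 \<le> length is" for "is"
    using that by (cases "is") (auto simp: actL0_def)
  then show "\<exists>N. \<forall>is. N \<le> length is \<longrightarrow> foldr (\<lambda>i. actL0 (E i)) is x = 0" by blast
qed

lemma Cpol_polmod: "Cpol sc M act \<Longrightarrow> polmod sc M act"
  by (rule polmodI) (auto simp: Cpol_def wmod_def polw_def)

text \<open>A longest monomial in the \<open>E i\<close> that does not kill \<open>x\<close>
  produces \<open>y\<close> killed by all \<open>E i\<close>. Its weight is then weakly decreasing
  on all of the integers; finite support makes it 0 far to the left, hence everywhere. Now
  \<open>F i\<close> would create an entry -1, so \<open>y\<close> spans a trivial submodule, which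
  is all of \<open>M\<close>.\<close>

lemma Chi_irred_iso_L0:
  fixes sc :: "qv \<Rightarrow> 'm::ab_group_add \<Rightarrow> 'm"
  assumes C: "Cpol sc M act" and H: "Chi sc M act" and irr: "irred sc M act"
  shows "umod_iso sc M act (*) UNIV actL0"
proof -
  interpret polmod sc M act using C by (rule Cpol_polmod)
  obtain la x where x: "x \<in> ws la" "x \<noteq> 0"
    using wmod_nonzero_weight[of sc M act] C irr by (auto simp: Cpol_def irred_def)
  have fE: "foldr (\<lambda>i. act (E i)) is y = foldr act (map E is) y" for "is" y
    by (induction "is") auto
  obtain N where N: "\<And>is. N \<le> length is \<Longrightarrow> foldr act (map E is) x = 0"
    using H ws_M[OF x(1)] unfolding Chi_def fE by blast
  define Q where "Q n \<longleftrightarrow> (\<exists>is. length is = n \<and> foldr act (map E is) x \<noteq> 0)" for n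
  have Qb: "n \<le> N" if "Q n" for n using that N unfolding Q_def by (metis nat_le_linear)
  have Q0: "Q 0" using x by (simp add: Q_def)
  define n where "n = (GREATEST n. Q n)"
  have Qn: "Q n" unfolding n_def by (rule GreatestI_nat[of Q, OF Q0]) (rule Qb)
  have max: "m \<le> n" if "Q m" for m unfolding n_def by (rule Greatest_le_nat[of Q, OF that]) (rule Qb)
  obtain "is" where is': "length is = n" "foldr act (map E is) x \<noteq> 0" using Qn unfolding Q_def by blast
  define y where "y = foldr act (map E is) x"
  define mu where "mu = foldr gsh (map E is) la"
  have y: "y \<in> ws mu" "y \<noteq> 0" using ws_word[OF x(1)] is' by (auto simp: y_def mu_def)
  have Ey: "act (E i) y = 0" for i
  proof (rule ccontr)
    assume "act (E i) y \<noteq> 0"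
    then have "Q (Suc n)" unfolding Q_def y_def using is'(1) by (intro exI[of _ "i # is"]) simp
    then show False using max by fastforce
  qed
  have step: "mu (i + 1) \<le> mu i" for i by (rule dominant_if_killed[OF y Ey])
  have mono: "mu j \<le> mu i" if "i \<le> j" for i j
    using that by (induction j rule: int_ge_induct) (use step in \<open>auto intro: order_trans\<close>)
  have nn: "0 \<le> mu j" for j using pol_nonneg[OF y(1), of j] y(2) by (meson not_less)
  have mu0: "mu j = 0" for j
  proof -
    obtain B where B: "\<forall>i\<in>{i. mu i \<noteq> 0}. B \<le> i"
      using pol_finite[OF y] by (meson bdd_below_finite bdd_below_def)
    then have "mu (min j (B - 1)) = 0" by force
    then show ?thesis using mono[of "min j (B - 1)" j] nn[of j] by simp
  qed
  have Fy: "act (F i) y = 0" for i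
    using pol_nonneg[OF ws_act[OF y(1), of "F i"], of i] by (simp add: mu0 dn_def dl_def)
  have Ky: "act (Kp i) y = y" "act (Km i) y = y" for i
    using ws_K[OF y(1)] ws_Km[OF y(1)] mu0 by simp_all
  have "subm (range (\<lambda>c. sc c y))"
    unfolding subm_def using ws_M[OF y(1)]
  proof (intro conjI allI ballI)
    show "0 \<in> range (\<lambda>c. sc c y)" by (rule range_eqI[of _ _ 0]) simp
    show "a + b \<in> range (\<lambda>c. sc c y)" if "a \<in> range (\<lambda>c. sc c y)" "b \<in> range (\<lambda>c. sc c y)" for a b
      using that by (auto simp: scale_left_distrib[symmetric])
    show "act g a \<in> range (\<lambda>c. sc c y)" if a: "a \<in> range (\<lambda>c. sc c y)" for g a
    proof -
      obtain c where c: "a = sc c y" using a by auto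
      have "0 \<in> range (\<lambda>c. sc c y)" by (rule range_eqI[of _ _ 0]) simp
      then show ?thesis using ws_M[OF y(1)] by (cases g) (auto simp: c act_sc Ey Fy Ky)
    qed
  qed auto
  moreover have "y \<in> range (\<lambda>c. sc c y)" by (rule range_eqI[of _ _ 1]) simp
  ultimately have M: "M = range (\<lambda>c. sc c y)" using irred_subm[OF irr] y(2) by blast
  define f where "f = the_inv_into UNIV (\<lambda>c. sc c y)"
  have inj: "inj (\<lambda>c. sc c y)" using y(2) by (auto intro!: injI)
  have f: "f (sc c y) = c" for c unfolding f_def using the_inv_into_f_f[OF inj] by simp
  have "bij_betw f M UNIV"
    unfolding M by (rule bij_betw_byWitness[where f' = "\<lambda>c. sc c y"]) (auto simp: f)
  moreover have "f (a + b) = f a + f b" if "a \<in> M" "b \<in> M" for a b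
    using that unfolding M by (auto simp: f scale_left_distrib[symmetric])
  moreover have "f (sc c a) = c * f a" if "a \<in> M" for a c
    using that unfolding M by (auto simp: f)
  moreover have "f (act g a) = actL0 g (f a)" if a: "a \<in> M" for g a
  proof -
    obtain c where c: "a = sc c y" using a M by auto
    have "f 0 = 0" using f[of 0] by simp
    then show ?thesis using ws_M[OF y(1)] by (cases g) (auto simp: c act_sc Ey Fy Ky f actL0_def)
  qed
  ultimately show ?thesis unfolding umod_iso_def by blast
qed

text \<open>The product of K_A - v^j over \<open>j < k\<close>, where K_A is the product of the
  \<open>Kp a\<close> for \<open>a\<close> in \<open>A\<close>. On a basis tensor K_A has eigenvalue
  v^m with m the number of letters in \<open>A\<close>, so for distinct \<open>A\<close> and
  \<open>k = r + 1\<close> the product kills r-fold tensors.\<close>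

fun kpoly :: "int list \<Rightarrow> nat \<Rightarrow> (qv \<times> gen list) list" where
  "kpoly A 0 = [(1, [])]"
| "kpoly A (Suc k) = map (\<lambda>(c, w). (c, map Kp A @ w)) (kpoly A k) @
     map (\<lambda>(c, w). (- (vq powi int k) * c, w)) (kpoly A k)"

context umodule
begin

lemma evalp_add: "x \<in> M \<Longrightarrow> y \<in> M \<Longrightarrow> evalp sc act p (x + y) = evalp sc act p x + evalp sc act p y"
  unfolding evalp_def by (induction p) (auto simp: word_add scale_right_distrib)

lemma evalp_sc: "x \<in> M \<Longrightarrow> evalp sc act p (sc c x) = sc c (evalp sc act p x)"
  unfolding evalp_def by (induction p) (auto simp: word_sc scale_right_distrib mult.commute)

lemma evalp_M: "x \<in> M \<Longrightarrow> evalp sc act p x \<in> M"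
  unfolding evalp_def by (induction p) auto

lemma evalp_append: "evalp sc act (p @ q) x = evalp sc act p x + evalp sc act q x"
  by (simp add: evalp_def)

lemma evalp_prefix: "x \<in> M \<Longrightarrow> evalp sc act (map (\<lambda>(c, w). (c, v @ w)) p) x = foldr act v (evalp sc act p x)"
  using evalp_M[of x] unfolding evalp_def by (induction p) (auto simp: word_sc word_add word_M M_sc)

lemma evalp_scale: "evalp sc act (map (\<lambda>(c, w). (d * c, w)) p) x = sc d (evalp sc act p x)"
  unfolding evalp_def by (induction p) (auto simp: scale_right_distrib)

lemma Kword: "x \<in> ws la \<Longrightarrow> foldr act (map Kp A) x = sc (vq powi (sum_list (map la A))) x"
  by (induction A) (auto simp: act_sc ws_M ws_K power_int_add mult.commute)

lemma evalp_kpoly: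
  assumes x: "x \<in> ws la"
  shows "evalp sc act (kpoly A k) x = sc (\<Prod>j<k. vq powi (sum_list (map la A)) - vq powi int j) x"
proof (induction k)
  case 0
  then show ?case by (simp add: evalp_def)
next
  case (Suc k)
  have "evalp sc act (kpoly A (Suc k)) x = foldr act (map Kp A) (evalp sc act (kpoly A k) x)
      + sc (- (vq powi int k)) (evalp sc act (kpoly A k) x)"
    using evalp_prefix[OF ws_M[OF x]] evalp_scale by (simp only: kpoly.simps evalp_append)
  also have "\<dots> = sc (\<Prod>j<Suc k. vq powi (sum_list (map la A)) - vq powi int j) x"
    unfolding Suc.IH using Kword[OF ws_sc[OF x]]
    by (simp add: scale_left_distrib[symmetric] algebra_simps del: power_int_of_nat)
  finally show ?case .
qed

end

section \<open>Tensor space as a module\<close>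

text \<open>Finite support without fixed length: \<open>lin\<close> sums over the support of its
  argument and is meaningful only here, while prefixing a letter leaves
  \<open>tens r\<close>.\<close>

definition FS :: "tv \<Rightarrow> bool" where "FS f \<longleftrightarrow> finite {w. f w \<noteq> 0}"

lemma scT_apply [simp]: "scT c f w = c * f w"
  by (simp add: scT_def)

lemma bas_apply: "bas w u = (if u = w then 1 else 0)"
  by (simp add: bas_def)

lemma fsum_apply: "(\<Sum>a\<in>A. f a) x = (\<Sum>a\<in>A. f a x)"
  by (induction A rule: infinite_finite_induct) auto

lemma FS_0 [simp, intro]: "FS 0"
  by (simp add: FS_def)

lemma FS_add [simp, intro]: "FS f \<Longrightarrow> FS g \<Longrightarrow> FS (f + g)"
  unfolding FS_def by (rule finite_subset[of _ "{w. f w \<noteq> 0} \<union> {w. g w \<noteq> 0}"]) auto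

lemma FS_scT [simp, intro]: "FS f \<Longrightarrow> FS (scT c f)"
  unfolding FS_def by (rule finite_subset[of _ "{w. f w \<noteq> 0}"]) auto

lemma FS_diff [simp, intro]: "FS f \<Longrightarrow> FS g \<Longrightarrow> FS (f - g)"
  unfolding FS_def by (rule finite_subset[of _ "{w. f w \<noteq> 0} \<union> {w. g w \<noteq> 0}"]) auto

lemma FS_bas [simp, intro]: "FS (bas w)"
  unfolding FS_def by (rule finite_subset[of _ "{w}"]) (auto simp: bas_apply)

lemma FS_pre [simp, intro]: "FS f \<Longrightarrow> FS (pre a f)"
  unfolding FS_def
  by (rule finite_subset[of _ "Cons a ` {w. f w \<noteq> 0}"]) (auto simp: pre_def image_iff split: list.split_asm if_splits)

lemma FS_sum: "(\<And>a. a \<in> A \<Longrightarrow> FS (f a)) \<Longrightarrow> FS (sum f A)"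
  by (induction A rule: infinite_finite_induct) auto

lemma vector_space_scT: "vector_space scT"
  by unfold_locales (auto simp: fun_eq_iff algebra_simps)

interpretation T: vector_space scT by (rule vector_space_scT)

lemma pre_bas [simp]: "pre a (bas u) = bas (a # u)"
  by (auto simp: pre_def bas_apply fun_eq_iff split: list.splits)

lemma pre_add: "pre a (f + g) = pre a f + pre a g"
  and pre_diff: "pre a (f - g) = pre a f - pre a g"
  and pre_scT: "pre a (scT c f) = scT c (pre a f)"
  and pre_0 [simp]: "pre a 0 = 0"
  by (auto simp: pre_def fun_eq_iff split: list.splits)

lemma lin_superset:
  assumes "finite A" "{w. f w \<noteq> 0} \<subseteq> A" shows "lin g f u = (\<Sum>w\<in>A. f w * g w u)"
  unfolding lin_def using assms by (intro sum.mono_neutral_left) auto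

lemma lin_add: "FS f \<Longrightarrow> FS h \<Longrightarrow> lin g (f + h) = lin g f + lin g h"
proof
  fix u assume fs: "FS f" "FS h"
  let ?A = "{w. f w \<noteq> 0} \<union> {w. h w \<noteq> 0}"
  have A: "finite ?A" using fs by (simp add: FS_def)
  have "lin g (f + h) u = (\<Sum>w\<in>?A. (f + h) w * g w u)"
    by (rule lin_superset[OF A]) auto
  also have "\<dots> = (\<Sum>w\<in>?A. f w * g w u) + (\<Sum>w\<in>?A. h w * g w u)"
    by (simp add: sum.distrib algebra_simps)
  also have "\<dots> = lin g f u + lin g h u"
    by (subst (1 2) lin_superset[OF A]) auto
  finally show "lin g (f + h) u = (lin g f + lin g h) u" by simp
qed

lemma lin_scT: "FS f \<Longrightarrow> lin g (scT c f) = scT c (lin g f)"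
proof
  fix u assume fs: "FS f"
  let ?A = "{w. f w \<noteq> 0}"
  have A: "finite ?A" using fs by (simp add: FS_def)
  have "lin g (scT c f) u = (\<Sum>w\<in>?A. (scT c f) w * g w u)"
    by (rule lin_superset[OF A]) auto
  then show "lin g (scT c f) u = scT c (lin g f) u"
    unfolding lin_def by (simp add: sum_distrib_left mult.assoc)
qed

lemma lin_bas [simp]: "lin g (bas w) = g w"
proof
  fix u
  have "lin g (bas w) u = (\<Sum>w'\<in>{w}. bas w w' * g w' u)"
    by (rule lin_superset) (auto simp: bas_apply)
  then show "lin g (bas w) u = g w u" by (simp add: bas_apply)
qed

lemma FS_lin: "(\<And>w. FS (g w)) \<Longrightarrow> FS f \<Longrightarrow> FS (lin g f)"
proof -
  assume g: "\<And>w. FS (g w)" and f: "FS f"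
  have "{u. lin g f u \<noteq> 0} \<subseteq> (\<Union>w\<in>{w. f w \<noteq> 0}. {u. g w u \<noteq> 0})"
  proof
    fix u assume "u \<in> {u. lin g f u \<noteq> 0}"
    then have "\<exists>w\<in>{w. f w \<noteq> 0}. f w * g w u \<noteq> 0"
      unfolding lin_def by (rule contrapos_pp) (simp only: mem_Collect_eq bex_simps not_not, rule sum.neutral, auto)
    then show "u \<in> (\<Union>w\<in>{w. f w \<noteq> 0}. {u. g w u \<noteq> 0})" by auto
  qed
  then show ?thesis unfolding FS_def by (rule finite_subset) (use f g in \<open>auto simp: FS_def\<close>)
qed

lemmas fapp = plus_fun_apply zero_fun_apply minus_apply uminus_apply scT_apply

declare fapp [simp del]

text \<open>Linearity is required on finitely supported vectors only, the domain on which
  \<open>lin\<close> is well behaved. Identities between such operators then reduce to basis tensors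
  by \<open>linop_eqI\<close>.\<close>

definition linop :: "(tv \<Rightarrow> tv) \<Rightarrow> bool" where
  "linop T \<longleftrightarrow> (\<forall>f h. FS f \<longrightarrow> FS h \<longrightarrow> T (f + h) = T f + T h) \<and>
     (\<forall>c f. FS f \<longrightarrow> T (scT c f) = scT c (T f)) \<and> (\<forall>f. FS f \<longrightarrow> FS (T f))"

lemma linop_addD: "linop T \<Longrightarrow> FS f \<Longrightarrow> FS h \<Longrightarrow> T (f + h) = T f + T h"
  and linop_scTD: "linop T \<Longrightarrow> FS f \<Longrightarrow> T (scT c f) = scT c (T f)"
  and linop_FSD: "linop T \<Longrightarrow> FS f \<Longrightarrow> FS (T f)"
  by (auto simp: linop_def)

lemma linop_0: "linop T \<Longrightarrow> T 0 = 0"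
  using linop_scTD[of T 0 0] by simp

lemma linop_sum: "linop T \<Longrightarrow> (\<And>a. a \<in> A \<Longrightarrow> FS (f a)) \<Longrightarrow> T (sum f A) = (\<Sum>a\<in>A. T (f a))"
  by (induction A rule: infinite_finite_induct) (auto simp: linop_0 linop_addD FS_sum)

lemma FS_expand: "FS f \<Longrightarrow> f = (\<Sum>w\<in>{w. f w \<noteq> 0}. scT (f w) (bas w))"
  by (auto simp: fapp fun_eq_iff fsum_apply bas_apply FS_def if_distrib[of "\<lambda>x. _ * x"] cong: if_cong)

lemma linop_eqI:
  assumes "linop T" "linop T'" "FS f" "\<And>w. f w \<noteq> 0 \<Longrightarrow> T (bas w) = T' (bas w)"
  shows "T f = T' f"
proof -
  have e: "S f = (\<Sum>w\<in>{w. f w \<noteq> 0}. scT (f w) (S (bas w)))" if S: "linop S" for S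
  proof -
    have "S f = S (\<Sum>w\<in>{w. f w \<noteq> 0}. scT (f w) (bas w))" using FS_expand[OF assms(3)] by metis
    also have "\<dots> = (\<Sum>w\<in>{w. f w \<noteq> 0}. S (scT (f w) (bas w)))" by (rule linop_sum[OF S]) auto
    finally show ?thesis using S by (simp add: linop_scTD)
  qed
  show ?thesis unfolding e[OF assms(1)] e[OF assms(2)] using assms(4) by (auto intro!: sum.cong)
qed

lemma linop_id [intro!, simp]: "linop (\<lambda>f. f)"
  and linop_zero [intro!, simp]: "linop (\<lambda>f. 0)"
  and linop_plus [intro!]: "linop T \<Longrightarrow> linop S \<Longrightarrow> linop (\<lambda>f. T f + S f)"
  and linop_minus [intro!]: "linop T \<Longrightarrow> linop S \<Longrightarrow> linop (\<lambda>f. T f - S f)"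
  and linop_scT [intro!]: "linop T \<Longrightarrow> linop (\<lambda>f. scT c (T f))"
  and linop_pre [intro!]: "linop T \<Longrightarrow> linop (\<lambda>f. pre a (T f))"
  and linop_if [intro!]: "linop T \<Longrightarrow> linop S \<Longrightarrow> linop (\<lambda>f. if b then T f else S f)"
  by (auto simp: linop_def pre_add pre_scT algebra_simps T.scale_left_commute)

lemma linop_comp: "linop T \<Longrightarrow> linop S \<Longrightarrow> linop (\<lambda>f. T (S f))"
  by (auto simp: linop_def)

lemma linop_lin: "(\<And>w. FS (g w)) \<Longrightarrow> linop (lin g)"
  by (auto simp: linop_def lin_add lin_scT FS_lin)

lemma FS_gb [simp, intro]: "FS (gb g w)"
  by (induction g w rule: gb.induct) auto

lemma linop_actT [intro!, simp]: "linop (actT g)"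
  unfolding actT_def by (rule linop_lin) simp

lemma linop_actT' [intro!]: "linop T \<Longrightarrow> linop (\<lambda>f. actT g (T f))"
  using linop_comp[OF linop_actT] .

lemma FS_hb [simp, intro]: "FS (hb j w)"
  by (auto simp: hb_def Let_def)

lemma linop_hs [intro!, simp]: "linop (hs j)"
  unfolding hs_def by (rule linop_lin) simp

lemma linop_hs' [intro!]: "linop T \<Longrightarrow> linop (\<lambda>f. hs j (T f))"
  using linop_comp[OF linop_hs] .

lemma actT_bas [simp]: "actT g (bas w) = gb g w"
  by (simp add: actT_def)

lemma hs_bas [simp]: "hs j (bas w) = hb j w"
  by (simp add: hs_def)

lemma FS_actT [simp, intro]: "FS f \<Longrightarrow> FS (actT g f)"
  and FS_hs [simp, intro]: "FS f \<Longrightarrow> FS (hs j f)"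
  using linop_FSD[of "actT g" f] linop_FSD[of "hs j" f] by auto

lemma actT_add: "FS f \<Longrightarrow> FS h \<Longrightarrow> actT g (f + h) = actT g f + actT g h"
  and actT_scT: "FS f \<Longrightarrow> actT g (scT c f) = scT c (actT g f)"
  and hs_add: "FS f \<Longrightarrow> FS h \<Longrightarrow> hs j (f + h) = hs j f + hs j h"
  and hs_scT: "FS f \<Longrightarrow> hs j (scT c f) = scT c (hs j f)"
  and actT_0 [simp]: "actT g 0 = 0"
  and hs_0 [simp]: "hs j 0 = 0"
  by (simp_all add: linop_addD linop_scTD linop_0)

section \<open>Diagonal operators, the coproduct rule, and the relations of U on tensors\<close>

definition diag :: "(int list \<Rightarrow> qv) \<Rightarrow> tv \<Rightarrow> tv" where "diag h f = (\<lambda>w. h w * f w)"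

lemma FS_diag [simp, intro]: "FS f \<Longrightarrow> FS (diag h f)"
  unfolding FS_def diag_def by (rule finite_subset[of _ "{w. f w \<noteq> 0}"]) auto

lemma linop_diag [intro!, simp]: "linop (diag h)"
  by (auto simp: linop_def) (auto simp: fapp diag_def algebra_simps fun_eq_iff)

lemma linop_diag' [intro!]: "linop T \<Longrightarrow> linop (\<lambda>f. diag h (T f))"
  using linop_comp[OF linop_diag] .

lemma diag_bas [simp]: "diag h (bas w) = scT (h w) (bas w)"
  by (auto simp: fapp diag_def bas_apply fun_eq_iff)

lemma diag_scT: "diag h (scT c f) = scT c (diag h f)"
  by (auto simp: fapp diag_def fun_eq_iff mult.left_commute)

lemma diag_add: "diag h (f + g) = diag h f + diag h g"
  by (auto simp: fapp diag_def algebra_simps fun_eq_iff)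

declare power_int_of_nat [simp del]

lemma gb_Kp: "gb (Kp j) w = scT (vq powi int (count_list w j)) (bas w)"
  by (induction w) (auto simp: pre_scT dl_def power_int_add mult.commute)

lemma gb_Km: "gb (Km j) w = scT (vq powi (- int (count_list w j))) (bas w)"
  by (induction w) (auto simp: pre_scT dl_def power_int_diff power_int_minus divide_inverse mult.commute power_int_add)

lemma actT_Kp: "FS f \<Longrightarrow> actT (Kp j) f = diag (\<lambda>w. vq powi int (count_list w j)) f"
  by (rule linop_eqI[of "actT (Kp j)"]) (auto simp: gb_Kp)

lemma actT_Km: "FS f \<Longrightarrow> actT (Km j) f = diag (\<lambda>w. vq powi (- int (count_list w j))) f"
  by (rule linop_eqI[of "actT (Km j)"]) (auto simp: gb_Km)

abbreviation Dt :: "int \<Rightarrow> tv \<Rightarrow> tv" where "Dt i \<equiv> diag (\<lambda>w. vq powi kt i w)"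
abbreviation Dm :: "int \<Rightarrow> tv \<Rightarrow> tv" where "Dm i \<equiv> diag (\<lambda>w. vq powi (- kt i w))"

lemma kt_Cons: "kt i (a # u) = kt i [a] + kt i u"
  by (simp add: kt_def)

lemma vq_cancel: "vq * (inverse vq * x) = x"
  by (simp flip: mult.assoc)

lemma vq_powi_m2: "vq powi (- 2) = inverse vq * inverse vq"
  by (simp add: power_int_minus power2_eq_square)

lemma kt_single: "kt i [i] = 1" "kt i [i + 1] = - 1" "a \<noteq> i \<Longrightarrow> a \<noteq> i + 1 \<Longrightarrow> kt i [a] = 0"
  by (simp_all add: kt_def)

text \<open>The coproduct for an arbitrary second factor, which lets the relations be proved by
  induction on the tensor with generators already applied to the tail.\<close>

lemma actT_pre_E:
  "FS f \<Longrightarrow> actT (E i) (pre a f) = (if a = i + 1 then pre i (Dt i f) else 0) + pre a (actT (E i) f)"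
  by (rule linop_eqI[of "\<lambda>f. actT (E i) (pre a f)"]) (auto simp: pre_scT)

lemma actT_pre_F:
  "FS f \<Longrightarrow> actT (F i) (pre a f) = (if a = i then pre (i + 1) f else 0) + scT (vq powi (- kt i [a])) (pre a (actT (F i) f))"
  by (rule linop_eqI[of "\<lambda>f. actT (F i) (pre a f)"]) auto

lemma diag_pre: "FS f \<Longrightarrow> diag h (pre a f) = pre a (diag (\<lambda>w. h (a # w)) f)"
  by (rule linop_eqI[of "\<lambda>f. diag h (pre a f)"]) (auto simp: pre_scT)

lemma Dt_pre:
  assumes "FS f" shows "Dt i (pre a f) = scT (vq powi kt i [a]) (pre a (Dt i f))"
proof (rule linop_eqI[OF _ _ assms])
  fix w
  show "Dt i (pre a (bas w)) = scT (vq powi kt i [a]) (pre a (Dt i (bas w)))"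
    by (simp add: pre_scT kt_Cons[of i a w] power_int_add)
qed auto

lemma Dm_pre:
  assumes "FS f" shows "Dm i (pre a f) = scT (vq powi (- kt i [a])) (pre a (Dm i f))"
proof (rule linop_eqI[OF _ _ assms])
  fix w
  show "Dm i (pre a (bas w)) = scT (vq powi (- kt i [a])) (pre a (Dm i (bas w)))"
    by (simp add: pre_scT kt_Cons[of i a w] power_int_add power_int_minus)
qed auto

lemma gb_supp:
  "gb g w u \<noteq> 0 \<Longrightarrow> length u = length w \<and> (\<forall>k. int (count_list u k) = gsh g (\<lambda>k. int (count_list w k)) k)"
proof (induction g w arbitrary: u rule: gb.induct)
  case (5 i a w)
  then consider "a = i + 1" "u = i # w" | u' where "u = a # u'" "gb (E i) w u' \<noteq> 0"
    by (auto simp: fapp pre_def bas_apply split: list.splits if_splits)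
  then show ?case
  proof cases
    case 2
    from "5.IH"[OF 2(2)] show ?thesis unfolding 2(1) by (simp add: up_def)
  qed (auto simp: up_def dl_def)
next
  case (6 i a w)
  then consider "a = i" "u = (i + 1) # w" | u' where "u = a # u'" "gb (F i) w u' \<noteq> 0"
    by (auto simp: fapp pre_def bas_apply split: list.splits if_splits)
  then show ?case
  proof cases
    case 2
    from "6.IH"[OF 2(2)] show ?thesis unfolding 2(1) by (simp add: dn_def)
  qed (auto simp: dn_def dl_def)
qed (auto simp: fapp pre_def bas_apply split: list.splits if_splits)

lemma diag_actT:
  assumes f: "FS f" and h: "\<And>w u. gb g w u \<noteq> 0 \<Longrightarrow> h u = c * h w"
  shows "diag h (actT g f) = scT c (actT g (diag h f))"
  using f
proof (rule linop_eqI[rotated 2])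
  fix w
  show "diag h (actT g (bas w)) = scT c (actT g (diag h (bas w)))"
    using h[of w] by (simp add: actT_scT) (auto simp: diag_def fapp fun_eq_iff)
qed auto

text \<open>The Cartan matrix of type A: 2 on the diagonal, -1 for neighbours, 0 otherwise. It is
  the exponent in the commutation of K_i K_(i+1)^(-1) with \<open>E j\<close>.\<close>

definition cij :: "int \<Rightarrow> int \<Rightarrow> int" where
  "cij i j = dl i j - dl i (j + 1) - dl (i + 1) j + dl (i + 1) (j + 1)"

lemma Dt_E: "FS f \<Longrightarrow> Dt i (actT (E j) f) = scT (vq powi cij i j) (actT (E j) (Dt i f))"
  by (rule diag_actT) (auto dest!: gb_supp simp: kt_def up_def cij_def simp flip: power_int_add)

lemma Dt_F: "FS f \<Longrightarrow> Dt i (actT (F j) f) = scT (vq powi (- cij i j)) (actT (F j) (Dt i f))"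
  by (rule diag_actT) (auto dest!: gb_supp simp: kt_def dn_def cij_def simp flip: power_int_add)

lemma Dm_E: "FS f \<Longrightarrow> Dm i (actT (E j) f) = scT (vq powi (- cij i j)) (actT (E j) (Dm i f))"
  by (rule diag_actT) (auto dest!: gb_supp simp: kt_def up_def cij_def simp flip: power_int_add)

lemma KE_T: "FS f \<Longrightarrow> actT (Kp i) (actT (E j) f) = scT (vq powi (dl i j - dl i (j + 1))) (actT (E j) (actT (Kp i) f))"
  by (simp add: actT_Kp, rule diag_actT) (auto dest!: gb_supp simp: up_def simp del: power_int_of_nat simp flip: power_int_add)

lemma KF_T: "FS f \<Longrightarrow> actT (Kp i) (actT (F j) f) = scT (vq powi (dl i (j + 1) - dl i j)) (actT (F j) (actT (Kp i) f))"
  by (simp add: actT_Kp, rule diag_actT) (auto dest!: gb_supp simp: dn_def simp del: power_int_of_nat simp flip: power_int_add)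

lemmas T_simps = T.scale_right_distrib actT_pre_E actT_pre_F Dt_pre Dm_pre actT_add actT_scT pre_add pre_scT Dt_E Dt_F Dm_E diag_scT diag_add

lemma EE_T:
  assumes "\<bar>i - j\<bar> > 1" "FS f" shows "actT (E i) (actT (E j) f) = actT (E j) (actT (E i) f)"
proof (rule linop_eqI[OF _ _ assms(2)])
  fix w
  have ne: "i \<noteq> j" "i \<noteq> j + 1" "j \<noteq> i + 1" "i + 1 \<noteq> j" "j + 1 \<noteq> i" "i + 1 \<noteq> j + 1" "cij i j = 0" "cij j i = 0"
    using assms(1) by (auto simp: cij_def dl_def)
  show "actT (E i) (actT (E j) (bas w)) = actT (E j) (actT (E i) (bas w))"
  proof (induction w)
    case (Cons a u)
    show ?case unfolding pre_bas[symmetric]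
      using ne Cons.IH by (auto simp: T_simps simp del: pre_bas actT_bas diag_bas)
  qed simp
qed auto

lemma FF_T:
  assumes "\<bar>i - j\<bar> > 1" "FS f" shows "actT (F i) (actT (F j) f) = actT (F j) (actT (F i) f)"
proof (rule linop_eqI[OF _ _ assms(2)])
  fix w
  have ne: "i \<noteq> j" "i \<noteq> j + 1" "j \<noteq> i + 1" "i + 1 \<noteq> j" "j + 1 \<noteq> i" "i + 1 \<noteq> j + 1"
      "kt i [j] = 0" "kt i [j + 1] = 0" "kt j [i] = 0" "kt j [i + 1] = 0"
    using assms(1) by (auto simp: kt_def)
  show "actT (F i) (actT (F j) (bas w)) = actT (F j) (actT (F i) (bas w))"
  proof (induction w)
    case (Cons a u)
    show ?case unfolding pre_bas[symmetric]
      using ne Cons.IH by (auto simp: T_simps mult.commute simp del: pre_bas actT_bas diag_bas)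
  qed simp
qed auto

lemma EF_T_bas:
  "actT (E i) (actT (F j) (bas w)) - actT (F j) (actT (E i) (bas w)) =
     (if i = j then scT (inverse (vq - inverse vq)) (Dt i (bas w) - Dm i (bas w)) else 0)"
proof (induction w)
  case Nil
  then show ?case by (simp add: kt_def)
next
  case (Cons a u)
  define f where "f = bas u"
  have f: "FS f" by (simp add: f_def)
  have IH: "actT (E i) (actT (F j) f) = actT (F j) (actT (E i) f) +
     (if i = j then scT (inverse (vq - inverse vq)) (Dt i f - Dm i f) else 0)"
    using Cons.IH unfolding f_def by (simp only: diff_eq_eq) (simp add: add.commute)
  \<comment> \<open>For \<open>i \<noteq> j\<close> and first letter \<open>i + 1\<close>, the two
    orders of \<open>E i\<close> and \<open>F j\<close> pick up different powers of
    \<open>vq\<close>; this identity matches them.\<close>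
  have kc: "kt j [i] = kt j [i + 1] + cij i j" by (auto simp: kt_def cij_def dl_def)
  show ?case
  proof (cases "i = j")
    case False
    have "actT (E i) (actT (F j) (pre a f)) - actT (F j) (actT (E i) (pre a f)) = 0"
      using False f IH kc
      by (auto simp: T_simps power_int_diff power_int_minus divide_inverse power_int_add mult.commute
          simp del: pre_bas actT_bas diag_bas)
    then show ?thesis using False by (simp add: f_def)
  next
    case True
    have one: "inverse (vq - inverse vq) * (vq - inverse vq) = 1" using vq_diff_nz by simp
    \<comment> \<open>For first letters \<open>i\<close> and \<open>i + 1\<close> the mixed terms
      carry the factor v - v^(-1), which cancels the denominator of the commutator.\<close>
    have D1: "scT (inverse (vq - inverse vq)) (scT vq x - scT (inverse vq) x) = x" for x
      using one by (simp flip: T.scale_left_diff_distrib)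
    have D2: "scT (inverse (vq - inverse vq) * vq) x = x + scT (inverse (vq - inverse vq) * inverse vq) x" for x
      using D1[of x] by (simp add: T.scale_right_diff_distrib diff_eq_eq)
    have "actT (E i) (actT (F j) (pre a f)) - actT (F j) (actT (E i) (pre a f)) =
      scT (inverse (vq - inverse vq)) (Dt i (pre a f) - Dm i (pre a f))"
    proof -
      consider "a = i" | "a = i + 1" | "a \<noteq> i" "a \<noteq> i + 1" by blast
      then show ?thesis
      proof cases
        case 1
        then show ?thesis
          using True f IH
          by (simp add: T_simps cij_def dl_def kt_single pre_diff D2[unfolded mult.commute[of "inverse (vq - inverse vq)"]]
              T.scale_right_diff_distrib  vq_powi_m2 vq_cancel mult.commute
              del: pre_bas actT_bas diag_bas)
      next
        case 2
        then show ?thesis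
          using True f IH
          by (simp add: T_simps cij_def dl_def kt_single pre_diff D2[unfolded mult.commute[of "inverse (vq - inverse vq)"]]
              T.scale_right_diff_distrib  vq_powi_m2 vq_cancel mult.commute
              del: pre_bas actT_bas diag_bas)
      next
        case 3
        then show ?thesis
          using True f IH
          by (simp add: T_simps kt_single pre_diff del: pre_bas actT_bas diag_bas)
      qed
    qed
    then show ?thesis using True by (simp add: f_def)
  qed
qed

text \<open>Induction on the tensor. Terms that keep the first letter form the Serre expression on
  the tail, which vanishes by induction; terms that move it cancel among themselves through the
  Cartan integers.\<close>

lemma serreE_T:
  assumes "\<bar>i - j\<bar> = 1" "FS f"
  shows "actT (E i) (actT (E i) (actT (E j) f)) - scT (vq + inverse vq) (actT (E i) (actT (E j) (actT (E i) f)))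
             + actT (E j) (actT (E i) (actT (E i) f)) = 0"
proof (rule linop_eqI[OF _ _ assms(2), where T' = "\<lambda>_. 0"])
  fix w
  have c: "cij i i = 2" "cij j j = 2" "cij i j = -1" "cij j i = -1"
    using assms(1) by (auto simp: cij_def dl_def)
  show "actT (E i) (actT (E i) (actT (E j) (bas w))) - scT (vq + inverse vq) (actT (E i) (actT (E j) (actT (E i) (bas w))))
             + actT (E j) (actT (E i) (actT (E i) (bas w))) = 0"
  proof (induction w)
    case (Cons a u)
    define f where "f = bas u"
    have f: "FS f" by (simp add: f_def)
    have IH: "actT (E i) (actT (E i) (actT (E j) f)) + actT (E j) (actT (E i) (actT (E i) f)) = scT vq (actT (E i) (actT (E j) (actT (E i) f))) + scT (inverse vq) (actT (E i) (actT (E j) (actT (E i) f)))"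
      using Cons.IH unfolding f_def by (simp add: algebra_simps)
    have IH': "pre b (actT (E i) (actT (E i) (actT (E j) f))) + pre b (actT (E j) (actT (E i) (actT (E i) f))) = scT vq (pre b (actT (E i) (actT (E j) (actT (E i) f)))) + scT (inverse vq) (pre b (actT (E i) (actT (E j) (actT (E i) f))))" for b
      using arg_cong[OF IH, of "pre b"] by (simp only: pre_add pre_scT)
    have "actT (E i) (actT (E i) (actT (E j) (pre a f))) - scT (vq + inverse vq) (actT (E i) (actT (E j) (actT (E i) (pre a f))))
             + actT (E j) (actT (E i) (actT (E i) (pre a f))) = 0"
    proof -
      consider "j = i + 1" "a = i + 1" | "j = i + 1" "a = j + 1" | "j = i - 1" "a = i + 1" | "j = i - 1" "a = i" 
        | "a \<noteq> i + 1" "a \<noteq> j + 1" using assms(1) by linarith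
      then show ?thesis
        by cases (use f c IH'[of a] in \<open>simp_all add: T_simps pre_diff power_int_minus algebra_simps power2_eq_square
            del: pre_bas actT_bas diag_bas\<close>)
    qed
    then show ?case by (simp add: f_def)
  qed simp
qed auto

lemma serreF_T:
  assumes "\<bar>i - j\<bar> = 1" "FS f"
  shows "actT (F i) (actT (F i) (actT (F j) f)) - scT (vq + inverse vq) (actT (F i) (actT (F j) (actT (F i) f)))
             + actT (F j) (actT (F i) (actT (F i) f)) = 0"
proof (rule linop_eqI[OF _ _ assms(2), where T' = "\<lambda>_. 0"])
  fix w
  show "actT (F i) (actT (F i) (actT (F j) (bas w))) - scT (vq + inverse vq) (actT (F i) (actT (F j) (actT (F i) (bas w))))
             + actT (F j) (actT (F i) (actT (F i) (bas w))) = 0"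
  proof (induction w)
    case (Cons a u)
    define f where "f = bas u"
    have f: "FS f" by (simp add: f_def)
    have IH: "actT (F i) (actT (F i) (actT (F j) f)) + actT (F j) (actT (F i) (actT (F i) f)) = scT vq (actT (F i) (actT (F j) (actT (F i) f))) + scT (inverse vq) (actT (F i) (actT (F j) (actT (F i) f)))"
      using Cons.IH unfolding f_def by (simp add: algebra_simps)
    note S = T_simps kt_def vq_cancel pre_diff power_int_minus algebra_simps power2_eq_square
    note [simp del] = pre_bas actT_bas diag_bas
    \<comment> \<open>Here a fixed first letter contributes a scalar: \<open>c\<close> is what two
      \<open>F i\<close> and one \<open>F j\<close> together pick up from \<open>a\<close>.\<close>
    have IH': "scT c (pre a (actT (F i) (actT (F i) (actT (F j) f)))) + scT c (pre a (actT (F j) (actT (F i) (actT (F i) f)))) = scT (c * vq) (pre a (actT (F i) (actT (F j) (actT (F i) f)))) + scT (c * inverse vq) (pre a (actT (F i) (actT (F j) (actT (F i) f))))" for c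
      using arg_cong[OF IH, of "\<lambda>x. scT c (pre a x)"] by (simp only: pre_add pre_scT T.scale_right_distrib T.scale_scale)
    have "actT (F i) (actT (F i) (actT (F j) (pre a f))) - scT (vq + inverse vq) (actT (F i) (actT (F j) (actT (F i) (pre a f))))
             + actT (F j) (actT (F i) (actT (F i) (pre a f))) = 0"
    proof -
      consider "j = i + 1" "a = i" | "j = i + 1" "a = j" | "j = i + 1" "a = j + 1" 
        | "j = i - 1" "a = j" | "j = i - 1" "a = i"| "j = i - 1" "a = i + 1"
        | "a \<noteq> i" "a \<noteq> i + 1" "a \<noteq> j" "a \<noteq> j + 1" using assms(1) by linarith
      then show ?thesis
      proof cases
        case 1
        then show ?thesis using f IH'[of "inverse vq * inverse vq"] by (simp add: S)
      next
        case 2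
        then show ?thesis using f IH'[of "vq"] by (simp add: S)
      next
        case 3
        then show ?thesis using f IH'[of "vq"] by (simp add: S)
      next
        case 4
        then show ?thesis using f IH'[of "inverse vq"] by (simp add: S)
      next
        case 5
        then show ?thesis using f IH'[of "inverse vq"] by (simp add: S)
      next
        case 6
        then show ?thesis using f IH'[of "vq * vq"] by (simp add: S)
      next
        case 7
        then show ?thesis using f IH'[of "1"] by (simp add: S)
      qed
    qed
    then show ?case by (simp add: f_def pre_bas)
  qed simp
qed auto

lemma tens_FS: "f \<in> tens r \<Longrightarrow> FS f"
  by (simp add: tens_def FS_def)

lemma tens_len: "f \<in> tens r \<Longrightarrow> f w \<noteq> 0 \<Longrightarrow> length w = r"
  by (auto simp: tens_def)

lemma tens_0 [simp, intro]: "0 \<in> tens r"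
  and tens_bas [intro]: "length w = r \<Longrightarrow> bas w \<in> tens r"
  by (simp_all add: tens_def fapp) (auto simp: bas_apply intro: finite_subset[of _ "{w}"])

lemma tens_add [intro]: "f \<in> tens r \<Longrightarrow> h \<in> tens r \<Longrightarrow> f + h \<in> tens r"
  using FS_add[of f h] by (auto simp: tens_def FS_def fapp) (metis add_0)

lemma tens_scT [intro]: "f \<in> tens r \<Longrightarrow> scT c f \<in> tens r"
  using FS_scT[of f c] by (auto simp: tens_def FS_def fapp)

lemma tens_lin:
  assumes "f \<in> tens r" "\<And>w. FS (g w)" "\<And>w u. length w = r \<Longrightarrow> g w u \<noteq> 0 \<Longrightarrow> length u = r"
  shows "lin g f \<in> tens r"
proof -
  have "lin g f u = 0" if "length u \<noteq> r" for u
    unfolding lin_def using assms(3)[of _ u] that tens_len[OF assms(1)] by (intro sum.neutral) auto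
  then show ?thesis using FS_lin[OF assms(2) tens_FS[OF assms(1)]] by (auto simp: tens_def FS_def)
qed

lemma tens_actT [intro]: "f \<in> tens r \<Longrightarrow> actT g f \<in> tens r"
  unfolding actT_def by (rule tens_lin) (auto dest: gb_supp)

lemma hb_supp: "hb j w u \<noteq> 0 \<Longrightarrow> length u = length w"
  by (auto simp: fapp hb_def Let_def bas_apply split: if_splits)

lemma tens_hs [intro]: "f \<in> tens r \<Longrightarrow> hs j f \<in> tens r"
  unfolding hs_def by (rule tens_lin) (auto dest: hb_supp)

lemma umod_tens: "umod scT (tens r) actT"
proof -
  have FS': "x \<in> tens r \<Longrightarrow> FS x" for x by (rule tens_FS)
  have KK: "actT (Kp i) (actT (Kp j) f) = actT (Kp j) (actT (Kp i) f)" if "FS f" for i j f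
    using that by (simp add: actT_Kp del: power_int_of_nat) (auto simp: diag_def mult.left_commute fun_eq_iff)
  have KKm: "actT (Kp i) (actT (Km i) f) = f" "actT (Km i) (actT (Kp i) f) = f" if "FS f" for i f
    using that by (simp_all add: actT_Kp actT_Km del: power_int_of_nat) (auto simp: diag_def power_int_minus fun_eq_iff)
  have EF: "actT (E i) (actT (F j) f) - actT (F j) (actT (E i) f) =
          (if i = j then scT (inverse (vq - inverse vq))
                (actT (Kp i) (actT (Km (i + 1)) f) - actT (Km i) (actT (Kp (i + 1)) f)) else 0)" if f: "FS f" for i j f
  proof (rule linop_eqI[OF _ _ f])
    fix w
    have "actT (Kp i) (actT (Km (i + 1)) (bas w)) = Dt i (bas w)" "actT (Km i) (actT (Kp (i + 1)) (bas w)) = Dm i (bas w)"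
      by (simp_all add: gb_Kp gb_Km actT_scT kt_def power_int_diff power_int_minus power_int_add divide_inverse mult.commute)
    then show "actT (E i) (actT (F j) (bas w)) - actT (F j) (actT (E i) (bas w)) =
          (if i = j then scT (inverse (vq - inverse vq))
                (actT (Kp i) (actT (Km (i + 1)) (bas w)) - actT (Km i) (actT (Kp (i + 1)) (bas w))) else 0)"
      using EF_T_bas[of i j w] by presburger
  qed auto
  show ?thesis
    unfolding umod_def
    using FS' KK KKm EF KE_T KF_T EE_T FF_T serreE_T serreF_T vector_space_scT
    by (intro conjI allI ballI impI) (auto simp: actT_add actT_scT)
qed

section \<open>The Hecke action and the contravariant form\<close>

definition swp :: "nat \<Rightarrow> int list \<Rightarrow> int list" where
  "swp j w = w[j - 1 := w ! j, j := w ! (j - 1)]"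

lemma length_swp [simp]: "length (swp j w) = length w"
  by (simp add: swp_def)

lemma swp_nth:
  assumes "1 \<le> j" "j < length w"
  shows "swp j w ! (j - 1) = w ! j" "swp j w ! j = w ! (j - 1)"
    "\<And>k. k \<noteq> j \<Longrightarrow> k \<noteq> j - 1 \<Longrightarrow> swp j w ! k = w ! k"
  using assms by (auto simp: swp_def nth_list_update)

lemma swp_swp [simp]: "1 \<le> j \<Longrightarrow> j < length w \<Longrightarrow> swp j (swp j w) = w"
  by (rule nth_equalityI) (auto simp: swp_def nth_list_update)

lemma mset_swp: "1 \<le> j \<Longrightarrow> j < length w \<Longrightarrow> mset (swp j w) = mset w"
  unfolding swp_def using mset_swap[of j w "j - 1"] by (simp add: list_update_swap)

lemma count_swp: "1 \<le> j \<Longrightarrow> j < length w \<Longrightarrow> count_list (swp j w) k = count_list w k"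
  using mset_swp[of j w] by (metis count_mset)

lemma hb_swp: "hb j w = (if w ! (j - 1) < w ! j then bas (swp j w)
     else if w ! (j - 1) = w ! j then scT vq (bas w)
     else scT (vq - inverse vq) (bas w) + bas (swp j w))"
  by (simp add: hb_def swp_def Let_def)

text \<open>The matrix of a Hecke generator in the tensor basis is symmetric, so the coefficient at
  \<open>w\<close> of an image follows the same three-case rule as the image of
  \<open>w\<close>.\<close>

lemma hb_apply:
  assumes "1 \<le> j" "j < length w"
  shows "hb j u w = (if w ! (j - 1) < w ! j then (if u = swp j w then 1 else 0)
     else if w ! (j - 1) = w ! j then vq * (if u = w then 1 else 0)
     else (vq - inverse vq) * (if u = w then 1 else 0) + (if u = swp j w then 1 else 0))"
proof (cases "length u = length w")
  case False
  then have "hb j u w = 0" using hb_supp[of j u w] by metis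
  then show ?thesis using False by auto
next
  case True
  then have u: "1 \<le> j" "j < length u" using assms by auto
  have 1: "w = swp j u \<longleftrightarrow> u = swp j w" using u assms by (metis swp_swp)
  have 2: "swp j w = w" if "w ! (j - 1) = w ! j" using that by (simp add: swp_def) (metis list_update_id)
  consider "u = w" | "u = swp j w" "u \<noteq> w" | "u \<noteq> w" "u \<noteq> swp j w" by blast
  then show ?thesis
  proof cases
    case 1
    then show ?thesis using assms swp_nth[OF assms] by (auto simp: hb_swp fapp bas_apply) 
  next
    case 2
    then show ?thesis using assms swp_nth[OF assms] by (auto simp: hb_swp fapp bas_apply)
  next
    case 3
    then show ?thesis using 1 by (auto simp: hb_swp fapp bas_apply)
  qed
qed

lemma hs_apply:
  assumes f: "FS f" and j: "1 \<le> j" "j < length w"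
  shows "hs j f w = (if w ! (j - 1) < w ! j then f (swp j w)
     else if w ! (j - 1) = w ! j then vq * f w
     else (vq - inverse vq) * f w + f (swp j w))"
proof -
  let ?A = "{u. f u \<noteq> 0} \<union> {w, swp j w}"
  have A: "finite ?A" using f by (simp add: FS_def)
  have "hs j f w = (\<Sum>u\<in>?A. f u * hb j u w)"
    unfolding hs_def by (rule lin_superset[OF A]) auto
  also have "\<dots> = (if w ! (j - 1) < w ! j then (\<Sum>u\<in>?A. if u = swp j w then f u else 0)
     else if w ! (j - 1) = w ! j then vq * (\<Sum>u\<in>?A. if u = w then f u else 0)
     else (vq - inverse vq) * (\<Sum>u\<in>?A. if u = w then f u else 0) + (\<Sum>u\<in>?A. if u = swp j w then f u else 0))"
    by (auto simp: hb_apply[OF j] sum_distrib_left sum.distrib[symmetric] algebra_simps intro!: sum.cong)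
  finally show ?thesis using A by (simp add: sum.delta)
qed

lemma hb_Suc: "1 \<le> j \<Longrightarrow> hb (Suc j) (a # w) = pre a (hb j w)"
  by (cases j) (auto simp: hb_def Let_def pre_add pre_scT)

lemma hb_1: "hb (Suc 0) (a # b # u) = (if a < b then bas (b # a # u) else if a = b then scT vq (bas (a # b # u))
    else scT (vq - inverse vq) (bas (a # b # u)) + bas (b # a # u))"
  by (simp add: hb_def)

lemma hs_pre: "FS f \<Longrightarrow> 1 \<le> j \<Longrightarrow> hs (Suc j) (pre a f) = pre a (hs j f)"
  by (rule linop_eqI[of "\<lambda>f. hs (Suc j) (pre a f)"]) (auto simp: hb_Suc)

lemma hs_pre2: "FS f \<Longrightarrow> hs (Suc 0) (pre a (pre b f)) = (if a < b then pre b (pre a f)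
    else if a = b then scT vq (pre a (pre b f))
    else scT (vq - inverse vq) (pre a (pre b f)) + pre b (pre a f))"
  by (rule linop_eqI[of "\<lambda>f. hs (Suc 0) (pre a (pre b f))"]) (auto simp: hb_1)

lemma diag_hs:
  assumes f: "f \<in> tens r" and j: "1 \<le> j" "j < r"
    and h: "\<And>w. length w = r \<Longrightarrow> h (swp j w) = h w"
  shows "diag h (hs j f) = hs j (diag h f)"
proof (rule linop_eqI[OF _ _ tens_FS[OF f]])
  fix w assume "f w \<noteq> 0"
  then have w: "length w = r" using tens_len[OF f] by blast
  show "diag h (hs j (bas w)) = hs j (diag h (bas w))"
    using h[OF w] by (simp add: hs_scT hb_swp diag_add diag_scT T.scale_right_distrib T.scale_left_commute)
qed auto

lemma Dt_hs: "f \<in> tens r \<Longrightarrow> 1 \<le> j \<Longrightarrow> j < r \<Longrightarrow> Dt i (hs j f) = hs j (Dt i f)"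
  by (rule diag_hs) (auto simp: kt_def count_swp)

lemma kt_single': "kt i [1 + i] = - 1"
  by (simp add: kt_def)

lemma actT_diff: "FS f \<Longrightarrow> FS h \<Longrightarrow> actT g (f - h) = actT g f - actT g h"
  and hs_diff: "FS f \<Longrightarrow> FS h \<Longrightarrow> hs j (f - h) = hs j f - hs j h"
  using actT_add[of "f - h" h g] hs_add[of "f - h" h j] by simp_all

text \<open>For \<open>j > 1\<close> the first letter is a spectator, up to the factor
  \<open>Dt i\<close> from the coproduct, which depends only on the content and so commutes with the
  Hecke action. The real check is \<open>j = 1\<close>, by cases on the first two letters.\<close>

lemma comm_bas:
  assumes "1 \<le> j" "j < length w"
  shows "actT (E i) (hs j (bas w)) = hs j (actT (E i) (bas w))"
    and "actT (F i) (hs j (bas w)) = hs j (actT (F i) (bas w))"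
proof -
  have "actT (E i) (hs j (bas w)) = hs j (actT (E i) (bas w)) \<and> actT (F i) (hs j (bas w)) = hs j (actT (F i) (bas w))"
    using assms
  proof (induction w arbitrary: j)
    case (Cons a w)
    show ?case
    proof (cases "j = 1")
      case False
      then obtain k where k: "j = Suc k" "1 \<le> k" using Cons.prems by (cases j) auto
      define f where "f = bas w"
      have f: "FS f" "f \<in> tens (length w)" by (auto simp: f_def)
      have kl: "k < length w" using Cons.prems k by simp
      have IH: "actT (E i) (hs k f) = hs k (actT (E i) f)" "actT (F i) (hs k f) = hs k (actT (F i) f)"
        using Cons.IH[OF k(2) kl] by (simp_all add: f_def)
      have D: "Dt i (hs k f) = hs k (Dt i f)" using Dt_hs[OF f(2) k(2) kl] .
      have "actT (E i) (hs (Suc k) (pre a f)) = hs (Suc k) (actT (E i) (pre a f))"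
           "actT (F i) (hs (Suc k) (pre a f)) = hs (Suc k) (actT (F i) (pre a f))"
        using f(1) k(2) IH D by (auto simp: hs_pre T_simps hs_add hs_scT simp del: pre_bas actT_bas diag_bas hs_bas)
      moreover have "pre a f = bas (a # w)" by (simp add: f_def)
      ultimately show ?thesis by (simp only: k(1))
    next
      case True
      then obtain b u where w: "w = b # u" using Cons.prems by (cases w) auto
      define f where "f = bas u"
      have f: "FS f" by (simp add: f_def)
      have e: "(vq - inverse vq) * vq = vq * vq - 1" "(vq - inverse vq) * inverse vq = 1 - inverse vq * inverse vq"
        by (simp_all add: algebra_simps)
      have "actT (E i) (hs (Suc 0) (pre a (pre b f))) = hs (Suc 0) (actT (E i) (pre a (pre b f)))"
      proof -
        consider "a = i + 1" "b = i + 1" | "a = i + 1" "b = i" | "a = i + 1" "b < i" | "a = i + 1" "b > i + 1"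
          | "a = i" "b = i + 1" | "a < i" "b = i + 1" | "a > i + 1" "b = i + 1" | "a \<noteq> i + 1" "b \<noteq> i + 1" by linarith
        then show ?thesis
          by cases (use f in \<open>auto simp: hs_pre2 T_simps hs_add hs_scT kt_single kt_single' e actT_diff hs_diff pre_diff  vq_cancel algebra_simps
             simp del: pre_bas actT_bas diag_bas hs_bas\<close>)
      qed
      moreover have "actT (F i) (hs (Suc 0) (pre a (pre b f))) = hs (Suc 0) (actT (F i) (pre a (pre b f)))"
      proof -
        consider "a = i" "b = i" | "a = i" "b = i + 1" | "a = i" "b < i" | "a = i" "b > i + 1"
          | "a = i + 1" "b = i" | "a < i" "b = i" | "a > i + 1" "b = i" | "a \<noteq> i" "b \<noteq> i" "a = i + 1" 
          | "a \<noteq> i" "b \<noteq> i" "b = i + 1" | "a \<noteq> i" "b \<noteq> i" "a \<noteq> i + 1" "b \<noteq> i + 1" by linarith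
        then show ?thesis
          by cases (use f in \<open>auto simp: hs_pre2 T_simps hs_add hs_scT kt_single kt_single' e actT_diff hs_diff pre_diff  vq_cancel algebra_simps
             simp del: pre_bas actT_bas diag_bas hs_bas\<close>)
      qed
      moreover have "pre a (pre b f) = bas (a # w)" by (simp add: f_def w)
      ultimately show ?thesis using True by (simp only: One_nat_def)
    qed
  qed simp
  then show "actT (E i) (hs j (bas w)) = hs j (actT (E i) (bas w))"
    "actT (F i) (hs j (bas w)) = hs j (actT (F i) (bas w))" by auto
qed

lemma actT_hs:
  assumes f: "f \<in> tens r" and j: "1 \<le> j" "j < r"
  shows "actT g (hs j f) = hs j (actT g f)"
proof (cases g)
  case (Kp i)
  show ?thesis unfolding Kp using tens_FS[OF f] diag_hs[OF f j] j
    by (simp add: actT_Kp count_swp)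
next
  case (Km i)
  show ?thesis unfolding Km using tens_FS[OF f] diag_hs[OF f j] j
    by (simp add: actT_Km count_swp)
next
  case (E i)
  show ?thesis unfolding E
    by (rule linop_eqI[OF _ _ tens_FS[OF f]]) (use comm_bas tens_len[OF f] j in auto)
next
  case (F i)
  show ?thesis unfolding F
    by (rule linop_eqI[OF _ _ tens_FS[OF f]]) (use comm_bas tens_len[OF f] j in auto)
qed

section \<open>The bilinear form with orthonormal basis tensors, and its contravariance\<close>

definition form :: "tv \<Rightarrow> tv \<Rightarrow> qv" where "form f g = (\<Sum>w\<in>{w. f w \<noteq> 0}. f w * g w)"

lemma form_superset: "finite A \<Longrightarrow> {w. f w \<noteq> 0} \<subseteq> A \<Longrightarrow> form f g = (\<Sum>w\<in>A. f w * g w)"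
  unfolding form_def by (intro sum.mono_neutral_left) auto

lemma form_sym: "FS f \<Longrightarrow> FS g \<Longrightarrow> form f g = form g f"
  using form_superset[of "{w. f w \<noteq> 0} \<union> {w. g w \<noteq> 0}" f g]
    form_superset[of "{w. f w \<noteq> 0} \<union> {w. g w \<noteq> 0}" g f]
  by (simp add: FS_def mult.commute)

lemma form_add: "form f (g + h) = form f g + form f h"
  and form_scT: "form f (scT c g) = c * form f g"
  and form_0 [simp]: "form f 0 = 0"
  by (simp_all add: form_def fapp algebra_simps sum.distrib sum_distrib_left)

text \<open>A sum of squares in an ordered field vanishes only termwise.\<close>

lemma form_anisotropic: "FS f \<Longrightarrow> form f f = 0 \<Longrightarrow> f = 0"
  unfolding form_def FS_def by (subst (asm) sum_nonneg_eq_0_iff) (auto simp: fun_eq_iff fapp)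

text \<open>The adjoint of \<open>E i\<close> is v^(-1) F_i K_i K_(i+1)^(-1), again an element of U;
  hence orthogonality to a submodule is preserved by the action.\<close>

lemma E_transpose: "gb (E i) w u = inverse vq * vq powi kt i u * gb (F i) u w"
proof (induction w arbitrary: u)
  case Nil
  have "gb (F i) u [] = 0"
    using gb_supp[of "F i" u "[]"] by (cases "u = []") (auto simp: fapp)
  then show ?case by (simp add: fapp)
next
  case (Cons a w)
  show ?case
  proof (cases u)
    case Nil
    then show ?thesis by (auto simp: fapp pre_def bas_apply)
  next
    case u: (Cons b u')
    have "a = i + 1 \<Longrightarrow> b = i \<Longrightarrow> a \<noteq> b" by simp
    then show ?thesis unfolding u using Cons.IH[of u'] kt_Cons[of i b u']
      by (auto simp: fapp pre_def bas_apply kt_single power_int_add power_int_minus)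
  qed
qed

lemma form_actT:
  assumes "FS f" "FS h" "\<And>w u. gb g w u = c * d u * gb g' u w"
  shows "form (actT g f) h = form f (scT c (actT g' (diag d h)))"
proof -
  let ?A = "{w. f w \<noteq> 0}" and ?B = "{w. h w \<noteq> 0}"
  have fin: "finite ?A" "finite ?B" using assms by (simp_all add: FS_def)
  have "form (actT g f) h = form h (actT g f)" using assms by (intro form_sym) auto
  also have "\<dots> = (\<Sum>u\<in>?B. \<Sum>w\<in>?A. h u * (f w * (c * d u * gb g' u w)))"
    unfolding form_def actT_def lin_def using assms(3) by (simp add: sum_distrib_left)
  also have "\<dots> = (\<Sum>w\<in>?A. \<Sum>u\<in>?B. f w * (c * (d u * h u * gb g' u w)))"
    by (subst sum.swap) (simp add: algebra_simps)
  also have "\<dots> = form f (scT c (actT g' (diag d h)))"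
  proof -
    have "actT g' (diag d h) w = (\<Sum>u\<in>?B. d u * h u * gb g' u w)" for w
      unfolding actT_def by (subst lin_superset[OF fin(2)]) (auto simp: diag_def)
    then show ?thesis unfolding form_def by (simp add: fapp sum_distrib_left)
  qed
  finally show ?thesis .
qed

lemma adj_E: "FS f \<Longrightarrow> FS h \<Longrightarrow> form (actT (E i) f) h = form f (scT (inverse vq) (actT (F i) (Dt i h)))"
  by (rule form_actT) (simp_all add: E_transpose[of i])

lemma form_diag: "FS f \<Longrightarrow> FS g \<Longrightarrow> form (diag d f) g = form f (diag d g)"
proof -
  assume "FS f" "FS g"
  then have "form (diag d f) g = (\<Sum>w\<in>{w. f w \<noteq> 0}. diag d f w * g w)"
    by (intro form_superset) (auto simp: FS_def diag_def)
  then show ?thesis by (simp add: form_def diag_def algebra_simps)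
qed

lemma Dt_Dm: "Dt i (Dm i f) = f"
  by (auto simp: diag_def power_int_minus fun_eq_iff)

lemma adj_F:
  assumes "FS f" "FS h" shows "form (actT (F i) f) h = form f (scT vq (Dm i (actT (E i) h)))"
proof -
  have "form (actT (E i) h) (Dm i f) = inverse vq * form h (actT (F i) f)"
    using adj_E[of h "Dm i f" i] assms by (simp add: Dt_Dm form_scT)
  then have "form h (actT (F i) f) = vq * form (actT (E i) h) (Dm i f)" by simp
  also have "form (actT (E i) h) (Dm i f) = form (Dm i f) (actT (E i) h)"
    using assms by (intro form_sym) auto
  also have "\<dots> = form f (Dm i (actT (E i) h))" using assms by (intro form_diag) auto
  finally show ?thesis using form_sym[of h "actT (F i) f"] assms by (simp add: form_scT)
qed

abbreviation cont :: "int list \<Rightarrow> int \<Rightarrow> int" where "cont w \<equiv> (\<lambda>i. int (count_list w i))"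

lemma wspace_tens:
  "x \<in> wspace scT (tens r) actT la \<longleftrightarrow> x \<in> tens r \<and> (\<forall>w. x w \<noteq> 0 \<longrightarrow> cont w = la)"
proof -
  have "(\<forall>i. actT (Kp i) x = scT (vq powi la i) x) \<longleftrightarrow> (\<forall>w. x w \<noteq> 0 \<longrightarrow> cont w = la)" if "x \<in> tens r"
  proof -
    have "(\<forall>i. actT (Kp i) x = scT (vq powi la i) x) \<longleftrightarrow>
      (\<forall>i w. vq powi int (count_list w i) * x w = vq powi la i * x w)"
      using tens_FS[OF that] by (simp add: actT_Kp diag_def fapp fun_eq_iff)
    also have "\<dots> \<longleftrightarrow> (\<forall>w. x w \<noteq> 0 \<longrightarrow> cont w = la)"
      by (auto simp: fun_eq_iff)
    finally show ?thesis .
  qed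
  then show ?thesis by (auto simp: wspace_def)
qed

lemma polw_tens: "polw scT (tens r) actT"
  unfolding polw_def wspace_tens
proof (intro allI impI)
  fix la :: "int \<Rightarrow> int" and x :: tv
  assume x: "(x \<in> tens r \<and> (\<forall>w. x w \<noteq> 0 \<longrightarrow> cont w = la)) \<and> x \<noteq> 0"
  then obtain w where "x w \<noteq> 0" by (auto simp: fun_eq_iff fapp)
  then have la: "la = cont w" using x by metis
  have "{i. la i \<noteq> 0} \<subseteq> set w" unfolding la by (auto simp: count_list_0_iff)
  then show "(\<forall>i. 0 \<le> la i) \<and> finite {i. la i \<noteq> 0}" unfolding la by (auto intro: finite_subset)
qed

lemma polmod_tens: "polmod scT (tens r) actT"
  by (simp add: polmod_def polmod_axioms_def umodule_if_umod umod_tens polw_tens)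

lemma (in umodule)
  assumes x: "x \<in> M"
  shows EE: "\<bar>i - j\<bar> > 1 \<Longrightarrow> act (E i) (act (E j) x) = act (E j) (act (E i) x)"
    and FF: "\<bar>i - j\<bar> > 1 \<Longrightarrow> act (F i) (act (F j) x) = act (F j) (act (F i) x)"
    and serreE: "\<bar>i - j\<bar> = 1 \<Longrightarrow> act (E i) (act (E i) (act (E j) x)) - sc (vq + inverse vq) (act (E i) (act (E j) (act (E i) x)))
             + act (E j) (act (E i) (act (E i) x)) = 0"
    and serreF: "\<bar>i - j\<bar> = 1 \<Longrightarrow> act (F i) (act (F i) (act (F j) x)) - sc (vq + inverse vq) (act (F i) (act (F j) (act (F i) x)))
             + act (F j) (act (F i) (act (F i) x)) = 0"
  using umod x unfolding umod_def by blast+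

lemma (in umodule) umod_subm:
  assumes N: "subm N" shows "umod sc N act"
proof -
  have sub: "x \<in> N \<Longrightarrow> x \<in> M" for x using N by (auto simp: subm_def)
  show ?thesis
    unfolding umod_def using N KKm KmK KE KF EF KK EE FF serreE serreF act_add act_sc sub vector_space_axioms
    unfolding subm_def by (intro conjI ballI allI impI) simp_all
qed

lemma (in umodule) wspace_subm: "subm N \<Longrightarrow> wspace sc N act la = ws la \<inter> N"
  by (auto simp: wspace_def subm_def)

lemma tens_decompose:
  assumes "y \<in> tens r"
  shows "y = (\<Sum>la\<in>cont ` {w. y w \<noteq> 0}. (\<lambda>w. if cont w = la then y w else 0))"
    "(\<lambda>w. if cont w = la then y w else 0) \<in> wspace scT (tens r) actT la"
proof -
  have fin: "finite {w. y w \<noteq> 0}" using tens_FS[OF assms] by (simp add: FS_def)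
  show "y = (\<Sum>la\<in>cont ` {w. y w \<noteq> 0}. (\<lambda>w. if cont w = la then y w else 0))"
  proof
    fix w
    have "(\<Sum>la\<in>cont ` {w. y w \<noteq> 0}. if cont w = la then y w else 0) = (if cont w \<in> cont ` {w. y w \<noteq> 0} then y w else 0)"
      using fin by (intro sum.delta') simp
    then show "y w = (\<Sum>la\<in>cont ` {w. y w \<noteq> 0}. (\<lambda>w. if cont w = la then y w else 0)) w"
      unfolding fsum_apply by (cases "y w = 0") auto
  qed
  show "(\<lambda>w. if cont w = la then y w else 0) \<in> wspace scT (tens r) actT la"
    unfolding wspace_tens using assms by (auto simp: tens_def intro: finite_subset[OF _ fin])
qed

text \<open>The form is contravariant and anisotropic: a submodule of \<open>U x\<close> not containing \<open>x\<close> has no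
  weight vectors of the weight of \<open>x\<close>, hence is orthogonal to \<open>U x\<close> and in particular to itself.\<close>

lemma irred_cyc_tens:
  assumes x: "x \<in> wspace scT (tens r) actT mu" "x \<noteq> 0" and low: "\<And>j. j \<le> 0 \<Longrightarrow> mu j = 0"
    and N: "N = umodule.cyc scT actT x"
    and top: "\<And>i. 1 \<le> i \<Longrightarrow> wspace scT N actT (up i mu) \<subseteq> {0}"
  shows "irred scT N actT"
proof -
  interpret T: polmod scT "tens r" actT by (rule polmod_tens)
  have sN: "T.subm N" unfolding N by (rule T.subm_cyc[OF T.ws_M[OF x(1)]])
  have uN: "umod scT N actT" by (rule T.umod_subm[OF sN])
  have xN: "x \<in> N" unfolding N by (rule T.cyc_self)
  interpret N: polmod scT N actT
    using polw_tens[of r] uN T.wspace_subm[OF sN]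
    by (auto simp: polmod_def polmod_axioms_def polw_def intro: umodule_if_umod)
  have xw: "x \<in> N.ws mu" using x xN by (simp add: T.wspace_subm[OF sN])
  have sub: "N' = {0} \<or> N' = N" if N': "N.subm N'" for N'
  proof (cases "x \<in> N'")
    case True
    then have "N \<subseteq> N'" using N.cyc_least[OF N'] unfolding N by blast
    then show ?thesis using N' unfolding N.subm_def by blast
  next
    case False
    have N'T: "T.subm N'" using N' sN by (auto simp: N.subm_def T.subm_def)
    have N'_tens: "y \<in> tens r" if "y \<in> N'" for y using that N'T by (auto simp: T.subm_def)
    have cl: "actT g y \<in> N'" "scT c y \<in> N'" if "y \<in> N'" for g y c using that N' by (auto simp: N.subm_def)
    have Dcl: "Dt i y \<in> N'" "Dm i y \<in> N'" if y: "y \<in> N'" for i y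
    proof -
      have f: "FS y" using tens_FS N'_tens[OF y] by blast
      \<comment> \<open>The diagonal factors in the adjoints are themselves words in the generators,
        so a submodule is stable under them.\<close>
      have "Dt i y = actT (Kp i) (actT (Km (i + 1)) y)" "Dm i y = actT (Km i) (actT (Kp (i + 1)) y)"
        using f by (simp_all add: actT_Kp actT_Km)
          (auto simp: diag_def kt_def fun_eq_iff simp flip: mult.assoc power_int_add)
      then show "Dt i y \<in> N'" "Dm i y \<in> N'" using cl y by auto
    qed
    have line: "y = 0" if y: "y \<in> N'" "y \<in> T.ws mu" for y
    proof -
      have "y \<in> N" using N' y(1) unfolding N.subm_def by blast
      then have "y \<in> N.cyc x" "y \<in> N.ws mu"
        using y(2) T.wspace_subm[OF sN] N by blast+
      then obtain c where c: "y = scT c x" using N.cyc_weight_line[OF xw top low] by blast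
      have "c = 0"
      proof (rule ccontr)
        assume "c \<noteq> 0"
        then have "x = scT (inverse c) y" using c by simp
        then show False using cl(2)[OF y(1)] False by simp
      qed
      then show ?thesis using c by simp
    qed
    \<comment> \<open>The component of \<open>y\<close> of weight \<open>mu\<close> lies in
      \<open>N'\<close> and vanishes by \<open>line\<close>; the other components have support
      disjoint from that of \<open>x\<close>.\<close>
    have orth_x: "form y x = 0" if y: "y \<in> N'" for y
    proof -
      let ?p = "\<lambda>la w. if cont w = la then y w else 0"
      have fin: "finite (cont ` {w. y w \<noteq> 0})" using tens_FS[OF N'_tens[OF y]] by (simp add: FS_def)
      have "\<forall>la\<in>cont ` {w. y w \<noteq> 0}. ?p la \<in> N'"
        using tens_decompose[OF N'_tens[OF y]] y by (intro T.subm_component[OF N'T fin]) auto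
      then have p0: "?p mu = 0" if "mu \<in> cont ` {w. y w \<noteq> 0}"
        using that line tens_decompose(2)[OF N'_tens[OF y]] by blast
      have "y w = 0" if w: "cont w = mu" for w
      proof (rule ccontr)
        assume nz: "y w \<noteq> 0"
        then have "?p mu = 0" using w by (intro p0) blast
        from fun_cong[OF this, of w] show False using w nz by (simp add: fapp)
      qed
      then have "y w * x w = 0" for w using x(1) unfolding wspace_tens by (cases "x w = 0") auto
      then show ?thesis unfolding form_def by (intro sum.neutral ballI)
    qed
    have orth_w: "\<forall>y\<in>N'. form y (foldr actT w x) = 0" for w
    proof (induction w)
      case (Cons g w)
      let ?z = "foldr actT w x"
      have z: "FS ?z" using T.word_M[OF T.ws_M[OF x(1)]] tens_FS by blast
      show ?case
      proof
        fix y assume y: "y \<in> N'"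
        then have f: "FS y" using N'_tens tens_FS by blast
        have s: "form y (actT g ?z) = form (actT g ?z) y" using f z by (intro form_sym) auto
        have zs: "form ?z y' = 0" if "y' \<in> N'" for y'
          using Cons.IH form_sym[OF z, of y'] tens_FS[OF N'_tens[OF that]] that by simp
        show "form y (foldr actT (g # w) x) = 0"
        proof (cases g)
          case (E i)
          then show ?thesis using s adj_E[OF z f] zs cl Dcl y by simp
        next
          case (F i)
          then show ?thesis using s adj_F[OF z f] zs cl Dcl y by simp
        next
          case (Kp i)
          have "form (actT (Kp i) ?z) y = form ?z (actT (Kp i) y)"
            using z f by (simp add: actT_Kp form_diag)
          then show ?thesis using s zs cl y Kp by simp
        next
          case (Km i)
          have "form (actT (Km i) ?z) y = form ?z (actT (Km i) y)"
            using z f by (simp add: actT_Km form_diag)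
          then show ?thesis using s zs cl y Km by simp
        qed
      qed
    qed (use orth_x in simp)
    have orth: "form y z = 0" if y: "y \<in> N'" and z: "z \<in> N" for y z
      using z[unfolded N T.cyc_def]
    proof (induction rule: T.span_induct_alt)
      case (step c v z)
      then show ?case using orth_w y by (auto simp: form_add form_scT)
    qed simp
    have "y = 0" if y: "y \<in> N'" for y
      using orth[OF y] y N' form_anisotropic[OF tens_FS[OF N'_tens[OF y]]] by (auto simp: N.subm_def)
    then show ?thesis using N' by (auto simp: N.subm_def)
  qed
  show ?thesis
    unfolding irred_def using uN xN x(2) sub unfolding N.subm_def by blast
qed

section \<open>Cyclicity of tensor space and its Hecke endomorphisms\<close>

text \<open>Adjacent swaps reach every rearrangement: the first letter of the target is bubbled to
  the front, then the tail is treated in the same way.\<close>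

lemma swap_closure:
  assumes "\<And>us a b vs. Q (us @ a # b # vs) \<Longrightarrow> Q (us @ b # a # vs)" "mset w = mset w'" "Q w"
  shows "Q w'"
  using assms
proof (induction w' arbitrary: Q w)
  case (Cons a u)
  have "a \<in> set w" using Cons.prems(2) by (metis list.set_intros(1) set_mset_mset)
  then obtain xs ys where w: "w = xs @ a # ys" by (metis split_list)
  have ws_embeds: "Q (xs @ a # ys) \<Longrightarrow> Q (a # xs @ ys)" for ys
  proof (induction xs arbitrary: ys rule: rev_induct)
    case (snoc x xs)
    then have "Q (xs @ a # x # ys)" using Cons.prems(1)[of xs x a ys] by simp
    then show ?case using snoc.IH[of "x # ys"] by simp
  qed simp
  have "Q (a # u)"
  proof (rule Cons.IH[of "\<lambda>u. Q (a # u)" "xs @ ys"])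
    show "Q (a # us @ b # c # vs) \<Longrightarrow> Q (a # us @ c # b # vs)" for us b c vs
      using Cons.prems(1)[of "a # us" b c vs] by simp
    show "mset (xs @ ys) = mset u" using Cons.prems(2) w by simp
    show "Q (a # xs @ ys)" using ws_embeds Cons.prems(3) w by simp
  qed
  then show ?case .
qed simp

text \<open>Both directions of such a step are given by \<open>F y\<close> and \<open>E y\<close> up to a nonzero scalar
  whenever the letter that moves occurs only once.\<close>

definition split_step :: "int list \<Rightarrow> int list \<Rightarrow> bool" where
  "split_step w w' \<longleftrightarrow> (\<exists>us y vs. w = us @ y # vs \<and> w' = us @ (y + 1) # vs \<and> (\<forall>x\<in>set us. x \<le> y) \<and> (\<forall>x\<in>set vs. y + 1 < x))"

lemma split_step_steps:
  assumes "a \<le> t" "\<And>x. x \<in> set us \<Longrightarrow> x \<le> a" "\<And>x. x \<in> set vs \<Longrightarrow> t < x"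
  shows "split_step\<^sup>*\<^sup>* (us @ a # vs) (us @ t # vs)"
  using assms
proof (induction t rule: int_ge_induct)
  case (step t)
  have "split_step (us @ t # vs) (us @ (t + 1) # vs)"
    unfolding split_step_def using step by force
  moreover have "split_step\<^sup>*\<^sup>* (us @ a # vs) (us @ t # vs)" using step by force
  ultimately show ?case by simp
qed simp

text \<open>The rightmost letter not yet placed is moved first, to its final place beyond
  \<open>N\<close>. It never meets another letter, since those on its left do not exceed it and
  those on its right are already further out.\<close>

lemma split_step_spread:
  assumes "sorted us" "\<And>x. x \<in> set us \<Longrightarrow> x \<le> N" "length us \<le> r"
  shows "split_step\<^sup>*\<^sup>* (us @ map (\<lambda>k. N + int k) [Suc (length us)..<Suc r]) (map (\<lambda>k. N + int k) [1..<Suc r])"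
  using assms
proof (induction us rule: rev_induct)
  case (snoc a us)
  let ?T = "map (\<lambda>k. N + int k) [Suc (Suc (length us))..<Suc r]"
  have "split_step\<^sup>*\<^sup>* (us @ a # ?T) (us @ (N + int (Suc (length us))) # ?T)"
    using snoc.prems by (intro split_step_steps) (force simp: sorted_append)+
  moreover have "(N + int (Suc (length us))) # ?T = map (\<lambda>k. N + int k) [Suc (length us)..<Suc r]"
    using snoc.prems(3) by (subst (2) upt_conv_Cons) auto
  moreover have "split_step\<^sup>*\<^sup>* (us @ map (\<lambda>k. N + int k) [Suc (length us)..<Suc r]) (map (\<lambda>k. N + int k) [1..<Suc r])"
    using snoc by (auto simp: sorted_append)
  ultimately show ?case by (metis append.assoc append_Cons append_Nil length_append_singleton rtranclp_trans)
qed simp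

text \<open>Both words are spread out beyond all their letters to the same strictly increasing word,
  which links any sorted word to \<open>[1..int r]\<close>.\<close>

lemma split_step_common:
  assumes "sorted w" "length w = r"
  obtains s where "split_step\<^sup>*\<^sup>* w s" "split_step\<^sup>*\<^sup>* [1..int r] s" "distinct s"
proof -
  obtain N0 where N0: "\<forall>x\<in>set w \<union> set [1..int r]. x \<le> N0"
    using finite_set by (metis List.finite_set bdd_above_def bdd_above_finite finite_UnI)
  have l: "length [1..int r] = r" by simp
  have "split_step\<^sup>*\<^sup>* w (map (\<lambda>k. N0 + int k) [1..<Suc r])"
    using split_step_spread[of w N0 r] assms N0 by simp
  moreover have "split_step\<^sup>*\<^sup>* [1..int r] (map (\<lambda>k. N0 + int k) [1..<Suc r])"
    using split_step_spread[of "[1..int r]" N0 r] N0 l by simp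
  moreover have "distinct (map (\<lambda>k. N0 + int k) [1..<Suc r])"
    by (simp add: distinct_map inj_on_def)
  ultimately show thesis by (rule that)
qed

lemma split_step_props:
  assumes "split_step w w'"
  shows "length w' = length w" "distinct w \<Longrightarrow> distinct w'" "(\<forall>x\<in>set w. L \<le> x) \<Longrightarrow> (\<forall>x\<in>set w'. L \<le> x)"
  using assms unfolding split_step_def by force+

lemma gb_F_absent: "y \<notin> set vs \<Longrightarrow> gb (F y) vs = 0"
  by (induction vs) auto

lemma gb_E_absent: "y + 1 \<notin> set vs \<Longrightarrow> gb (E y) vs = 0"
  by (induction vs) auto

lemma gb_F_single:
  assumes "y \<notin> set us" "y \<notin> set vs"
  shows "\<exists>c. c \<noteq> 0 \<and> gb (F y) (us @ y # vs) = scT c (bas (us @ (y + 1) # vs))"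
  using assms(1)
proof (induction us)
  case Nil
  then show ?case using gb_F_absent[OF assms(2)] by (intro exI[of _ 1]) simp
next
  case (Cons a us)
  then obtain c where "c \<noteq> 0" "gb (F y) (us @ y # vs) = scT c (bas (us @ (y + 1) # vs))" by auto
  then show ?case using Cons.prems
    by (intro exI[of _ "vq powi (- kt y [a]) * c"]) (auto simp: pre_scT)
qed

lemma gb_E_single:
  assumes "y + 1 \<notin> set us" "y + 1 \<notin> set vs"
  shows "\<exists>c. c \<noteq> 0 \<and> gb (E y) (us @ (y + 1) # vs) = scT c (bas (us @ y # vs))"
  using assms(1)
proof (induction us)
  case Nil
  then show ?case using gb_E_absent[OF assms(2)] by (intro exI[of _ "vq powi kt y vs"]) (auto simp: pre_scT)
next
  case (Cons a us)
  then obtain c where "c \<noteq> 0" "gb (E y) (us @ (y + 1) # vs) = scT c (bas (us @ y # vs))" by auto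
  then show ?case using Cons.prems by (intro exI[of _ c]) (auto simp: pre_scT)
qed

text \<open>Splitting a doubled letter yields both orders of the two new letters. When one order is
  already available, the other can be extracted.\<close>

lemma gb_E_pair:
  assumes "y + 1 \<notin> set us" "y + 1 \<notin> set vs"
  shows "\<exists>c d. d \<noteq> 0 \<and> gb (E y) (us @ (y + 1) # (y + 1) # vs)
     = scT c (bas (us @ y # (y + 1) # vs)) + scT d (bas (us @ (y + 1) # y # vs))"
  using assms(1)
proof (induction us)
  case Nil
  have "gb (E y) ((y + 1) # (y + 1) # vs)
     = scT (vq powi kt y ((y + 1) # vs)) (bas (y # (y + 1) # vs)) + scT (vq powi kt y vs) (bas ((y + 1) # y # vs))"
    using gb_E_absent[OF assms(2)] by (simp add: pre_scT)
  then show ?case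
    by (intro exI[of _ "vq powi kt y ((y + 1) # vs)"] exI[of _ "vq powi kt y vs"]) simp
next
  case (Cons a us)
  then obtain c d where "d \<noteq> 0" "gb (E y) (us @ (y + 1) # (y + 1) # vs)
     = scT c (bas (us @ y # (y + 1) # vs)) + scT d (bas (us @ (y + 1) # y # vs))" by auto
  then show ?case using Cons.prems by (intro exI[of _ c] exI[of _ d]) (auto simp: pre_scT pre_add)
qed

lemma swp_append: "swp (Suc (length us)) (us @ a # b # vs) = us @ b # a # vs"
  by (simp add: swp_def nth_append list_update_append)

lemma hs_bas_append:
  "hs (Suc (length us)) (bas (us @ a # b # vs)) = (if a < b then bas (us @ b # a # vs)
     else if a = b then scT vq (bas (us @ a # b # vs))
     else scT (vq - inverse vq) (bas (us @ a # b # vs)) + bas (us @ b # a # vs))"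
  by (simp add: hb_swp swp_append nth_append)

abbreviation omv :: "nat \<Rightarrow> tv" where "omv r \<equiv> bas [1..int r]"

abbreviation cycT :: "tv \<Rightarrow> tv set" where "cycT \<equiv> umodule.cyc scT actT"

lemma omv_tens [simp]: "omv r \<in> tens r"
  by (rule tens_bas) simp

lemma upto_split: "1 \<le> j \<Longrightarrow> j < r \<Longrightarrow>
  [1..int r] = [1..int j - 1] @ int j # (int j + 1) # [int j + 2..int r]"
proof -
  assume j: "1 \<le> j" "j < r"
  have "[1..int r] = [1..int j - 1] @ [int j..int r]"
    using j upto_split1[of 1 "int j" "int r"] by simp
  also have "[int j..int r] = int j # [int j + 1..int r]" using j by (simp add: upto_rec1)
  also have "[int j + 1..int r] = (int j + 1) # [int j + 2..int r]"
    using j by (subst upto_rec1) (auto simp: algebra_simps)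
  finally show ?thesis .
qed

text \<open>First the generated submodule absorbs the Hecke action, hence contains all
  rearrangements of any basis tensor that it contains; then sorted words are reached by moving
  letters that occur only once.\<close>

lemma cyc_omv: "cycT (omv r) = tens r"
proof -
  interpret T: polmod scT "tens r" actT by (rule polmod_tens)
  let ?G = "cycT (omv r)"
  have G: "T.subm ?G" by (rule T.subm_cyc) simp
  have Gadd: "x \<in> ?G \<Longrightarrow> y \<in> ?G \<Longrightarrow> x + y \<in> ?G" and Gsc: "x \<in> ?G \<Longrightarrow> scT c x \<in> ?G"
    and Gact: "x \<in> ?G \<Longrightarrow> actT g x \<in> ?G" and GT: "?G \<subseteq> tens r" for x y c g
    using G unfolding T.subm_def by blast+
  have Gdiff: "x \<in> ?G \<Longrightarrow> y \<in> ?G \<Longrightarrow> x - y \<in> ?G" for x y by (rule T.subm_diff[OF G])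
  have Gdiv: "x \<in> ?G" if "scT c x \<in> ?G" "c \<noteq> 0" for c x
    using Gsc[OF that(1), of "inverse c"] that(2) by simp
  have om: "omv r \<in> ?G" by (rule T.cyc_self)
  \<comment> \<open>\<open>F j\<close> merges the letters \<open>j\<close> and \<open>j + 1\<close>
    into a double \<open>j + 1\<close>; \<open>E j\<close> splits it again, and subtracting the
    known multiple of \<open>omv r\<close> leaves the swapped tensor.\<close>
  have hs_om: "hs j (omv r) \<in> ?G" if j: "1 \<le> j" "j < r" for j
  proof -
    define us where "us = [1..int j - 1]"
    define vs where "vs = [int j + 2..int r]"
    have e: "[1..int r] = us @ int j # (int j + 1) # vs" unfolding us_def vs_def by (rule upto_split[OF j])
    have a: "int j \<notin> set us" "int j + 1 \<notin> set us" "int j \<notin> set ((int j + 1) # vs)" "int j + 1 \<notin> set vs"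
      by (auto simp: us_def vs_def)
    have len: "Suc (length us) = j" using j by (simp add: us_def)
    obtain c where c: "c \<noteq> 0" "gb (F (int j)) (us @ int j # (int j + 1) # vs) = scT c (bas (us @ (int j + 1) # (int j + 1) # vs))"
      using gb_F_single[OF a(1,3)] by blast
    obtain d e' where d: "e' \<noteq> 0" "gb (E (int j)) (us @ (int j + 1) # (int j + 1) # vs)
      = scT d (bas (us @ int j # (int j + 1) # vs)) + scT e' (bas (us @ (int j + 1) # int j # vs))"
      using gb_E_pair[OF a(2,4)] by blast
    have "bas (us @ (int j + 1) # (int j + 1) # vs) \<in> ?G"
      using Gact[OF om, of "F (int j)"] c Gdiv[OF _ c(1)] by (simp add: e)
    from Gact[OF this, of "E (int j)"] have
      "scT d (omv r) + scT e' (bas (us @ (int j + 1) # int j # vs)) \<in> ?G" using d by (simp add: e)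
    from Gdiff[OF this Gsc[OF om, of d]] have "bas (us @ (int j + 1) # int j # vs) \<in> ?G"
      using Gdiv[OF _ d(1)] by simp
    then show ?thesis using hs_bas_append[of us "int j" "int j + 1" vs] len by (simp add: e)
  qed
  \<comment> \<open>The actions commute, so stability under the Hecke generators needs to be known
    at the generating vector only.\<close>
  have hsG: "hs j x \<in> ?G" if x: "x \<in> ?G" and j: "1 \<le> j" "j < r" for x j
  proof -
    have w: "hs j (foldr actT w (omv r)) = foldr actT w (hs j (omv r))" for w
    proof (induction w)
      case (Cons g w)
      then show ?case using actT_hs[OF T.word_M[OF omv_tens, of w] j, of g] by (simp del: hs_bas)
    qed simp
    have w': "foldr actT w (hs j (omv r)) \<in> ?G" for w
      by (induction w) (use hs_om[OF j] Gact in auto)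
    have "x \<in> tens r \<and> hs j x \<in> ?G"
      using x unfolding T.cyc_def
    proof (induction rule: T.span_induct_alt)
      case base
      then show ?case by (simp add: T.span_zero)
    next
      case (step c u x)
      then have u: "u \<in> tens r" "hs j u \<in> ?G" using w w' T.word_M[OF omv_tens] by auto
      then show ?case using step.IH Gadd Gsc unfolding T.cyc_def
        by (auto simp: hs_add hs_scT tens_FS)
    qed
    then show ?thesis by simp
  qed
  have perm: "bas w' \<in> ?G" if "bas w \<in> ?G" "length w = r" "mset w = mset w'" for w w'
  proof -
    have "bas w' \<in> ?G \<and> length w' = r"
    proof (rule swap_closure[OF _ that(3), where Q = "\<lambda>w. bas w \<in> ?G \<and> length w = r"])
      fix us a b vs
      assume Q: "bas (us @ a # b # vs) \<in> ?G \<and> length (us @ a # b # vs) = r"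
      then have h: "hs (Suc (length us)) (bas (us @ a # b # vs)) \<in> ?G" by (intro hsG) auto
      consider "a < b" | "a = b" | "a > b" by linarith
      then have "bas (us @ b # a # vs) \<in> ?G"
      proof cases
        case 3
        then have "hs (Suc (length us)) (bas (us @ a # b # vs)) - scT (vq - inverse vq) (bas (us @ a # b # vs))
          = bas (us @ b # a # vs)" unfolding hs_bas_append by simp
        then show ?thesis using Gdiff[OF h Gsc] Q by metis
      qed (use h Q hs_bas_append[of us a b vs] in auto)
      then show "bas (us @ b # a # vs) \<in> ?G \<and> length (us @ b # a # vs) = r" using Q by simp
    qed (use that in auto)
    then show ?thesis by simp
  qed
  have sorted: "bas w \<in> ?G" if w: "sorted w" "length w = r" for w
  proof -
    obtain s where s: "split_step\<^sup>*\<^sup>* w s" "split_step\<^sup>*\<^sup>* [1..int r] s" "distinct s" using split_step_common[OF w] .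
    have "bas s \<in> ?G \<and> distinct s"
      using s(2)
    proof (induction rule: rtranclp_induct)
      case (step w1 w2)
      then obtain us y vs where e: "w1 = us @ y # vs" "w2 = us @ (y + 1) # vs" unfolding split_step_def by blast
      then have "y \<notin> set us" "y \<notin> set vs" using step.IH by auto
      then obtain c where "c \<noteq> 0" "gb (F y) w1 = scT c (bas w2)" using gb_F_single e by blast
      then show ?case using Gact[of "bas w1" "F y"] step.IH Gdiv split_step_props(2)[OF step.hyps(2)] by auto
    qed (use om in auto)
    then have sG: "bas s \<in> ?G" by simp
    \<comment> \<open>From \<open>s\<close> the path to \<open>w\<close> is run backwards: in each
      step the letter \<open>y + 1\<close> occurs once, so \<open>E y\<close> undoes the move
      exactly, up to a unit.\<close>
    show ?thesis
      using s(1)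
    proof (induction rule: converse_rtranclp_induct)
      case (step w1 w2)
      then obtain us y vs where e: "w1 = us @ y # vs" "w2 = us @ (y + 1) # vs"
        "\<forall>x\<in>set us. x \<le> y" "\<forall>x\<in>set vs. y + 1 < x" unfolding split_step_def by blast
      then have "y + 1 \<notin> set us" "y + 1 \<notin> set vs" by force+
      then obtain c where "c \<noteq> 0" "gb (E y) w2 = scT c (bas w1)" using gb_E_single e by blast
      then show ?case using Gact[of "bas w2" "E y"] step.IH Gdiv by auto
    qed (rule sG)
  qed
  have all: "bas w \<in> ?G" if "length w = r" for w
    using perm[OF sorted[of "sort w"], of w] that by simp
  have "f \<in> ?G" if f: "f \<in> tens r" for f
  proof -
    have "(\<Sum>w\<in>{w. f w \<noteq> 0}. scT (f w) (bas w)) \<in> ?G"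
      using all tens_len[OF f] Gsc by (intro T.subm_sum[OF G]) auto
    then show ?thesis using FS_expand[OF tens_FS[OF f]] by simp
  qed
  then show ?thesis using GT by blast
qed

text \<open>\<open>Send\<close> without the normalisation outside \<open>tens r\<close>. The
  generators satisfy this directly, whereas they would first have to be cut off to lie in
  \<open>Send r\<close>.\<close>

definition hlin :: "nat \<Rightarrow> (tv \<Rightarrow> tv) \<Rightarrow> bool" where
  "hlin r \<phi> \<longleftrightarrow> (\<forall>f\<in>tens r. \<phi> f \<in> tens r) \<and>
     (\<forall>f\<in>tens r. \<forall>g\<in>tens r. \<phi> (f + g) = \<phi> f + \<phi> g) \<and>
     (\<forall>c. \<forall>f\<in>tens r. \<phi> (scT c f) = scT c (\<phi> f)) \<and>
     (\<forall>j. \<forall>f\<in>tens r. 1 \<le> j \<and> j < r \<longrightarrow> \<phi> (hs j f) = hs j (\<phi> f))"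

lemma Send_iff: "\<phi> \<in> Send r \<longleftrightarrow> (\<forall>f. f \<notin> tens r \<longrightarrow> \<phi> f = 0) \<and> hlin r \<phi>"
  by (auto simp: Send_def hlin_def)

lemma hlinD:
  assumes "hlin r \<phi>"
  shows "f \<in> tens r \<Longrightarrow> \<phi> f \<in> tens r"
    and "f \<in> tens r \<Longrightarrow> g \<in> tens r \<Longrightarrow> \<phi> (f + g) = \<phi> f + \<phi> g"
    and "f \<in> tens r \<Longrightarrow> \<phi> (scT c f) = scT c (\<phi> f)"
    and "f \<in> tens r \<Longrightarrow> 1 \<le> j \<Longrightarrow> j < r \<Longrightarrow> \<phi> (hs j f) = hs j (\<phi> f)"
  using assms by (auto simp: hlin_def)

lemma hlin_0: "hlin r \<phi> \<Longrightarrow> \<phi> 0 = 0"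
  using hlinD(3)[of r \<phi> 0 0] by simp

lemma hlin_comp: "hlin r \<phi> \<Longrightarrow> hlin r \<psi> \<Longrightarrow> hlin r (\<phi> \<circ> \<psi>)"
  by (auto simp: hlin_def)

lemma hlin_id: "hlin r (\<lambda>x. x)"
  by (auto simp: hlin_def)

lemma hlin_actT: "hlin r (actT g)"
  by (auto simp: hlin_def actT_add actT_scT tens_FS actT_hs)

lemma hlin_word: "hlin r (foldr actT w)"
proof (induction w)
  case Nil
  then show ?case using hlin_id by (simp add: id_def)
next
  case (Cons g w)
  have e: "foldr actT (g # w) = actT g \<circ> foldr actT w" by auto
  show ?case unfolding e by (rule hlin_comp[OF hlin_actT Cons.IH])
qed

lemma hlin_add: "hlin r \<phi> \<Longrightarrow> hlin r \<psi> \<Longrightarrow> hlin r (\<lambda>x. scT c (\<phi> x) + \<psi> x)"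
  by (auto simp: hlin_def hs_add hs_scT tens_FS[of _ r] T.scale_right_distrib algebra_simps T.scale_left_commute)

lemma hlin_expand:
  assumes \<phi>: "hlin r \<phi>" and f: "f \<in> tens r"
  shows "\<phi> f = (\<Sum>w\<in>{w. f w \<noteq> 0}. scT (f w) (\<phi> (bas w)))"
proof -
  have "finite A \<Longrightarrow> (\<And>w. w \<in> A \<Longrightarrow> length w = r) \<Longrightarrow> (\<Sum>w\<in>A. scT (f w) (bas w)) \<in> tens r \<and>
    \<phi> (\<Sum>w\<in>A. scT (f w) (bas w)) = (\<Sum>w\<in>A. scT (f w) (\<phi> (bas w)))" for A
    by (induction A rule: finite_induct) (auto simp: hlin_0[OF \<phi>] hlinD[OF \<phi>] tens_bas tens_scT)
  from this[of "{w. f w \<noteq> 0}"] show ?thesis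
    using FS_expand[OF tens_FS[OF f]] tens_FS[OF f] tens_len[OF f] by (simp add: FS_def)
qed

lemma hlin_eqI:
  assumes "hlin r \<phi>" "hlin r \<psi>" "f \<in> tens r" "\<And>w. f w \<noteq> 0 \<Longrightarrow> \<phi> (bas w) = \<psi> (bas w)"
  shows "\<phi> f = \<psi> f"
  unfolding hlin_expand[OF assms(1,3)] hlin_expand[OF assms(2,3)] using assms(4) by (auto intro!: sum.cong)

text \<open>Each adjacent swap of letters is expressed by a Hecke generator and the unswapped
  tensor, so an equality at one basis tensor spreads to its rearrangements.\<close>

lemma hlin_eq_perm:
  assumes \<phi>: "hlin r \<phi>" and \<psi>: "hlin r \<psi>" and w: "length w = r" "\<phi> (bas w) = \<psi> (bas w)" "mset w = mset w'"
  shows "\<phi> (bas w') = \<psi> (bas w')"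
proof -
  have "\<phi> (bas w') = \<psi> (bas w') \<and> length w' = r"
  proof (rule swap_closure[OF _ w(3), where Q = "\<lambda>w. \<phi> (bas w) = \<psi> (bas w) \<and> length w = r"])
    fix us a b vs
    assume Q: "\<phi> (bas (us @ a # b # vs)) = \<psi> (bas (us @ a # b # vs)) \<and> length (us @ a # b # vs) = r"
    let ?w = "us @ a # b # vs" and ?w' = "us @ b # a # vs"
    have t: "bas ?w \<in> tens r" "bas ?w' \<in> tens r" using Q by auto
    have h: "\<phi> (hs (Suc (length us)) (bas ?w)) = \<psi> (hs (Suc (length us)) (bas ?w))"
      using Q t hlinD(4)[OF \<phi>, of "bas ?w" "Suc (length us)"] hlinD(4)[OF \<psi>, of "bas ?w" "Suc (length us)"] by auto
    consider "a < b" | "a = b" | "a > b" by linarith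
    then have "\<phi> (bas ?w') = \<psi> (bas ?w')"
    proof cases
      case 3
      then have "hs (Suc (length us)) (bas ?w) = scT (vq - inverse vq) (bas ?w) + bas ?w'" unfolding hs_bas_append by simp
      then show ?thesis using h Q t hlinD(2,3)[OF \<phi>] hlinD(2,3)[OF \<psi>] by (simp add: tens_scT)
    qed (use h Q hs_bas_append[of us a b vs] in auto)
    then show "\<phi> (bas ?w') = \<psi> (bas ?w') \<and> length ?w' = r" using Q by simp
  qed (use w in auto)
  then show ?thesis by simp
qed

text \<open>Cyclicity of tensor space provides an operator from U with any prescribed value at
  \<open>omv r\<close>. That it comes from U is recorded only through
  \<open>T x \<in> cycT x\<close>, which is what is used later.\<close>

lemma ex_U_op:
  assumes "y \<in> tens r"
  shows "\<exists>T. hlin r T \<and> T (omv r) = y \<and> (\<forall>x\<in>tens r. T x \<in> cycT x)"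
proof -
  interpret T: polmod scT "tens r" actT by (rule polmod_tens)
  have "y \<in> T.cyc (omv r)" using assms by (simp add: cyc_omv)
  then show ?thesis unfolding T.cyc_def[of "omv r"]
  proof (induction rule: T.span_induct_alt)
    case base
    then show ?case by (intro exI[of _ "\<lambda>x. 0"]) (auto simp: hlin_def T.cyc_def T.span_zero)
  next
    case (step c u y)
    then obtain w S where w: "u = foldr actT w (omv r)"
      and S: "hlin r S" "S (omv r) = y" "\<forall>x\<in>tens r. S x \<in> cycT x" by auto
    have "scT c (foldr actT w x) + S x \<in> cycT x" if "x \<in> tens r" for x
      using T.cyc_word[of w x] S(3) that by (simp add: T.cyc_def T.span_add T.span_scale)
    then show ?case using hlin_add[OF hlin_word S(1)] w S(2)
      by (intro exI[of _ "\<lambda>x. scT c (foldr actT w x) + S x"]) auto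
  qed
qed

lemma cont_eq_mset: "cont w = cont w' \<Longrightarrow> mset w = mset w'"
  by (auto simp: fun_eq_iff multiset_eq_iff count_mset)

text \<open>Both legs of the path through the spread-out word are reversible moves of a single
  letter to an empty place.\<close>

lemma ws_embeds_spread:
  assumes w: "sorted w" "length w = r"
  shows "\<exists>L. umodule.ws_embeds scT (tens r) actT L (cont w) (cont [1..int r])"
proof -
  interpret T: polmod scT "tens r" actT by (rule polmod_tens)
  obtain s where s: "split_step\<^sup>*\<^sup>* w s" "split_step\<^sup>*\<^sup>* [1..int r] s" "distinct s" using split_step_common[OF w] .
  obtain L where L: "\<forall>x\<in>set w \<union> set [1..int r]. L \<le> x"
    by (metis List.finite_set bdd_below_def bdd_below_finite finite_UnI)
  have "T.ws_embeds L (cont w) (cont s) \<and> (\<forall>x\<in>set s. L \<le> x)"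
    using s(1)
  proof (induction rule: rtranclp_induct)
    case base
    then show ?case using L T.ws_embeds_refl by auto
  next
    case (step w1 w2)
    then obtain us y vs where e: "w1 = us @ y # vs" "w2 = us @ (y + 1) # vs"
        "\<forall>x\<in>set us. x \<le> y" "\<forall>x\<in>set vs. y + 1 < x" unfolding split_step_def by blast
    have "y + 1 \<notin> set us" "y + 1 \<notin> set vs" using e by force+
    then have z: "count_list us (y + 1) = 0" "count_list vs (y + 1) = 0" by (simp_all add: count_list_0_iff)
    have "T.ws_embeds L (cont w1) (\<lambda>j. cont w1 j + int 1 * dl j (y + 1) - int 1 * dl j y)"
      using step.IH z by (intro T.ws_embeds_F) (auto simp: e)
    moreover have "(\<lambda>j. cont w1 j + int 1 * dl j (y + 1) - int 1 * dl j y) = cont w2"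
      by (auto simp: e dl_def)
    ultimately show ?case using T.ws_embeds_trans step.IH split_step_props(3)[OF step.hyps(2)] by metis
  qed
  \<comment> \<open>This leg runs from the far end back, so \<open>E\<close> is used: distinctness
    makes the place \<open>y\<close> empty in \<open>w2\<close>.\<close>
  moreover have "T.ws_embeds L (cont s) (cont [1..int r]) \<and> (\<forall>x\<in>set s. L \<le> x) \<and> distinct s"
    using s(2)
  proof (induction rule: rtranclp_induct)
    case base
    then show ?case using L T.ws_embeds_refl by auto
  next
    case (step w1 w2)
    then obtain us y vs where e: "w1 = us @ y # vs" "w2 = us @ (y + 1) # vs" unfolding split_step_def by blast
    have "y \<notin> set us" "y \<notin> set vs" using e step.IH by auto
    then have z: "count_list us y = 0" "count_list vs y = 0" by (simp_all add: count_list_0_iff)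
    have "T.ws_embeds L (cont w2) (\<lambda>j. cont w2 j + int 1 * dl j y - int 1 * dl j (y + 1))"
      using step.IH z by (intro T.ws_embeds_E) (auto simp: e)
    moreover have "(\<lambda>j. cont w2 j + int 1 * dl j y - int 1 * dl j (y + 1)) = cont w1"
      by (auto simp: e dl_def)
    ultimately show ?case using T.ws_embeds_trans step.IH split_step_props(2,3)[OF step.hyps(2)] by metis
  qed
  ultimately show ?thesis using T.ws_embeds_trans by blast
qed

text \<open>This gives S u = U u for such weight vectors. Transport \<open>u\<close> reversibly to
  the weight of \<open>omv r\<close>; there the Hecke-linear operator coincides with one coming from
  U, since agreement at \<open>omv r\<close> spreads over all rearrangements of
  \<open>[1..int r]\<close>.\<close>

lemma hlin_cyc:
  assumes \<phi>: "hlin r \<phi>" and w: "sorted w" "length w = r" and u: "u \<in> wspace scT (tens r) actT (cont w)"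
  shows "\<phi> u \<in> cycT u"
proof -
  interpret T: polmod scT "tens r" actT by (rule polmod_tens)
  obtain d d' c where d: "foldr actT d u \<in> T.ws (cont [1..int r])" "scT c (foldr actT d' (foldr actT d u)) = u"
    using ws_embeds_spread[OF w] u unfolding T.ws_embeds_def by blast
  let ?x = "foldr actT d u"
  have x: "?x \<in> tens r" using d(1) by (rule T.ws_M)
  have \<psi>: "hlin r (\<phi> \<circ> foldr actT d')" by (rule hlin_comp[OF \<phi> hlin_word])
  obtain S where S: "hlin r S" "S (omv r) = (\<phi> \<circ> foldr actT d') (omv r)" "\<forall>x\<in>tens r. S x \<in> cycT x"
    using ex_U_op[OF hlinD(1)[OF \<psi> omv_tens]] by blast
  have "S ?x = (\<phi> \<circ> foldr actT d') ?x"
  proof (rule hlin_eqI[OF S(1) \<psi> x])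
    fix w assume "?x w \<noteq> 0"
    then have "cont w = cont [1..int r]" using d(1) unfolding wspace_tens by blast
    then have "mset [1..int r] = mset w" using cont_eq_mset by metis
    then show "S (bas w) = (\<phi> \<circ> foldr actT d') (bas w)"
      using hlin_eq_perm[OF S(1) \<psi> _ S(2)] by simp
  qed
  moreover have "\<phi> u = scT c (\<phi> (foldr actT d' ?x))"
    using d(2) hlinD(3)[OF \<phi> T.word_M[OF x], of c d'] by simp
  ultimately have e: "\<phi> u = scT c (S ?x)" by simp
  have u': "u \<in> tens r" using u by (rule T.ws_M)
  have cu: "T.subm (cycT u)" by (rule T.subm_cyc[OF u'])
  have "cycT ?x \<subseteq> cycT u" by (rule T.cyc_least[OF cu T.cyc_word])
  then have "S ?x \<in> cycT u" using S(3) x by blast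
  then show ?thesis unfolding e using cu unfolding T.subm_def by blast
qed

text \<open>Existence: project onto the tensors with content that of \<open>[1..int r]\<close>,
  which commutes with the Hecke action, then apply an operator sending \<open>omv r\<close> to
  \<open>u\<close>. No freeness over the Hecke algebra has to be shown.\<close>

lemma ex1_zmu:
  assumes u: "u \<in> tens r"
  shows "\<exists>!z. z \<in> Send r \<and> (\<forall>w. length w = r \<and> mset w \<noteq> mset [1..int r] \<longrightarrow> z (bas w) = 0) \<and> z (omv r) = u"
proof (rule ex_ex1I)
  obtain S where S: "hlin r S" "S (omv r) = u" using ex_U_op[OF u] by blast
  define P where "P = diag (\<lambda>w. if mset w = mset [1..int r] then 1 else 0)"
  have P: "hlin r P"
    unfolding hlin_def P_def
  proof (intro conjI ballI allI impI)
    fix f assume f: "f \<in> tens r"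
    show "diag (\<lambda>w. if mset w = mset [1..int r] then 1 else 0) f \<in> tens r"
      using f FS_diag[OF tens_FS[OF f], of "\<lambda>w. if mset w = mset [1..int r] then 1 else 0"]
      by (auto simp: tens_def FS_def diag_def)
    show "diag (\<lambda>w. if mset w = mset [1..int r] then 1 else 0) (hs j f)
      = hs j (diag (\<lambda>w. if mset w = mset [1..int r] then 1 else 0) f)" if "1 \<le> j \<and> j < r" for j
      using that by (intro diag_hs[OF f]) (auto simp: mset_swp)
  qed (simp_all add: diag_add diag_scT)
  have SP: "hlin r (S \<circ> P)" by (rule hlin_comp[OF S(1) P])
  define z where "z f = (if f \<in> tens r then (S \<circ> P) f else 0)" for f
  have "z \<in> Send r" unfolding Send_iff
    using SP by (auto simp: z_def hlin_def)
  moreover have "z (bas w) = 0" if "length w = r" "mset w \<noteq> mset [1..int r]" for w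
    using that hlin_0[OF S(1)] by (simp add: z_def P_def)
  moreover have "z (omv r) = u" using S(2) by (simp add: z_def P_def)
  ultimately show "\<exists>z. z \<in> Send r \<and> (\<forall>w. length w = r \<and> mset w \<noteq> mset [1..int r] \<longrightarrow> z (bas w) = 0) \<and> z (omv r) = u"
    by blast
next
  fix z z'
  assume z: "z \<in> Send r \<and> (\<forall>w. length w = r \<and> mset w \<noteq> mset [1..int r] \<longrightarrow> z (bas w) = 0) \<and> z (omv r) = u"
    and z': "z' \<in> Send r \<and> (\<forall>w. length w = r \<and> mset w \<noteq> mset [1..int r] \<longrightarrow> z' (bas w) = 0) \<and> z' (omv r) = u"
  have h: "hlin r z" "hlin r z'" using z z' by (auto simp: Send_iff)
  have "z (bas w) = z' (bas w)" if "length w = r" for w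
  proof (cases "mset w = mset [1..int r]")
    case True
    then show ?thesis using hlin_eq_perm[OF h, of "[1..int r]" w] z z' by simp
  qed (use z z' that in simp)
  then have "z f = z' f" if "f \<in> tens r" for f
    using hlin_eqI[OF h that] tens_len[OF that] by blast
  then show "z = z'" using z z' by (auto simp: Send_iff fun_eq_iff) metis
qed

section \<open>Permutations and reduced words\<close>

abbreviation tau :: "nat \<Rightarrow> nat \<Rightarrow> nat" where "tau j \<equiv> transpose j (Suc j)"

text \<open>Positions are counted from 1, so place permutations become composition on the
  right.\<close>

definition word_of :: "nat \<Rightarrow> (nat \<Rightarrow> int) \<Rightarrow> int list" where "word_of r t = map t [1..<Suc r]"

lemma length_wd [simp]: "length (word_of r t) = r"
  by (simp add: word_of_def)

lemma word_of_nth [simp]: "i < r \<Longrightarrow> word_of r t ! i = t (Suc i)"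
  by (simp add: word_of_def del: upt_Suc)

lemma word_of_eq_iff: "word_of r t = word_of r t' \<longleftrightarrow> (\<forall>p\<in>{1..r}. t p = t' p)"
  by (auto simp: word_of_def)

lemma count_wd: "count_list (word_of r t) k = card {p \<in> {1..r}. t p = k}"
proof -
  have "count_list (map t xs) k = card {p \<in> set xs. t p = k}" if "distinct xs" for xs
    using that
  proof (induction xs)
    case (Cons x xs)
    have "{p \<in> set (x # xs). t p = k} = (if t x = k then insert x {p \<in> set xs. t p = k} else {p \<in> set xs. t p = k})"
      by auto
    then show ?case using Cons by auto
  qed simp
  from this[of "[1..<Suc r]"] show ?thesis
    by (simp add: word_of_def atLeastLessThanSuc_atLeastAtMost del: upt_Suc)
qed

lemma swp_wd:
  assumes "1 \<le> j" "j < r" shows "swp j (word_of r t) = word_of r (t \<circ> tau j)"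
proof (rule nth_equalityI)
  fix i assume i: "i < length (swp j (word_of r t))"
  obtain k where k: "j = Suc k" using assms by (cases j) auto
  consider "i = k" | "i = Suc k" | "i \<noteq> k" "i \<noteq> Suc k" by blast
  then show "swp j (word_of r t) ! i = word_of r (t \<circ> tau j) ! i"
    using i assms swp_nth[of j "word_of r t"] k by cases (auto simp: transpose_apply_other)
qed simp

lemma hs_wd:
  assumes "1 \<le> j" "j < r"
  shows "t j < t (Suc j) \<Longrightarrow> hs j (bas (word_of r t)) = bas (word_of r (t \<circ> tau j))"
    and "t (Suc j) < t j \<Longrightarrow> hs j (bas (word_of r t)) = scT (vq - inverse vq) (bas (word_of r t)) + bas (word_of r (t \<circ> tau j))"
  using assms swp_wd[OF assms, of t] by (auto simp: hb_swp)

definition Inv :: "nat \<Rightarrow> (nat \<Rightarrow> nat) \<Rightarrow> (nat \<times> nat) set" where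
  "Inv r s = {(i, j). 1 \<le> i \<and> i < j \<and> j \<le> r \<and> s j < s i}"

lemma finite_Inv: "finite (Inv r s)"
  by (rule finite_subset[of _ "{1..r} \<times> {1..r}"]) (auto simp: Inv_def)

lemma ell_Inv: "ell r s = card (Inv r s)"
  by (simp add: ell_def Inv_def)

lemma tau_less: "a < b \<Longrightarrow> (a, b) \<noteq> (j, Suc j) \<Longrightarrow> tau j a < tau j b"
  by (auto simp: transpose_def)

lemma tau_range: "1 \<le> j \<Longrightarrow> j < r \<Longrightarrow> 1 \<le> a \<Longrightarrow> a \<le> r \<Longrightarrow> 1 \<le> tau j a \<and> tau j a \<le> r"
  by (auto simp: transpose_def)

text \<open>\<open>tau j\<close> preserves the order of every pair except \<open>(j, Suc j)\<close>,
  so it transports inversions and adds exactly that pair.\<close>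

lemma Inv_tau:
  assumes j: "1 \<le> j" "j < r" and s: "s j < s (Suc j)"
  shows "Inv r (s \<circ> tau j) = insert (j, Suc j) ((\<lambda>(a, b). (tau j a, tau j b)) ` Inv r s)"
proof (intro equalityI subsetI)
  fix x assume x: "x \<in> Inv r (s \<circ> tau j)"
  obtain a b where ab: "x = (a, b)" by (cases x)
  show "x \<in> insert (j, Suc j) ((\<lambda>(a, b). (tau j a, tau j b)) ` Inv r s)"
  proof (cases "x = (j, Suc j)")
    case False
    then have "(tau j a, tau j b) \<in> Inv r s"
      using x tau_less[of a b j] tau_range[OF j, of a] tau_range[OF j, of b] unfolding ab Inv_def by auto
    then have "(\<lambda>(a, b). (tau j a, tau j b)) (tau j a, tau j b) \<in> (\<lambda>(a, b). (tau j a, tau j b)) ` Inv r s"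
      by (rule imageI)
    then show ?thesis by (simp add: ab)
  qed simp
next
  fix x assume x: "x \<in> insert (j, Suc j) ((\<lambda>(a, b). (tau j a, tau j b)) ` Inv r s)"
  then show "x \<in> Inv r (s \<circ> tau j)"
  proof
    assume "x = (j, Suc j)"
    then show ?thesis using j s by (auto simp: Inv_def)
  next
    assume "x \<in> (\<lambda>(a, b). (tau j a, tau j b)) ` Inv r s"
    then obtain a b where ab: "(a, b) \<in> Inv r s" "x = (tau j a, tau j b)" by auto
    then have "(a, b) \<noteq> (j, Suc j)" using s by (auto simp: Inv_def)
    then show ?thesis
      using ab tau_less[of a b j] tau_range[OF j, of a] tau_range[OF j, of b] unfolding Inv_def by auto
  qed
qed

lemma ell_tau:
  assumes j: "1 \<le> j" "j < r" and s: "s j < s (Suc j)"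
  shows "ell r (s \<circ> tau j) = Suc (ell r s)"
proof -
  let ?f = "\<lambda>(a, b). (tau j a, tau j b)"
  have "(j, Suc j) \<notin> ?f ` Inv r s"
  proof
    assume "(j, Suc j) \<in> ?f ` Inv r s"
    then obtain a b where "(a, b) \<in> Inv r s" "tau j a = j" "tau j b = Suc j" by auto
    moreover have "tau j (tau j a) = a" "tau j (tau j b) = b" by simp_all
    ultimately have "a = Suc j" "b = j" "a < b" by (auto simp: Inv_def simp del: transpose_involutory)
    then show False by simp
  qed
  moreover have "inj_on ?f (Inv r s)"
    by (rule inj_onI) (auto dest: injD[OF inj_transpose])
  ultimately show ?thesis
    unfolding ell_Inv Inv_tau[OF j s] using finite_Inv[of r s] by (simp add: card_image)
qed

lemma ell_tau':
  assumes j: "1 \<le> j" "j < r" and s: "s (Suc j) < s j"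
  shows "ell r s = Suc (ell r (s \<circ> tau j))"
proof -
  have "s = (s \<circ> tau j) \<circ> tau j" by (simp add: comp_assoc)
  then show ?thesis using ell_tau[OF j, of "s \<circ> tau j"] s by simp
qed

lemma perms_tau: "1 \<le> j \<Longrightarrow> j < r \<Longrightarrow> tau j \<in> perms r"
  by (auto simp: perms_def intro: permutes_swap_id)

lemma perms_comp: "s \<in> perms r \<Longrightarrow> t \<in> perms r \<Longrightarrow> s \<circ> t \<in> perms r"
  by (auto simp: perms_def intro: permutes_compose)

lemma perms_id [simp]: "id \<in> perms r"
  by (simp add: perms_def permutes_id)

lemma perms_inv: "s \<in> perms r \<Longrightarrow> inv s \<in> perms r"
  by (auto simp: perms_def intro: permutes_inv)

lemma perms_inj: "s \<in> perms r \<Longrightarrow> s a = s b \<longleftrightarrow> a = b"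
  using permutes_inj[of s "{1..r}"] by (auto simp: perms_def dest: injD)

lemma perms_range: "s \<in> perms r \<Longrightarrow> p \<in> {1..r} \<Longrightarrow> s p \<in> {1..r}"
  using permutes_in_image[of s "{1..r}" p] by (auto simp: perms_def)

lemma perms_inv_apply [simp]: "s \<in> perms r \<Longrightarrow> s (inv s a) = a" "s \<in> perms r \<Longrightarrow> inv s (s a) = a"
  using permutes_inverses[of s "{1..r}"] by (auto simp: perms_def)

lemma perms_eqI: "s \<in> perms r \<Longrightarrow> t \<in> perms r \<Longrightarrow> (\<And>p. p \<in> {1..r} \<Longrightarrow> s p = t p) \<Longrightarrow> s = t"
  by (rule ext) (metis perms_def mem_Collect_eq permutes_not_in)

lemma finite_perms: "finite (perms r)"
  unfolding perms_def by (rule finite_permutations) simp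

abbreviation prodw :: "nat list \<Rightarrow> nat \<Rightarrow> nat" where
  "prodw js \<equiv> foldr (\<lambda>j t. transpose j (j + 1) \<circ> t) js id"

lemma prodw_snoc: "prodw (js @ [j]) = prodw js \<circ> tau j"
proof -
  have "foldr (\<lambda>j t. transpose j (j + 1) \<circ> t) js x = prodw js \<circ> x" for x :: "nat \<Rightarrow> nat"
    by (induction js) (auto simp: comp_assoc)
  from this[of "tau j"] show ?thesis by simp
qed

lemma prodw_perms: "set js \<subseteq> {1..<r} \<Longrightarrow> prodw js \<in> perms r"
  by (induction js) (use perms_comp[OF perms_tau] in auto)

lemma ell_id [simp]: "ell r id = 0"
proof -
  have "Inv r id = {}" by (auto simp: Inv_def)
  then show ?thesis by (simp add: ell_Inv)
qed

lemma tau_cases: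
  assumes "s \<in> perms r" "1 \<le> j" "j < r"
  obtains "s j < s (Suc j)" "ell r (s \<circ> tau j) = Suc (ell r s)"
  | "s (Suc j) < s j" "ell r s = Suc (ell r (s \<circ> tau j))"
proof -
  have "s j \<noteq> s (Suc j)" using perms_inj[OF assms(1)] by simp
  then show thesis using that ell_tau[of j r s] ell_tau'[of j r s] assms by (meson linorder_neqE_nat)
qed

lemma ell_tau_le: "s \<in> perms r \<Longrightarrow> 1 \<le> j \<Longrightarrow> j < r \<Longrightarrow> ell r (s \<circ> tau j) \<le> Suc (ell r s)"
  by (erule tau_cases; assumption?) linarith+

lemma ell_prodw_le: "set js \<subseteq> {1..<r} \<Longrightarrow> ell r (prodw js) \<le> length js"
proof (induction js rule: rev_induct)
  case (snoc j js)
  then have "prodw js \<in> perms r" "1 \<le> j" "j < r" using prodw_perms by auto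
  then have "ell r (prodw (js @ [j])) \<le> Suc (ell r (prodw js))" unfolding prodw_snoc by (rule ell_tau_le)
  moreover have "ell r (prodw js) \<le> length js" by (rule snoc.IH) (use snoc.prems in simp)
  ultimately show ?case by (metis (no_types) Suc_le_mono le_trans length_append_singleton)
qed simp

lemma redword_snoc:
  assumes "redword r s (js @ [j])"
  shows "redword r (prodw js) js" "s = prodw js \<circ> tau j" "prodw js j < prodw js (Suc j)" "1 \<le> j" "j < r"
    "prodw js \<in> perms r"
proof -
  have js: "set js \<subseteq> {1..<r}" "1 \<le> j" "j < r" and l: "Suc (length js) = ell r s" and s: "s = prodw js \<circ> tau j"
    using assms unfolding redword_def prodw_snoc by auto
  show p: "prodw js \<in> perms r" using prodw_perms[OF js(1)] .
  show "s = prodw js \<circ> tau j" "1 \<le> j" "j < r" by fact+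
  show "redword r (prodw js) js" "prodw js j < prodw js (Suc j)"
    using ell_prodw_le[OF js(1)] l s js
    by (cases rule: tau_cases[OF p js(2,3)]; auto simp: redword_def)+
qed

text \<open>Strictly increasing integers on \<open>n\<close> consecutive arguments that lie in
  \<open>n\<close> consecutive values leave no room: counting up from the left bounds
  \<open>f i\<close> below, counting down from the right bounds it above.\<close>

lemma increasing_interval:
  fixes f :: "nat \<Rightarrow> int"
  assumes inc: "\<And>i. a < i \<Longrightarrow> i < a + n \<Longrightarrow> f i < f (Suc i)"
    and lo: "\<And>i. i \<in> {a + 1..a + n} \<Longrightarrow> c < f i" and hi: "\<And>i. i \<in> {a + 1..a + n} \<Longrightarrow> f i \<le> c + int n"
    and i: "i \<in> {a + 1..a + n}"
  shows "f i = c + int i - int a"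
proof -
  have 1: "c + int (Suc k) \<le> f (a + Suc k)" if "Suc k \<le> n" for k
    using that
  proof (induction k)
    case 0
    then show ?case using lo[of "a + 1"] by simp
  next
    case (Suc k)
    then show ?case using inc[of "a + Suc k"] by simp
  qed
  have 2: "f (a + (n - k)) \<le> c + int (n - k)" if "k < n" for k
    using that
  proof (induction k)
    case 0
    then show ?case using hi[of "a + n"] by simp
  next
    case (Suc k)
    have "f (Suc (a + (n - Suc k))) = f (a + (n - k))" "int (n - k) = int (n - Suc k) + 1"
      using Suc.prems by (auto simp: Suc_diff_Suc simp flip: add_Suc_right)
    moreover have "a < a + (n - Suc k)" "a + (n - Suc k) < a + n" using Suc.prems by linarith+
    from inc[OF this] have "f (a + (n - Suc k)) < f (Suc (a + (n - Suc k)))" .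
    moreover have "f (a + (n - k)) \<le> c + int (n - k)" using Suc by simp
    ultimately show ?case by linarith
  qed
  define k where "k = i - a - 1"
  have k: "i = a + Suc k" "Suc k \<le> n" using i unfolding k_def by auto
  then have "n - (n - Suc k) = Suc k" "n - Suc k < n" by auto
  then show ?thesis using 1[OF k(2)] 2[of "n - Suc k"] k(1) by simp
qed

text \<open>Remove a descent, which shortens the permutation by one; without descents
  \<open>increasing_interval\<close> forces the identity.\<close>

lemma ex_redword: "s \<in> perms r \<Longrightarrow> \<exists>js. redword r s js"
proof (induction "ell r s" arbitrary: s rule: less_induct)
  case less
  show ?case
  proof (cases "\<exists>j. 1 \<le> j \<and> j < r \<and> s (Suc j) < s j")
    case True
    then obtain j where j: "1 \<le> j" "j < r" "s (Suc j) < s j" by blast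
    have e: "ell r s = Suc (ell r (s \<circ> tau j))" by (rule ell_tau'[of j r s]) (use j in auto)
    then obtain js where js: "redword r (s \<circ> tau j) js"
      using less.hyps[of "s \<circ> tau j"] perms_comp[OF less.prems perms_tau[OF j(1,2)]] by auto
    have "redword r s (js @ [j])"
      using js e j unfolding redword_def prodw_snoc by (auto simp: comp_assoc)
    then show ?thesis by blast
  next
    case False
    have "s i = i" if "i \<in> {1..r}" for i
    proof -
      have "s i < s (Suc i)" if "0 < i" "i < 0 + r" for i
        using False perms_inj[OF less.prems, of i "Suc i"] that
        by (metis Suc_leI add_0 linorder_neqE_nat n_not_Suc_n One_nat_def)
      then have "int (s i) = 0 + int i - int 0"
        using that perms_range[OF less.prems] by (intro increasing_interval[where n = r]) force+
      then show ?thesis by simp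
    qed
    then have "s = id" using less.prems by (intro perms_eqI) auto
    then show ?thesis by (intro exI[of _ "[]"]) (simp add: redword_def)
  qed
qed

text \<open>The hypothesis on inversions says that every swap along the reduced word exchanges an
  increasing pair of letters, where the Hecke generator acts by a plain swap. The result is the same
  for all reduced words, so the arbitrary choice in \<open>heckT\<close> is harmless and no braid
  relations are needed.\<close>

lemma fold_hs_wd:
  assumes "redword r s js" "\<And>i k. (i, k) \<in> Inv r s \<Longrightarrow> t (s k) < t (s i)"
  shows "fold hs js (bas (word_of r t)) = bas (word_of r (t \<circ> s))"
  using assms
proof (induction js arbitrary: s rule: rev_induct)
  case Nil
  then show ?case by (simp add: redword_def)
next
  case (snoc j js)
  note r = redword_snoc[OF snoc.prems(1)]
  let ?s' = "prodw js"
  have I: "Inv r s = insert (j, Suc j) ((\<lambda>(a, b). (tau j a, tau j b)) ` Inv r ?s')"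
    unfolding r(2) by (rule Inv_tau[OF r(4,5,3)])
  have e: "s (tau j x) = ?s' x" for x using fun_cong[OF r(2), of "tau j x"] by simp
  have "fold hs js (bas (word_of r t)) = bas (word_of r (t \<circ> ?s'))"
  proof (rule snoc.IH[OF r(1)])
    fix i k assume ik: "(i, k) \<in> Inv r ?s'"
    then have "(tau j i, tau j k) \<in> Inv r s" unfolding I by force
    then show "t (?s' k) < t (?s' i)" using snoc.prems(2)[of "tau j i" "tau j k"] unfolding e by blast
  qed
  moreover have "t (s (Suc j)) < t (s j)" using snoc.prems(2)[of j "Suc j"] I by simp
  then have "t (?s' j) < t (?s' (Suc j))" using e[of j] e[of "Suc j"] by simp
  then have "hs j (bas (word_of r (t \<circ> ?s'))) = bas (word_of r (t \<circ> ?s' \<circ> tau j))"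
    by (intro hs_wd(1)[OF r(4,5)]) simp
  moreover have "t \<circ> ?s' \<circ> tau j = t \<circ> s" by (simp only: r(2) comp_assoc)
  moreover have "fold hs (js @ [j]) (bas (word_of r t)) = hs j (fold hs js (bas (word_of r t)))" by simp
  ultimately show ?case by (simp only:)
qed

lemma heckT_wd:
  assumes "s \<in> perms r" "\<And>i k. (i, k) \<in> Inv r s \<Longrightarrow> t (s k) < t (s i)"
  shows "heckT r s (bas (word_of r t)) = bas (word_of r (t \<circ> s))"
proof -
  have "redword r s (SOME js. redword r s js)" by (rule someI_ex[OF ex_redword[OF assms(1)]])
  then show ?thesis unfolding heckT_def by (rule fold_hs_wd) (use assms(2) in blast)
qed

lemma heckT_scT:
  assumes "FS f" shows "heckT r s (scT c f) = scT c (heckT r s f)"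
proof -
  have "FS (fold hs js f) \<and> fold hs js (scT c f) = scT c (fold hs js f)" for js
    using assms by (induction js arbitrary: f) (auto simp: hs_scT)
  then show ?thesis by (simp add: heckT_def)
qed

lemma ell_inv:
  assumes s: "s \<in> perms r" shows "ell r (inv s) = ell r s"
proof -
  have le: "ell r (inv s) \<le> ell r s" if s: "s \<in> perms r" for s
  proof -
    have "Inv r (inv s) \<subseteq> (\<lambda>(a, b). (s b, s a)) ` Inv r s"
    proof
      fix x assume x: "x \<in> Inv r (inv s)"
      obtain a b where ab: "x = (a, b)" by (cases x)
      have "(inv s b, inv s a) \<in> Inv r s"
        using x s perms_range[OF perms_inv[OF s], of a] perms_range[OF perms_inv[OF s], of b]
        unfolding ab Inv_def by auto
      then have "(\<lambda>(a, b). (s b, s a)) (inv s b, inv s a) \<in> (\<lambda>(a, b). (s b, s a)) ` Inv r s" by (rule imageI)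
      then show "x \<in> (\<lambda>(a, b). (s b, s a)) ` Inv r s" using s by (simp add: ab)
    qed
    then show ?thesis unfolding ell_Inv by (meson card_image_le card_mono finite_Inv finite_imageI le_trans)
  qed
  have "inv (inv s) = s" using s permutes_inv_inv[of s "{1..r}"] by (simp add: perms_def)
  then show ?thesis using le[OF s] le[OF perms_inv[OF s]] by simp
qed

section \<open>Compositions, their consecutive blocks and Young subgroups\<close>

locale composition =
  fixes r :: nat and la :: "int \<Rightarrow> nat"
  assumes fin: "finite {i. la i \<noteq> 0}" and rk: "rk la = r"
begin

lemma psum_Suc: "psum la (k + 1) = psum la k + la k"
proof (cases "la k = 0")
  case True
  then have "{i. i < k + 1 \<and> la i \<noteq> 0} = {i. i < k \<and> la i \<noteq> 0}" by (auto simp: zless_add1_eq) (metis less_irrefl order_le_less)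
  then show ?thesis using True by (simp add: psum_def)
next
  case False
  then have "{i. i < k + 1 \<and> la i \<noteq> 0} = insert k {i. i < k \<and> la i \<noteq> 0}" by auto
  moreover have "finite {i. i < k \<and> la i \<noteq> 0}" by (rule finite_subset[OF _ fin]) auto
  ultimately show ?thesis by (simp add: psum_def)
qed

lemma psum_mono: "k \<le> k' \<Longrightarrow> psum la k \<le> psum la k'"
  by (induction k' rule: int_ge_induct) (auto simp: psum_Suc)

lemma psum_le: "psum la k \<le> r"
  unfolding psum_def rk[symmetric] rk_def using fin by (intro sum_mono2) auto

lemma blockset_Suc: "blockset la k = {psum la k + 1..psum la (k + 1)}"
  by (simp add: blockset_def psum_Suc)

lemma blockset_range: "blockset la k \<subseteq> {1..r}"
  unfolding blockset_Suc using psum_le[of "k + 1"] by auto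

lemma blockset_less: "p \<in> blockset la k \<Longrightarrow> q \<in> blockset la k' \<Longrightarrow> k < k' \<Longrightarrow> p < q"
  unfolding blockset_Suc using psum_mono[of "k + 1" k'] by auto

lemma ex_blockset:
  assumes "p \<in> {1..r}" shows "\<exists>k. p \<in> blockset la k"
proof -
  obtain B where B: "\<forall>i\<in>{i. la i \<noteq> 0}. B \<le> i"
    using fin by (meson bdd_below_finite bdd_below_def)
  obtain C where C: "\<forall>i\<in>{i. la i \<noteq> 0}. i \<le> C"
    using fin by (meson bdd_above_finite bdd_above_def)
  have "{i. i < B \<and> la i \<noteq> 0} = {}" using B by force
  then have p0: "psum la B = 0" by (simp add: psum_def)
  have "i < max B (C + 1)" if "la i \<noteq> 0" for i
  proof -
    have "i \<le> C" using C that by blast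
    then show ?thesis by simp
  qed
  then have "{i. i < max B (C + 1) \<and> la i \<noteq> 0} = {i. la i \<noteq> 0}" by blast
  then have p1: "psum la (max B (C + 1)) = r" using rk by (simp add: psum_def rk_def)
  have "p \<le> psum la k \<Longrightarrow> \<exists>k. p \<in> blockset la k" if "B \<le> k" for k
    using that
  proof (induction k rule: int_ge_induct)
    case (step k)
    then show ?case by (cases "p \<le> psum la k") (auto simp: blockset_Suc intro!: exI[of _ k])
  qed (use p0 assms in auto)
  then show ?thesis using p1 assms by (metis atLeastAtMost_iff max.cobounded1)
qed

definition blk :: "nat \<Rightarrow> int" where "blk p = (THE k. p \<in> blockset la k)"

lemma blk_eqI: "p \<in> blockset la k \<Longrightarrow> blk p = k"
  unfolding blk_def
proof (rule the_equality)
  fix k' assume "p \<in> blockset la k" "p \<in> blockset la k'"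
  then show "k' = k"
    using blockset_less[of p k p k'] blockset_less[of p k' p k] by (meson less_irrefl linorder_cases)
qed

lemma in_blockset: "p \<in> {1..r} \<Longrightarrow> p \<in> blockset la (blk p)"
  using ex_blockset blk_eqI by blast

lemma blk_iff: "p \<in> {1..r} \<Longrightarrow> blk p = k \<longleftrightarrow> p \<in> blockset la k"
  using in_blockset blk_eqI by blast

lemma blk_mono: "p \<in> {1..r} \<Longrightarrow> q \<in> {1..r} \<Longrightarrow> p \<le> q \<Longrightarrow> blk p \<le> blk q"
  using blockset_less[OF in_blockset in_blockset, of q p] by (meson not_le)

lemma blk_between: "p \<in> {1..r} \<Longrightarrow> q \<in> {1..r} \<Longrightarrow> blk p = blk q \<Longrightarrow> p \<le> i \<Longrightarrow> i \<le> q \<Longrightarrow> blk i = blk p"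
  using blk_mono[of p i] blk_mono[of i q] by simp

lemma blk_fiber: "{p \<in> {1..r}. blk p = k} = blockset la k"
  using blk_iff blockset_range by blast

lemma card_blockset [simp]: "card (blockset la k) = la k"
  by (simp add: blockset_def)

lemma sorted_blk: "sorted (word_of r blk)"
  unfolding word_of_def sorted_map by (rule sorted_wrt_mono_rel[OF _ sorted_upt]) (auto intro: blk_mono)

lemma omw_eq: "omw la = word_of r blk"
  unfolding omw_def
proof (rule the_equality)
  show *: "sorted (word_of r blk) \<and> (\<forall>k. count_list (word_of r blk) k = la k)"
    using sorted_blk unfolding count_wd blk_fiber by simp
  fix w assume w: "sorted w \<and> (\<forall>k. count_list w k = la k)"
  then have "mset w = mset (word_of r blk)" using * by (simp add: multiset_eq_iff count_mset)
  then show "w = word_of r blk" using w * by (metis properties_for_sort)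
qed

lemma young_iff: "s \<in> young r la \<longleftrightarrow> s \<in> perms r \<and> (\<forall>p\<in>{1..r}. blk (s p) = blk p)"
proof
  assume s: "s \<in> young r la"
  then have "s (p) \<in> blockset la (blk p)" if "p \<in> {1..r}" for p
    using in_blockset[OF that] by (auto simp: young_def)
  then show "s \<in> perms r \<and> (\<forall>p\<in>{1..r}. blk (s p) = blk p)"
    using s blk_eqI by (auto simp: young_def)
next
  assume s: "s \<in> perms r \<and> (\<forall>p\<in>{1..r}. blk (s p) = blk p)"
  have "s ` blockset la k = blockset la k" for k
  proof (rule endo_inj_surj)
    show "finite (blockset la k)" by (simp add: blockset_def)
    show "s ` blockset la k \<subseteq> blockset la k"
    proof (rule image_subsetI)
      fix p assume p: "p \<in> blockset la k"
      then have p': "p \<in> {1..r}" using blockset_range by blast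
      then have "blk (s p) = k" using s blk_eqI[OF p] by simp
      then show "s p \<in> blockset la k" using in_blockset[OF perms_range[OF _ p', of s]] s by simp
    qed
    show "inj_on s (blockset la k)" using perms_inj s by (auto intro: inj_onI)
  qed
  then show "s \<in> young r la" using s by (simp add: young_def)
qed

lemma young_perms: "s \<in> young r la \<Longrightarrow> s \<in> perms r"
  by (simp add: young_iff)

lemma young_blk: "s \<in> young r la \<Longrightarrow> p \<in> {1..r} \<Longrightarrow> blk (s p) = blk p"
  by (simp add: young_iff)

lemma young_comp: "s \<in> young r la \<Longrightarrow> t \<in> young r la \<Longrightarrow> s \<circ> t \<in> young r la"
  using perms_range by (auto simp: young_iff perms_comp)

lemma young_id [simp]: "id \<in> young r la"
  by (simp add: young_iff)

lemma young_transpose: "p \<in> {1..r} \<Longrightarrow> q \<in> {1..r} \<Longrightarrow> blk p = blk q \<Longrightarrow> transpose p q \<in> young r la"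
  by (auto simp: young_iff perms_def transpose_def intro: permutes_swap_id)

lemma finite_young: "finite (young r la)"
  by (rule finite_subset[OF _ finite_perms]) (auto simp: young_iff)

text \<open>Blocks are intervals, so monotonicity on a block follows from its adjacent pairs, on
  which minimal length gives information.\<close>

lemma block_step_mono:
  fixes f :: "nat \<Rightarrow> nat"
  assumes "\<And>j. 1 \<le> j \<Longrightarrow> j < r \<Longrightarrow> blk j = blk (Suc j) \<Longrightarrow> f j < f (Suc j)"
    and "p \<in> {1..r}" "q \<in> {1..r}" "blk p = blk q" "p < q"
  shows "f p < f q"
proof -
  have "Suc p \<le> q" using assms by simp
  moreover have "q \<in> {1..r} \<Longrightarrow> blk p = blk q \<Longrightarrow> f p < f q" if "Suc p \<le> q" for q
    using that
  proof (induction q rule: dec_induct)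
    case base
    then show ?case using assms by auto
  next
    case (step q)
    have "blk q = blk p" using blk_between[of p "Suc q" q] step assms(2) by auto
    moreover have "q \<in> {1..r}" using step assms(2) by auto
    ultimately show ?case using step assms(1)[of q] by force
  qed
  ultimately show ?thesis using assms by blast
qed

end

section \<open>The double coset representative and the generator of the Weyl module\<close>

lemma card_fibers:
  assumes "finite A" "finite I"
  shows "card {p \<in> A. f p \<in> I} = (\<Sum>i\<in>I. card {p \<in> A. f p = i})"
  using assms(2)
proof (induction I rule: finite_induct)
  case (insert i I)
  have "{p \<in> A. f p \<in> insert i I} = {p \<in> A. f p = i} \<union> {p \<in> A. f p \<in> I}" by auto
  moreover have "card ({p \<in> A. f p = i} \<union> {p \<in> A. f p \<in> I}) = card {p \<in> A. f p = i} + card {p \<in> A. f p \<in> I}"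
    using insert.hyps assms(1) by (intro card_Un_disjoint) auto
  ultimately show ?case using insert by simp
qed simp

lemma initial_segment:
  fixes S :: "int set"
  assumes "finite S" "\<And>i. i \<in> S \<Longrightarrow> 1 \<le> i" "\<And>i j. 1 \<le> i \<Longrightarrow> i \<le> j \<Longrightarrow> j \<in> S \<Longrightarrow> i \<in> S"
  shows "S = {1..int (card S)}"
proof (cases "S = {}")
  case False
  define m where "m = Max S"
  have m: "m \<in> S" "\<And>i. i \<in> S \<Longrightarrow> i \<le> m" using Max_in[OF assms(1) False] Max_ge[OF assms(1)] by (auto simp: m_def)
  have S: "S = {1..m}"
  proof (intro equalityI subsetI)
    show "i \<in> S" if "i \<in> {1..m}" for i using assms(3)[of i m] m(1) that by simp
    show "i \<in> {1..m}" if "i \<in> S" for i using assms(2)[OF that] m(2)[OF that] by simp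
  qed
  have "int (card {1..m}) = m" using assms(2)[OF m(1)] by simp
  then show ?thesis unfolding S by simp
qed simp

text \<open>The picture is a Young diagram with row lengths \<open>mu\<close> and column lengths
  \<open>nu\<close>: \<open>M.blk\<close> numbers positions by row, \<open>N.blk\<close> by column,
  and words are read as fillings of the columns one after the other.\<close>

locale partition =
  fixes r :: nat and mu :: "int \<Rightarrow> nat"
  assumes part: "is_partition r mu"
begin

abbreviation nu :: "int \<Rightarrow> nat" where "nu \<equiv> conj mu"

lemma mu_low: "i \<le> 0 \<Longrightarrow> mu i = 0"
  and mu_mono: "1 \<le> i \<Longrightarrow> i \<le> j \<Longrightarrow> mu j \<le> mu i"
  and mu_fin: "finite {i. mu i \<noteq> 0}"
  and mu_rk: "rk mu = r"
  using part by (auto simp: is_partition_def)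

lemma mu_supp: "mu i \<noteq> 0 \<Longrightarrow> 1 \<le> i"
  using mu_low[of i] by force

lemma conj_set:
  assumes "1 \<le> l" shows "{j. nat l \<le> mu j} = {1..int (nu l)}"
proof -
  have "finite {j. nat l \<le> mu j}" by (rule finite_subset[OF _ mu_fin]) (use assms in auto)
  moreover have "1 \<le> j" if "nat l \<le> mu j" for j using mu_supp[of j] that assms by linarith
  moreover have "nat l \<le> mu i" if "1 \<le> i" "i \<le> j" "nat l \<le> mu j" for i j
    using mu_mono[OF that(1,2)] that(3) by simp
  ultimately have "{j. nat l \<le> mu j} = {1..int (card {j. nat l \<le> mu j})}"
    by (intro initial_segment; blast)
  then show ?thesis using assms by (simp add: conj_def)
qed

lemma conj_iff: "1 \<le> l \<Longrightarrow> 1 \<le> k \<Longrightarrow> k \<le> int (nu l) \<longleftrightarrow> nat l \<le> mu k"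
proof -
  assume l: "1 \<le> l" and k: "1 \<le> k"
  have "nat l \<le> mu k \<longleftrightarrow> k \<in> {1..int (nu l)}" using conj_set[OF l] by blast
  then show ?thesis using k by simp
qed

lemma mu_le: "mu i \<le> r"
proof (cases "mu i = 0")
  case False
  then show ?thesis using member_le_sum[of i "{i. mu i \<noteq> 0}" mu] mu_fin mu_rk by (auto simp: rk_def)
qed simp

lemma mu_supp_le:
  assumes "mu j \<noteq> 0" shows "j \<le> int r"
proof -
  have sub: "{1..j} \<subseteq> {i. mu i \<noteq> 0}" using mu_mono[of _ j] assms by force
  have "nat j = card {1..j}" by simp
  also have "\<dots> \<le> card {i. mu i \<noteq> 0}" by (rule card_mono[OF mu_fin sub])
  also have "\<dots> = (\<Sum>i\<in>{i. mu i \<noteq> 0}. 1)" by simp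
  also have "\<dots> \<le> (\<Sum>i\<in>{i. mu i \<noteq> 0}. mu i)" by (intro sum_mono) auto
  also have "\<dots> = r" using mu_rk by (simp add: rk_def)
  finally show ?thesis by simp
qed

lemma sum_mu: "(\<Sum>i\<in>{1..int r}. mu i) = r"
proof -
  have "(\<Sum>i\<in>{i. mu i \<noteq> 0}. mu i) = (\<Sum>i\<in>{1..int r}. mu i)"
    using mu_supp mu_supp_le by (intro sum.mono_neutral_left) auto
  then show ?thesis using mu_rk by (simp add: rk_def)
qed

lemma min_conj:
  assumes "1 \<le> l" shows "min (nu l) k = card {i \<in> {1..int k}. nat l \<le> mu i}"
proof -
  have "nat l \<le> mu i \<longleftrightarrow> i \<in> {1..int (nu l)}" for i using conj_set[OF assms] by blast
  then have "{i \<in> {1..int k}. nat l \<le> mu i} = {1..int k} \<inter> {1..int (nu l)}" by blast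
  also have "\<dots> = {1..int (min (nu l) k)}" by auto
  finally show ?thesis by simp
qed

text \<open>The boxes in the first \<open>k\<close> rows, counted once by columns and once by
  rows.\<close>

lemma sum_min: "(\<Sum>l\<in>{1..int r}. min (nu l) k) = (\<Sum>i\<in>{1..int k}. mu i)"
proof -
  have c: "card {x \<in> A. P x} = (\<Sum>x\<in>A. if P x then 1 else 0)" if "finite A" for A :: "int set" and P
    using that by (simp add: sum.If_cases Int_def)
  have "(\<Sum>l\<in>{1..int r}. min (nu l) k) = (\<Sum>l\<in>{1..int r}. \<Sum>i\<in>{1..int k}. if nat l \<le> mu i then 1 else 0)"
  proof (intro sum.cong refl)
    fix l :: int assume "l \<in> {1..int r}"
    then have "min (nu l) k = card {i \<in> {1..int k}. nat l \<le> mu i}" by (intro min_conj) simp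
    also have "\<dots> = (\<Sum>i\<in>{1..int k}. if nat l \<le> mu i then 1 else 0)" by (rule c) simp
    finally show "min (nu l) k = (\<Sum>i\<in>{1..int k}. if nat l \<le> mu i then 1 else 0)" .
  qed
  also have "\<dots> = (\<Sum>i\<in>{1..int k}. \<Sum>l\<in>{1..int r}. if nat l \<le> mu i then 1 else 0)" by (rule sum.swap)
  also have "\<dots> = (\<Sum>i\<in>{1..int k}. card {l \<in> {1..int r}. nat l \<le> mu i})"
    by (intro sum.cong refl c[symmetric]) simp
  also have "\<dots> = (\<Sum>i\<in>{1..int k}. mu i)"
  proof (intro sum.cong refl)
    fix i
    have "{l \<in> {1..int r}. nat l \<le> mu i} = {1..int (mu i)}" using mu_le[of i] by auto
    then show "card {l \<in> {1..int r}. nat l \<le> mu i} = mu i" by simp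
  qed
  finally show ?thesis .
qed

lemma nu_supp: "nu l \<noteq> 0 \<Longrightarrow> 1 \<le> l \<and> l \<le> int r"
proof -
  assume nz: "nu l \<noteq> 0"
  then have l: "1 \<le> l" by (auto simp: conj_def split: if_splits)
  then have "nat l \<le> mu 1" using conj_iff[of l 1] nz by simp
  then show ?thesis using l mu_le[of 1] by linarith
qed

lemma nu_le: "nu l \<le> r"
proof (cases "nu l = 0")
  case False
  then have l: "1 \<le> l" using nu_supp by blast
  then have "nat l \<le> mu (int (nu l))" using conj_iff[of l "int (nu l)"] False by simp
  then have "mu (int (nu l)) \<noteq> 0" using l by linarith
  then show ?thesis using mu_supp_le[of "int (nu l)"] by simp
qed simp

lemma nu_fin: "finite {l. nu l \<noteq> 0}"
  by (rule finite_subset[of _ "{1..int r}"]) (use nu_supp in auto)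

lemma nu_rk: "rk nu = r"
proof -
  have "rk nu = (\<Sum>l\<in>{1..int r}. nu l)"
    unfolding rk_def using nu_supp by (intro sum.mono_neutral_left) auto
  also have "\<dots> = (\<Sum>l\<in>{1..int r}. min (nu l) r)" using nu_le by (intro sum.cong) (auto simp: min_def)
  finally show ?thesis using sum_min[of r] sum_mu by simp
qed

sublocale M: composition r mu
  by unfold_locales (fact mu_fin mu_rk)+

sublocale N: composition r "conj mu"
  by unfold_locales (fact nu_fin nu_rk)+

lemma N_blk_range: "p \<in> {1..r} \<Longrightarrow> N.blk p \<in> {1..int r}"
  using N.in_blockset[of p] nu_supp[of "N.blk p"] by (fastforce simp: blockset_def)

text \<open>Fillings without repetition inside a column.\<close>

definition blk_inj :: "(nat \<Rightarrow> int) \<Rightarrow> bool" where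
  "blk_inj t \<longleftrightarrow> (\<forall>p\<in>{1..r}. \<forall>q\<in>{1..r}. N.blk p = N.blk q \<and> t p = t q \<longrightarrow> p = q)"

lemma card_block_le:
  assumes "blk_inj t"
  shows "card {p \<in> blockset nu l. t p \<in> {1..int k}} \<le> min (nu l) k"
proof -
  let ?B = "{p \<in> blockset nu l. t p \<in> {1..int k}}"
  have fin: "finite (blockset nu l)" by (simp add: blockset_def)
  have "card ?B \<le> card (blockset nu l)" using fin by (intro card_mono) auto
  moreover have "inj_on t ?B"
    using assms N.blockset_range[of l] N.blk_eqI unfolding blk_inj_def by (intro inj_onI) blast
  then have "card ?B = card (t ` ?B)" by (simp add: card_image)
  moreover have "card (t ` ?B) \<le> card {1..int k}" by (rule card_mono) auto
  ultimately show ?thesis by simp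
qed

lemma card_split:
  "card {p \<in> {1..r}. t p \<in> {1..int k}} = (\<Sum>l\<in>{1..int r}. card {p \<in> blockset nu l. t p \<in> {1..int k}})"
proof -
  let ?A = "{p \<in> {1..r}. t p \<in> {1..int k}}"
  have "?A = {p \<in> ?A. N.blk p \<in> {1..int r}}" using N_blk_range by blast
  then have "card ?A = card {p \<in> ?A. N.blk p \<in> {1..int r}}" by simp
  also have "\<dots> = (\<Sum>l\<in>{1..int r}. card {p \<in> ?A. N.blk p = l})" by (rule card_fibers) auto
  also have "\<dots> = (\<Sum>l\<in>{1..int r}. card {p \<in> blockset nu l. t p \<in> {1..int k}})"
  proof (intro sum.cong refl)
    fix l
    have "{p \<in> ?A. N.blk p = l} = {p \<in> blockset nu l. t p \<in> {1..int k}}"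
      using N.blk_fiber[of l] by blast
    then show "card {p \<in> ?A. N.blk p = l} = card {p \<in> blockset nu l. t p \<in> {1..int k}}" by simp
  qed
  finally show ?thesis .
qed

text \<open>A column of length \<open>nu l\<close> can hold at most \<open>min (nu l) k\<close> of
  the letters 1, ..., k; summing over the columns gives the boxes in the first \<open>k\<close>
  rows.\<close>

lemma dominance:
  assumes "blk_inj t"
  shows "card {p \<in> {1..r}. t p \<in> {1..int k}} \<le> (\<Sum>i\<in>{1..int k}. mu i)"
  unfolding card_split sum_min[symmetric] by (rule sum_mono) (rule card_block_le[OF assms])

text \<open>Gale and Ryser: if \<open>t\<close> moreover has content \<open>mu\<close>, then all the above estimates are equalities.\<close>

lemma entries_le:
  assumes t: "blk_inj t" and c: "\<And>k. card {p \<in> {1..r}. t p = k} = mu k" and p: "p \<in> {1..r}"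
  shows "1 \<le> t p \<and> t p \<le> int (nu (N.blk p))"
proof -
  let ?l = "N.blk p" and ?k = "nu (N.blk p)"
  \<comment> \<open>Content \<open>mu\<close> makes the total bound sharp for \<open>?k\<close>, so
    each column attains its own bound. With \<open>?k\<close> the length of the column of
    \<open>p\<close>, that whole column has entries in \<open>{1..int ?k}\<close>.\<close>
  have "(\<Sum>l\<in>{1..int r}. card {p \<in> blockset nu l. t p \<in> {1..int ?k}}) = (\<Sum>l\<in>{1..int r}. min (nu l) ?k)"
    unfolding card_split[symmetric] sum_min using c by (subst card_fibers) auto
  then have "card {p \<in> blockset nu ?l. t p \<in> {1..int ?k}} = min (nu ?l) ?k"
    using card_block_le[OF t] N_blk_range[OF p] by (rule sum_mono_inv) auto
  then have "card {p \<in> blockset nu ?l. t p \<in> {1..int ?k}} = card (blockset nu ?l)" by simp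
  then have "{p \<in> blockset nu ?l. t p \<in> {1..int ?k}} = blockset nu ?l"
    by (intro card_subset_eq) (auto simp: blockset_def)
  then show ?thesis using N.in_blockset[OF p] by auto
qed

definition dist_rep :: "(nat \<Rightarrow> nat) \<Rightarrow> bool" where
  "dist_rep w \<longleftrightarrow> w \<in> perms r \<and>
      (\<forall>x\<in>young r mu. \<forall>y\<in>young r nu. ell r w \<le> ell r (x \<circ> w \<circ> y)) \<and>
      {inv w \<circ> x \<circ> w | x. x \<in> young r mu} \<inter> young r nu = {id}"

text \<open>Two positions in a common column that \<open>w\<close> sends to a common row give a
  transposition in the intersection; conversely an element of the intersection preserves the column
  of each position and the row of its image.\<close>

lemma trivial_iff:
  assumes w: "w \<in> perms r"
  shows "{inv w \<circ> x \<circ> w | x. x \<in> young r mu} \<inter> young r nu = {id} \<longleftrightarrow> blk_inj (\<lambda>p. M.blk (w p))"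
proof
  assume triv: "{inv w \<circ> x \<circ> w | x. x \<in> young r mu} \<inter> young r nu = {id}"
  show "blk_inj (\<lambda>p. M.blk (w p))"
    unfolding blk_inj_def
  proof (intro ballI impI)
    fix p q assume p: "p \<in> {1..r}" and q: "q \<in> {1..r}" and e: "N.blk p = N.blk q \<and> M.blk (w p) = M.blk (w q)"
    let ?y = "transpose p q" and ?x = "transpose (w p) (w q)"
    have y: "?y \<in> young r nu" using N.young_transpose p q e by blast
    have x: "?x \<in> young r mu" using M.young_transpose perms_range[OF w] p q e by blast
    have "?y a = (inv w \<circ> ?x \<circ> w) a" for a
      using w perms_inj[OF w] by (auto simp: transpose_def)
    then have "?y = inv w \<circ> ?x \<circ> w" by (rule ext)
    then have "?y \<in> {inv w \<circ> x \<circ> w | x. x \<in> young r mu} \<inter> young r nu" using x y by blast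
    then have "?y = id" using triv by blast
    then show "p = q" by (metis id_apply transpose_apply_first)
  qed
next
  assume inj: "blk_inj (\<lambda>p. M.blk (w p))"
  have "inv w \<circ> id \<circ> w = id" using w by (auto simp: fun_eq_iff)
  then have "id \<in> {inv w \<circ> x \<circ> w | x. x \<in> young r mu} \<inter> young r nu" by (metis (mono_tags, lifting) IntI M.young_id N.young_id mem_Collect_eq)
  moreover have "y = id" if y: "y \<in> {inv w \<circ> x \<circ> w | x. x \<in> young r mu} \<inter> young r nu" for y
  proof (rule perms_eqI)
    obtain x where x: "x \<in> young r mu" "y = inv w \<circ> x \<circ> w" using y by blast
    show yp: "y \<in> perms r" using y N.young_perms by blast
    fix p assume p: "p \<in> {1..r}"
    have "w (y p) = x (w p)" using w by (simp add: x(2))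
    then have "M.blk (w (y p)) = M.blk (w p)" using M.young_blk[OF x(1) perms_range[OF w p]] by simp
    moreover have "N.blk (y p) = N.blk p" using N.young_blk p y by blast
    ultimately have "y p = p" using inj perms_range[OF yp p] p unfolding blk_inj_def by blast
    then show "y p = id p" by simp
  qed simp
  ultimately show "{inv w \<circ> x \<circ> w | x. x \<in> young r mu} \<inter> young r nu = {id}" by blast
qed

lemma content_perm:
  assumes w: "w \<in> perms r" shows "card {p \<in> {1..r}. M.blk (w p) = k} = mu k"
proof -
  have "w ` {p \<in> {1..r}. M.blk (w p) = k} = {p \<in> {1..r}. M.blk p = k}"
  proof (intro equalityI subsetI)
    fix a assume a: "a \<in> {p \<in> {1..r}. M.blk p = k}"
    then have "inv w a \<in> {p \<in> {1..r}. M.blk (w p) = k}"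
      using w perms_range[OF perms_inv[OF w], of a] by auto
    then show "a \<in> w ` {p \<in> {1..r}. M.blk (w p) = k}" by (rule image_eqI[rotated]) (use w in simp)
  qed (use perms_range[OF w] in auto)
  moreover have "inj_on w {p \<in> {1..r}. M.blk (w p) = k}" by (rule inj_onI) (simp add: perms_inj[OF w])
  from card_image[OF this] have "card (w ` {p \<in> {1..r}. M.blk (w p) = k}) = card {p \<in> {1..r}. M.blk (w p) = k}" .
  ultimately have "card {p \<in> {1..r}. M.blk (w p) = k} = card {p \<in> {1..r}. M.blk p = k}" by (simp only:)
  then show ?thesis unfolding M.blk_fiber by simp
qed

text \<open>Minimal length excludes descents of \<open>w\<close> inside columns and of
  \<open>inv w\<close> inside rows. With trivial intersection the rows met by a column increase
  strictly, and the bound of \<open>entries_le\<close> leaves only 1, 2, ..., which is the last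
  claim.\<close>

lemma dist_rep_props:
  assumes "dist_rep w"
  shows "w \<in> perms r"
    and "blk_inj (\<lambda>p. M.blk (w p))"
    and "\<And>p q. p \<in> {1..r} \<Longrightarrow> q \<in> {1..r} \<Longrightarrow> N.blk p = N.blk q \<Longrightarrow> p < q \<Longrightarrow> M.blk (w p) < M.blk (w q)"
    and "\<And>a b. a \<in> {1..r} \<Longrightarrow> b \<in> {1..r} \<Longrightarrow> M.blk a = M.blk b \<Longrightarrow> a < b \<Longrightarrow> inv w a < inv w b"
    and "\<And>p. p \<in> {1..r} \<Longrightarrow> M.blk (w p) = int p - int (psum nu (N.blk p))"
proof -
  show w: "w \<in> perms r" using assms by (simp add: dist_rep_def)
  show inj: "blk_inj (\<lambda>p. M.blk (w p))" using assms trivial_iff[OF w] by (simp add: dist_rep_def)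
  have min: "ell r w \<le> ell r (x \<circ> w \<circ> y)" if "x \<in> young r mu" "y \<in> young r nu" for x y
    using assms that by (simp add: dist_rep_def)
  have w1: "w p < w q" if "p \<in> {1..r}" "q \<in> {1..r}" "N.blk p = N.blk q" "p < q" for p q
  proof (rule N.block_step_mono[OF _ that])
    fix j assume j: "1 \<le> j" "j < r" "N.blk j = N.blk (Suc j)"
    have "tau j \<in> young r nu" using j by (intro N.young_transpose) auto
    then have "ell r w \<le> ell r (w \<circ> tau j)" using min[of id "tau j"] by simp
    then show "w j < w (Suc j)" by (cases rule: tau_cases[OF w j(1,2)]) auto
  qed
  have w2: "inv w a < inv w b" if "a \<in> {1..r}" "b \<in> {1..r}" "M.blk a = M.blk b" "a < b" for a b
  proof (rule M.block_step_mono[OF _ that])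
    fix j assume j: "1 \<le> j" "j < r" "M.blk j = M.blk (Suc j)"
    have "tau j \<in> young r mu" using j by (intro M.young_transpose) auto
    then have "ell r w \<le> ell r (tau j \<circ> w)" using min[of "tau j" id] by simp
    \<comment> \<open>Multiplication on the left becomes multiplication on the right after
      inverting, where descents are understood.\<close>
    also have "ell r (tau j \<circ> w) = ell r (inv (tau j \<circ> w))"
      using ell_inv perms_comp[OF perms_tau[OF j(1,2)] w] by simp
    also have "inv (tau j \<circ> w) = inv w \<circ> tau j"
      using w by (subst o_inv_distrib) (auto simp: perms_def permutes_bij bij_swap_iff)
    finally have "ell r (inv w) \<le> ell r (inv w \<circ> tau j)" by (simp only: ell_inv[OF w])
    then show "inv w j < inv w (Suc j)" by (cases rule: tau_cases[OF perms_inv[OF w] j(1,2)]) auto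
  qed
  then show "\<And>a b. a \<in> {1..r} \<Longrightarrow> b \<in> {1..r} \<Longrightarrow> M.blk a = M.blk b \<Longrightarrow> a < b \<Longrightarrow> inv w a < inv w b" .
  have t: "M.blk (w p) < M.blk (w q)" if pq: "p \<in> {1..r}" "q \<in> {1..r}" "N.blk p = N.blk q" "p < q" for p q
  proof -
    have "M.blk (w p) \<le> M.blk (w q)"
      using M.blk_mono[OF perms_range[OF w pq(1)] perms_range[OF w pq(2)]] w1[OF pq] by simp
    moreover have "M.blk (w p) \<noteq> M.blk (w q)" using inj pq unfolding blk_inj_def by blast
    ultimately show ?thesis by simp
  qed
  then show "\<And>p q. p \<in> {1..r} \<Longrightarrow> q \<in> {1..r} \<Longrightarrow> N.blk p = N.blk q \<Longrightarrow> p < q \<Longrightarrow> M.blk (w p) < M.blk (w q)" .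
  fix p assume p: "p \<in> {1..r}"
  let ?l = "N.blk p"
  have B: "i \<in> {1..r} \<and> N.blk i = ?l" if "i \<in> {psum nu ?l + 1..psum nu ?l + nu ?l}" for i
    using that N.blockset_range[of ?l] N.blk_eqI[of i ?l] unfolding blockset_def by blast
  have "M.blk (w p) = 0 + int p - int (psum nu ?l)"
  proof (rule increasing_interval[where n = "nu ?l"])
    show "M.blk (w i) < M.blk (w (Suc i))" if "psum nu ?l < i" "i < psum nu ?l + nu ?l" for i
      using that B[of i] B[of "Suc i"] by (intro t) auto
    show "0 < M.blk (w i)" "M.blk (w i) \<le> 0 + int (nu ?l)" if "i \<in> {psum nu ?l + 1..psum nu ?l + nu ?l}" for i
      using entries_le[OF inj content_perm[OF w], of i] B[OF that] by auto
    show "p \<in> {psum nu ?l + 1..psum nu ?l + nu ?l}" using N.in_blockset[OF p] by (simp add: blockset_def)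
  qed
  then show "M.blk (w p) = int p - int (psum nu ?l)" by simp
qed

text \<open>The row of \<open>w p\<close> is the height of \<open>p\<close> in its column for any
  such \<open>w\<close>. So \<open>w' \<circ> inv w\<close> preserves rows, and it is increasing on
  them, hence the identity.\<close>

lemma dist_rep_unique:
  assumes "dist_rep w" "dist_rep w'" shows "w = w'"
proof -
  note W = dist_rep_props[OF assms(1)] and W' = dist_rep_props[OF assms(2)]
  have wi: "inv w a \<in> {1..r}" if "a \<in> {1..r}" for a using perms_range[OF perms_inv[OF W(1)] that] .
  define \<sigma> where "\<sigma> a = w' (inv w a)" for a
  have \<sigma>r: "\<sigma> a \<in> {1..r}" if "a \<in> {1..r}" for a unfolding \<sigma>_def using perms_range[OF W'(1) wi[OF that]] .
  have \<sigma>b: "M.blk (\<sigma> a) = M.blk a" if "a \<in> {1..r}" for a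
    using W(5)[OF wi[OF that]] W'(5)[OF wi[OF that]] W(1) by (simp add: \<sigma>_def)
  have \<sigma>m: "\<sigma> a < \<sigma> b" if ab: "a \<in> {1..r}" "b \<in> {1..r}" "M.blk a = M.blk b" "a < b" for a b
  proof (rule ccontr)
    assume "\<not> \<sigma> a < \<sigma> b"
    moreover have lt: "inv w a < inv w b" using W(4)[OF ab] .
    then have "\<sigma> a \<noteq> \<sigma> b" using perms_inj[OF W'(1)] by (auto simp: \<sigma>_def)
    ultimately have "\<sigma> b < \<sigma> a" by simp
    then have "inv w' (\<sigma> b) < inv w' (\<sigma> a)" using W'(4)[OF \<sigma>r \<sigma>r] \<sigma>b ab by simp
    then show False using lt W'(1) by (simp add: \<sigma>_def)
  qed
  have "\<sigma> a = a" if a: "a \<in> {1..r}" for a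
  proof -
    let ?k = "M.blk a"
    have B: "i \<in> {1..r} \<and> M.blk i = ?k" if "i \<in> {psum mu ?k + 1..psum mu ?k + mu ?k}" for i
      using that M.blockset_range[of ?k] M.blk_eqI[of i ?k] unfolding blockset_def by blast
    have "int (\<sigma> a) = int (psum mu ?k) + int a - int (psum mu ?k)"
    proof (rule increasing_interval[where n = "mu ?k"])
      show "int (\<sigma> i) < int (\<sigma> (Suc i))" if "psum mu ?k < i" "i < psum mu ?k + mu ?k" for i
        using that B[of i] B[of "Suc i"] \<sigma>m[of i "Suc i"] by auto
      show "int (psum mu ?k) < int (\<sigma> i)" "int (\<sigma> i) \<le> int (psum mu ?k) + int (mu ?k)"
        if "i \<in> {psum mu ?k + 1..psum mu ?k + mu ?k}" for i
        using M.in_blockset[OF \<sigma>r, of i] \<sigma>b[of i] B[OF that] by (auto simp: blockset_def)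
      show "a \<in> {psum mu ?k + 1..psum mu ?k + mu ?k}" using M.in_blockset[OF a] by (simp add: blockset_def)
    qed
    then show ?thesis by simp
  qed
  from this[OF perms_range[OF W(1)]] have "w p = w' p" if "p \<in> {1..r}" for p
    using that by (simp add: \<sigma>_def perms_inv_apply(2)[OF W(1)])
  then show ?thesis by (rule perms_eqI[OF W(1) W'(1)])
qed

text \<open>The heights of the positions in their columns have content \<open>mu\<close>: the value
  \<open>k\<close> occurs once in each of the \<open>mu k\<close> columns of length at least
  \<open>k\<close>. So they are a rearrangement of the row numbers.\<close>

lemma ex_trivial: "\<exists>w\<in>perms r. blk_inj (\<lambda>p. M.blk (w p))"
proof -
  define t where "t p = int p - int (psum nu (N.blk p))" for p
  have "card {p \<in> {1..r}. t p = k} = mu k" for k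
  proof -
    have pos: "1 \<le> t p" if "p \<in> {1..r}" for p
      using N.in_blockset[OF that] by (auto simp: t_def blockset_def)
    show ?thesis
    proof (cases "1 \<le> k")
      case False
      then have "{p \<in> {1..r}. t p = k} = {}" using pos by force
      then show ?thesis using False mu_low[of k] by simp
    next
      case True
      have "{p \<in> {1..r}. t p = k} = {p \<in> {p \<in> {1..r}. t p = k}. N.blk p \<in> {1..int r}}"
        using N_blk_range by blast
      then have "card {p \<in> {1..r}. t p = k} = (\<Sum>l\<in>{1..int r}. card {p \<in> {p \<in> {1..r}. t p = k}. N.blk p = l})"
        using card_fibers[of "{p \<in> {1..r}. t p = k}" "{1..int r}" N.blk] by simp
      also have "\<dots> = (\<Sum>l\<in>{1..int r}. if nat l \<le> mu k then 1 else 0)"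
      proof (intro sum.cong refl)
        fix l assume l: "l \<in> {1..int r}"
        have "{p \<in> {p \<in> {1..r}. t p = k}. N.blk p = l} = {p \<in> blockset nu l. int p - int (psum nu l) = k}"
          using N.blk_fiber[of l] by (auto simp: t_def)
        also have "\<dots> = (if k \<le> int (nu l) then {psum nu l + nat k} else {})"
          using True by (auto simp: blockset_def)
        finally show "card {p \<in> {p \<in> {1..r}. t p = k}. N.blk p = l} = (if nat l \<le> mu k then 1 else 0)"
          using conj_iff[of l k] l True by simp
      qed
      also have "\<dots> = card {l \<in> {1..int r}. nat l \<le> mu k}" by (simp add: sum.If_cases Int_def)
      also have "{l \<in> {1..int r}. nat l \<le> mu k} = {1..int (mu k)}" using mu_le[of k] by auto
      finally show ?thesis by simp
    qed
  qed
  then have "count_list (word_of r t) k = count_list (word_of r M.blk) k" for k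
    unfolding count_wd M.blk_fiber by simp
  then have "mset (word_of r t) = mset (word_of r M.blk)" by (simp add: multiset_eq_iff count_mset)
  then have "image_mset t (mset_set {1..r}) = image_mset M.blk (mset_set {1..r})"
    by (simp add: word_of_def atLeastLessThanSuc_atLeastAtMost del: upt_Suc)
  then obtain w where w: "w permutes {1..r}" "\<forall>p\<in>{1..r}. t p = M.blk (w p)"
    using image_mset_eq_implies_permutes[of "{1..r}" t M.blk] by auto
  moreover have "blk_inj (\<lambda>p. M.blk (w p))"
    unfolding blk_inj_def
  proof (intro ballI impI)
    fix p q assume p: "p \<in> {1..r}" and q: "q \<in> {1..r}" and e: "N.blk p = N.blk q \<and> M.blk (w p) = M.blk (w q)"
    have "t p = t q" using w(2)[rule_format, OF p] w(2)[rule_format, OF q] e by simp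
    then show "p = q" using e by (simp add: t_def)
  qed
  ultimately show ?thesis by (auto simp: perms_def)
qed

text \<open>A shortest element of the double coset of any permutation with trivial intersection; the
  latter property holds throughout the coset.\<close>

lemma ex_dist_rep: "\<exists>w. dist_rep w"
proof -
  obtain w0 where w0: "w0 \<in> perms r" "blk_inj (\<lambda>p. M.blk (w0 p))" using ex_trivial by blast
  define D where "D w \<longleftrightarrow> (\<exists>x\<in>young r mu. \<exists>y\<in>young r nu. w = x \<circ> w0 \<circ> y)" for w
  have "D w0" unfolding D_def using M.young_id N.young_id by (metis comp_id id_comp)
  then obtain w where w: "D w" "\<And>w'. D w' \<Longrightarrow> ell r w \<le> ell r w'"
    using ex_has_least_nat[of D w0 "ell r"] by blast
  obtain x y where xy: "x \<in> young r mu" "y \<in> young r nu" "w = x \<circ> w0 \<circ> y" using w(1) unfolding D_def by blast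
  have yp: "y \<in> perms r" and xp: "x \<in> perms r" using xy M.young_perms N.young_perms by blast+
  have wp: "w \<in> perms r" unfolding xy(3) using perms_comp[OF perms_comp[OF xp w0(1)] yp] .
  have "blk_inj (\<lambda>p. M.blk (w p))"
    unfolding blk_inj_def
  proof (intro ballI impI)
    fix p q assume p: "p \<in> {1..r}" and q: "q \<in> {1..r}" and e: "N.blk p = N.blk q \<and> M.blk (w p) = M.blk (w q)"
    have "M.blk (w a) = M.blk (w0 (y a))" if "a \<in> {1..r}" for a
      using M.young_blk[OF xy(1) perms_range[OF w0(1) perms_range[OF yp that]]] by (simp add: xy(3))
    then have "M.blk (w0 (y p)) = M.blk (w0 (y q))" using e p q by simp
    moreover have "N.blk (y p) = N.blk (y q)" using e N.young_blk[OF xy(2)] p q by simp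
    ultimately have "y p = y q" using w0(2) perms_range[OF yp] p q unfolding blk_inj_def by blast
    then show "p = q" using perms_inj[OF yp] by simp
  qed
  moreover have "D (x' \<circ> w \<circ> y')" if "x' \<in> young r mu" "y' \<in> young r nu" for x' y'
  proof -
    have "x' \<circ> w \<circ> y' = (x' \<circ> x) \<circ> w0 \<circ> (y \<circ> y')" unfolding xy(3) by (simp only: comp_assoc)
    then show ?thesis unfolding D_def using M.young_comp[OF that(1) xy(1)] N.young_comp[OF xy(2) that(2)] by blast
  qed
  ultimately show ?thesis unfolding dist_rep_def using wp w(2) trivial_iff[OF wp] by blast
qed

lemma wmu: "dist_rep (wmu r mu)"
proof -
  have "\<exists>!w. dist_rep w" using ex_dist_rep dist_rep_unique by blast
  then have "dist_rep (THE w. dist_rep w)" by (rule theI')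
  then show ?thesis unfolding wmu_def dist_rep_def by (simp add: dist_rep_def)
qed

definition tab :: "nat \<Rightarrow> int" where "tab p = M.blk (wmu r mu p)"

lemma tab_inc: "p \<in> {1..r} \<Longrightarrow> q \<in> {1..r} \<Longrightarrow> N.blk p = N.blk q \<Longrightarrow> p < q \<Longrightarrow> tab p < tab q"
  unfolding tab_def using dist_rep_props(3)[OF wmu] .

text \<open>Up to a power of \<open>vq\<close> this is \<open>umu r mu\<close>: all reduced expressions involved only ever
  swap increasing letters, so no quadratic relation is needed.\<close>

definition alt :: tv where
  "alt = (\<Sum>s\<in>young r nu. scT ((- inverse vq) ^ ell r s) (bas (word_of r (tab \<circ> s))))"

lemma young_tab:
  assumes s: "s \<in> young r nu" and pq: "p \<in> {1..r}" "q \<in> {1..r}" "N.blk p = N.blk q" "s p < s q"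
  shows "tab (s p) < tab (s q)"
  using tab_inc[OF perms_range[OF N.young_perms[OF s] pq(1)] perms_range[OF N.young_perms[OF s] pq(2)]]
    N.young_blk[OF s] pq by simp

lemma umu_alt: "umu r mu = scT (vq ^ ell r (wmu r mu)) alt"
proof -
  let ?w = "wmu r mu"
  note W = dist_rep_props[OF wmu]
  have 1: "heckT r ?w (bas (word_of r M.blk)) = bas (word_of r (M.blk \<circ> ?w))"
  proof (rule heckT_wd[OF W(1)])
    fix i k assume ik: "(i, k) \<in> Inv r ?w"
    then have r: "i \<in> {1..r}" "k \<in> {1..r}" "i < k" "?w k < ?w i" by (auto simp: Inv_def)
    have r': "?w i \<in> {1..r}" "?w k \<in> {1..r}" using perms_range[OF W(1)] r by blast+
    \<comment> \<open>Equal letters cannot be met: \<open>inv w\<close> increases on rows, so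
      \<open>w\<close> has no inversion between two positions sent to the same row.\<close>
    have "M.blk (?w k) \<noteq> M.blk (?w i)"
      using W(4)[OF r'(2,1) _ r(4)] r(3) W(1) by auto
    moreover have "M.blk (?w k) \<le> M.blk (?w i)" using M.blk_mono[OF r'(2,1)] r(4) by simp
    ultimately show "M.blk (?w k) < M.blk (?w i)" by simp
  qed
  have 2: "heckT r s (bas (word_of r tab)) = bas (word_of r (tab \<circ> s))" if s: "s \<in> young r nu" for s
  proof (rule heckT_wd[OF N.young_perms[OF s]])
    fix i k assume ik: "(i, k) \<in> Inv r s"
    then have r: "i \<in> {1..r}" "k \<in> {1..r}" "i < k" "s k < s i" by (auto simp: Inv_def)
    have r': "s i \<in> {1..r}" "s k \<in> {1..r}" using perms_range[OF N.young_perms[OF s]] r by blast+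
    have "N.blk k = N.blk i"
      using N.blk_mono[OF r(1,2)] N.blk_mono[OF r'(2,1)] N.young_blk[OF s] r by simp
    then show "tab (s k) < tab (s i)" using young_tab[OF s] r by blast
  qed
  \<comment> \<open>The weight (-v^2)^(-l) in \<open>yv\<close> and the factor v^l in
    \<open>TT\<close> combine to (-v^(-1))^l.\<close>
  have c: "(- (vq ^ 2)) powi (- int n) * vq ^ n = (- inverse vq) ^ n" for n
  proof -
    have "(- (vq ^ 2)) powi (- int n) = inverse (- (vq ^ 2)) ^ n"
      by (simp only: power_int_minus power_int_of_nat power_inverse)
    then have "(- (vq ^ 2)) powi (- int n) * vq ^ n = (inverse (- (vq ^ 2)) * vq) ^ n"
      by (simp only: power_mult_distrib)
    also have "inverse (- (vq ^ 2)) * vq = - inverse vq" by (simp add: power2_eq_square)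
    finally show ?thesis .
  qed
  have t: "M.blk \<circ> ?w = tab" by (auto simp: tab_def)
  have "umu r mu = yv r nu (scT (vq ^ ell r ?w) (bas (word_of r tab)))"
    unfolding umu_def TT_def M.omw_eq 1 t ..
  also have "\<dots> = (\<Sum>s\<in>young r nu. scT (vq ^ ell r ?w) (scT ((- inverse vq) ^ ell r s) (bas (word_of r (tab \<circ> s)))))"
    unfolding yv_def TT_def
  proof (intro sum.cong refl)
    fix s assume s: "s \<in> young r nu"
    show "scT ((- (vq ^ 2)) powi (- int (ell r s))) (scT (vq ^ ell r s) (heckT r s (scT (vq ^ ell r ?w) (bas (word_of r tab)))))
      = scT (vq ^ ell r ?w) (scT ((- inverse vq) ^ ell r s) (bas (word_of r (tab \<circ> s))))"
      unfolding heckT_scT[OF FS_bas] 2[OF s] T.scale_scale mult.assoc[symmetric] c by (simp only: mult.commute)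
  qed
  also have "\<dots> = scT (vq ^ ell r ?w) alt"
    unfolding alt_def by (simp only: T.scale_sum_right)
  finally show ?thesis .
qed

lemma alt_tens: "alt \<in> tens r"
proof -
  have "finite A \<Longrightarrow> (\<Sum>s\<in>A. scT (c s) (bas (word_of r (tab \<circ> s)))) \<in> tens r" for A and c :: "(nat \<Rightarrow> nat) \<Rightarrow> qv"
    by (induction A rule: finite_induct) (simp_all add: tens_add tens_scT tens_bas)
  from this[OF N.finite_young, of "\<lambda>s. (- inverse vq) ^ ell r s"] show ?thesis unfolding alt_def .
qed

lemma alt_apply: "alt u = (\<Sum>s\<in>young r nu. (- inverse vq) ^ ell r s * (if u = word_of r (tab \<circ> s) then 1 else 0))"
  unfolding alt_def fsum_apply by (intro sum.cong refl) (simp only: fapp bas_apply)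

lemma alt_supp: "alt u \<noteq> 0 \<Longrightarrow> cont u = (\<lambda>i. int (mu i))"
proof
  fix k assume "alt u \<noteq> 0"
  then obtain s where "s \<in> young r nu" "(- inverse vq) ^ ell r s * (if u = word_of r (tab \<circ> s) then 1 else 0) \<noteq> 0"
    unfolding alt_apply by (rule sum.not_neutral_contains_not_neutral)
  then have s: "s \<in> young r nu" "u = word_of r (tab \<circ> s)" by (auto split: if_splits)
  have "tab \<circ> s = (\<lambda>p. M.blk ((wmu r mu \<circ> s) p))" by (auto simp: tab_def)
  then show "cont u k = int (mu k)"
    using content_perm[OF perms_comp[OF dist_rep_props(1)[OF wmu] N.young_perms[OF s(1)]], of k]
    unfolding s(2) count_wd by simp
qed

text \<open>Columns of \<open>tab\<close> increase strictly, so only the identity of the column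
  group fixes its word, which therefore has coefficient 1.\<close>

lemma alt_nz: "alt \<noteq> 0"
proof -
  have "word_of r tab = word_of r (tab \<circ> s) \<longleftrightarrow> s = id" if s: "s \<in> young r nu" for s
  proof
    assume "word_of r tab = word_of r (tab \<circ> s)"
    then have e: "tab p = tab (s p)" if "p \<in> {1..r}" for p using that by (simp add: word_of_eq_iff)
    show "s = id"
    proof (rule perms_eqI[OF N.young_perms[OF s] perms_id])
      fix p assume p: "p \<in> {1..r}"
      have sp: "s p \<in> {1..r}" using perms_range[OF N.young_perms[OF s] p] .
      show "s p = id p"
        using e[OF p] tab_inc[OF p sp] tab_inc[OF sp p] N.young_blk[OF s p] by (cases "s p" p rule: linorder_cases) auto
    qed
  qed simp
  then have "alt (word_of r tab) = (\<Sum>s\<in>young r nu. if s = id then (- inverse vq) ^ ell r s else 0)"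
    unfolding alt_apply by (intro sum.cong refl) simp
  also have "\<dots> = 1" using N.finite_young by (simp add: sum.delta)
  finally show ?thesis by (auto simp: fapp)
qed

text \<open>The column group splits into pairs \<open>s\<close>, \<open>s \<circ> tau j\<close> with
  \<open>s j < s (Suc j)\<close>. The two terms of a pair add up to an eigenvector of the Hecke
  generator for the eigenvalue -v^(-1).\<close>

lemma hs_alt:
  assumes j: "1 \<le> j" "j < r" "N.blk j = N.blk (Suc j)"
  shows "hs j alt = scT (- inverse vq) alt"
proof -
  let ?Y = "young r nu"
  define c where "c = - inverse vq"
  define g where "g s = scT (c ^ ell r s) (bas (word_of r (tab \<circ> s)))" for s
  define P where "P = {s \<in> ?Y. s j < s (Suc j)}"
  define Q where "Q = {s \<in> ?Y. s (Suc j) < s j}"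
  have fin: "finite ?Y" by (rule N.finite_young)
  have tY: "tau j \<in> ?Y" using j by (intro N.young_transpose) auto
  have jr: "j \<in> {1..r}" "Suc j \<in> {1..r}" using j by auto
  have Y: "?Y = P \<union> Q" "P \<inter> Q = {}"
    unfolding P_def Q_def using N.young_perms perms_inj by (auto simp: not_less) (metis le_neq_implies_less n_not_Suc_n)
  have bij: "bij_betw (\<lambda>s. s \<circ> tau j) P Q"
    by (rule bij_betw_byWitness[where f' = "\<lambda>s. s \<circ> tau j"])
       (auto simp: P_def Q_def comp_assoc N.young_comp[OF _ tY])
  have sumY: "(\<Sum>s\<in>?Y. G s) = (\<Sum>s\<in>P. G s + G (s \<circ> tau j))" for G :: "(nat \<Rightarrow> nat) \<Rightarrow> tv"
  proof -
    have "(\<Sum>s\<in>?Y. G s) = (\<Sum>s\<in>P. G s) + (\<Sum>s\<in>Q. G s)"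
      using fin Y by (metis (no_types, lifting) finite_Un sum.union_disjoint)
    also have "(\<Sum>s\<in>Q. G s) = (\<Sum>s\<in>P. G (s \<circ> tau j))" by (rule sum.reindex_bij_betw[OF bij, symmetric])
    finally show ?thesis by (simp add: sum.distrib)
  qed
  have pair: "hs j (g s + g (s \<circ> tau j)) = scT c (g s + g (s \<circ> tau j))" if s: "s \<in> P" for s
  proof -
    have sY: "s \<in> ?Y" "s j < s (Suc j)" using s by (auto simp: P_def)
    have l: "ell r (s \<circ> tau j) = Suc (ell r s)" using ell_tau[of j r s] j sY(2) by simp
    let ?a = "bas (word_of r (tab \<circ> s))" and ?b = "bas (word_of r (tab \<circ> (s \<circ> tau j)))"
    have lt: "tab (s j) < tab (s (Suc j))" using young_tab[OF sY(1) jr j(3) sY(2)] .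
    have 1: "hs j ?a = ?b" using hs_wd(1)[OF j(1,2), of "tab \<circ> s"] lt by (simp add: comp_assoc)
    have "tab \<circ> (s \<circ> tau j) \<circ> tau j = tab \<circ> s" by (simp add: comp_assoc)
    then have 2: "hs j ?b = scT (vq - inverse vq) ?b + ?a"
      using hs_wd(2)[OF j(1,2), of "tab \<circ> (s \<circ> tau j)"] lt by simp
    have q: "c * (vq - inverse vq) = c * c - 1" by (simp add: c_def algebra_simps)
    have "hs j (g s + g (s \<circ> tau j)) = scT (c ^ ell r s) (?b + scT c (scT (vq - inverse vq) ?b + ?a))"
      unfolding g_def l by (simp add: hs_add hs_scT 1 2 T.scale_right_distrib mult.commute del: hs_bas)
    also have "scT c (scT (vq - inverse vq) ?b + ?a) = scT (c * c - 1) ?b + scT c ?a"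
      by (simp add: T.scale_right_distrib q)
    also have "?b + (scT (c * c - 1) ?b + scT c ?a) = scT c (?a + scT c ?b)"
      by (simp add: T.scale_right_distrib T.scale_left_diff_distrib)
    also have "scT (c ^ ell r s) (scT c (?a + scT c ?b)) = scT c (g s + g (s \<circ> tau j))"
      unfolding g_def l by (simp add: T.scale_right_distrib mult_ac)
    finally show ?thesis .
  qed
  have FSg: "FS (g s)" for s by (simp add: g_def)
  have a: "alt = (\<Sum>s\<in>P. g s + g (s \<circ> tau j))"
    using sumY[of g] by (simp only: alt_def g_def c_def)
  have "hs j alt = (\<Sum>s\<in>P. hs j (g s + g (s \<circ> tau j)))"
    unfolding a using FSg by (intro linop_sum[OF linop_hs]) auto
  also have "\<dots> = (\<Sum>s\<in>P. scT c (g s + g (s \<circ> tau j)))" by (rule sum.cong[OF refl pair])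
  also have "\<dots> = scT c alt" unfolding a by (simp only: T.scale_sum_right)
  finally show ?thesis by (simp add: c_def)
qed

section \<open>Alternating vectors and the dominance bound on their weights\<close>

definition antisym_on :: "tv \<Rightarrow> bool" where
  "antisym_on f \<longleftrightarrow> (\<forall>j. 1 \<le> j \<and> j < r \<and> N.blk j = N.blk (Suc j) \<longrightarrow> hs j f = scT (- inverse vq) f)"

text \<open>Equal adjacent letters would require both eigenvalues v and -v^(-1). Otherwise swap the
  later equal letter one place to the left; the swapped coefficient is 0 by induction, and what
  remains of the eigenvalue equation forces \<open>f w = 0\<close> in all three cases. The indices
  \<open>p - 1\<close> and \<open>p + d\<close> belong to the positions \<open>p\<close> and
  \<open>p + Suc d\<close>.\<close>

lemma antisym_zero:
  assumes f: "f \<in> tens r" "antisym_on f" and p: "1 \<le> p" "p + Suc d \<le> r" "N.blk p = N.blk (p + Suc d)"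
    and w: "length w = r" "w ! (p - 1) = w ! (p + d)"
  shows "f w = 0"
  using p w
proof (induction d arbitrary: w)
  case 0
  then have j: "1 \<le> p" "p < r" "N.blk p = N.blk (Suc p)" by auto
  then have "hs p f w = - inverse vq * f w" using f(2) by (simp add: antisym_on_def fapp)
  moreover have "hs p f w = vq * f w" using hs_apply[OF tens_FS[OF f(1)], of p w] j 0 by simp
  ultimately have "(vq + inverse vq) * f w = 0" by (simp add: algebra_simps)
  moreover have "0 < vq + inverse vq" using vq_gt1 by (intro add_pos_pos) auto
  ultimately show ?case by simp
next
  case (Suc d)
  let ?j = "p + Suc d" and ?w = "swp (p + Suc d) w"
  have pr: "p \<in> {1..r}" "p + Suc (Suc d) \<in> {1..r}" using Suc.prems by auto
  have b: "N.blk ?j = N.blk p" using N.blk_between[OF pr Suc.prems(3), of ?j] by simp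
  have j: "1 \<le> ?j" "?j < r" "N.blk ?j = N.blk (Suc ?j)" using Suc.prems b by auto
  have jw: "1 \<le> ?j" "?j < length w" using j Suc.prems(4) by auto
  have "f ?w = 0"
  proof (rule Suc.IH)
    show "?w ! (p - 1) = ?w ! (p + d)"
      using swp_nth[OF jw] Suc.prems by auto
  qed (use Suc.prems b in auto)
  moreover have "hs ?j f w = - inverse vq * f w" using f(2) j by (simp add: antisym_on_def fapp)
  moreover have "hs ?j f w = (if w ! (?j - 1) < w ! ?j then f ?w else if w ! (?j - 1) = w ! ?j then vq * f w
     else (vq - inverse vq) * f w + f ?w)" by (rule hs_apply[OF tens_FS[OF f(1)] jw])
  ultimately have "- inverse vq * f w = 0 \<or> - inverse vq * f w = vq * f w \<or> - inverse vq * f w = (vq - inverse vq) * f w"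
    by (auto split: if_splits)
  moreover have "0 < vq + inverse vq" using vq_gt1 by (intro add_pos_pos) auto
  moreover have "(vq + inverse vq) * f w = 0" if "- inverse vq * f w = vq * f w"
    using that by (simp add: algebra_simps)
  moreover have "vq * f w = 0" if "- inverse vq * f w = (vq - inverse vq) * f w"
    using that by (simp add: algebra_simps)
  ultimately show ?case by auto
qed

lemma antisym_blk_inj:
  assumes f: "f \<in> tens r" "antisym_on f" and w: "f w \<noteq> 0"
  shows "blk_inj (\<lambda>p. w ! (p - 1))"
  unfolding blk_inj_def
proof (intro ballI impI)
  have len: "length w = r" using tens_len[OF f(1) w] .
  have *: False if "p \<in> {1..r}" "q \<in> {1..r}" "N.blk p = N.blk q" "w ! (p - 1) = w ! (q - 1)" "p < q" for p q
  proof -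
    define d where "d = q - Suc p"
    have q: "q = p + Suc d" using that(5) by (simp add: d_def)
    show False using antisym_zero[OF f, of p d w] that w len unfolding q by simp
  qed
  fix p q assume "p \<in> {1..r}" "q \<in> {1..r}" "N.blk p = N.blk q \<and> w ! (p - 1) = w ! (q - 1)"
  then show "p = q" using *[of p q] *[of q p] by (metis linorder_neqE_nat)
qed

text \<open>U commutes with the Hecke action, so the alternating vectors form a submodule.\<close>

lemma cyc_alt_antisym: "f \<in> cycT alt \<Longrightarrow> f \<in> tens r \<and> antisym_on f"
proof -
  interpret T: polmod scT "tens r" actT by (rule polmod_tens)
  have "T.subm {f \<in> tens r. \<forall>j. 1 \<le> j \<and> j < r \<and> N.blk j = N.blk (Suc j) \<longrightarrow> hs j f = scT c f}" for c
    unfolding T.subm_def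
    by (auto simp: hs_add hs_scT tens_FS[of _ r] T.scale_right_distrib actT_hs[symmetric] actT_scT
        T.scale_left_commute mult.commute)
  then have "T.subm {f \<in> tens r. antisym_on f}" unfolding antisym_on_def .
  moreover have "alt \<in> {f \<in> tens r. antisym_on f}" using alt_tens hs_alt by (simp add: antisym_on_def)
  ultimately have "T.cyc alt \<subseteq> {f \<in> tens r. antisym_on f}" by (rule T.cyc_least)
  then show "f \<in> cycT alt \<Longrightarrow> f \<in> tens r \<and> antisym_on f" by blast
qed

lemma cyc_alt_dominated:
  assumes f: "f \<in> cycT alt" "f w \<noteq> 0"
  shows "(\<Sum>i\<in>{1..int k}. cont w i) \<le> (\<Sum>i\<in>{1..int k}. int (mu i))"
proof -
  have w: "length w = r" "blk_inj (\<lambda>p. w ! (p - 1))"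
    using cyc_alt_antisym[OF f(1)] antisym_blk_inj f(2) tens_len by blast+
  have e: "w = word_of r (\<lambda>p. w ! (p - 1))" using w(1) by (intro nth_equalityI) auto
  have "(\<Sum>i\<in>{1..int k}. count_list w i) = (\<Sum>i\<in>{1..int k}. card {p \<in> {1..r}. w ! (p - 1) = i})"
    by (intro sum.cong refl) (rule count_wd[of r "\<lambda>p. w ! (p - 1)", folded e])
  also have "\<dots> = card {p \<in> {1..r}. w ! (p - 1) \<in> {1..int k}}" by (rule card_fibers[symmetric]) auto
  also have "\<dots> \<le> (\<Sum>i\<in>{1..int k}. mu i)" by (rule dominance[OF w(2)])
  finally show ?thesis by (simp flip: of_nat_sum)
qed

end

section \<open>Weyl modules and the classification\<close>

lemma umod_iso_sym:
  assumes "umod sc1 M1 act1" "umod_iso sc1 M1 act1 sc2 M2 act2"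
  shows "umod_iso sc2 M2 act2 sc1 M1 act1"
proof -
  interpret A: umodule sc1 M1 act1 using assms(1) by (rule umodule_if_umod)
  obtain f where f: "bij_betw f M1 M2" "\<forall>x\<in>M1. \<forall>y\<in>M1. f (x + y) = f x + f y"
    "\<forall>c. \<forall>x\<in>M1. f (sc1 c x) = sc2 c (f x)" "\<forall>g. \<forall>x\<in>M1. f (act1 g x) = act2 g (f x)"
    using assms(2) unfolding umod_iso_def by blast
  define h where "h = the_inv_into M1 f"
  have h: "bij_betw h M2 M1" unfolding h_def by (rule bij_betw_the_inv_into[OF f(1)])
  have hf: "h (f x) = x" if "x \<in> M1" for x
    unfolding h_def using f(1) that by (simp add: bij_betw_def the_inv_into_f_f)
  have ex: "\<exists>x\<in>M1. y = f x" if "y \<in> M2" for y using f(1) that by (auto simp: bij_betw_def)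
  have "h (y + y') = h y + h y'" if y: "y \<in> M2" "y' \<in> M2" for y y'
  proof -
    obtain x x' where x: "x \<in> M1" "y = f x" "x' \<in> M1" "y' = f x'" using ex y by blast
    then have "y + y' = f (x + x')" using f(2) by simp
    then show ?thesis using x hf A.M_add by simp
  qed
  moreover have "h (sc2 c y) = sc1 c (h y)" if y: "y \<in> M2" for y c
  proof -
    obtain x where x: "x \<in> M1" "y = f x" using ex y by blast
    then have "sc2 c y = f (sc1 c x)" using f(3) by simp
    then show ?thesis using x hf A.M_sc by simp
  qed
  moreover have "h (act2 g y) = act1 g (h y)" if y: "y \<in> M2" for y g
  proof -
    obtain x where x: "x \<in> M1" "y = f x" using ex y by blast
    then have "act2 g y = f (act1 g x)" using f(4) by simp
    then show ?thesis using x hf A.M_act by simp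
  qed
  ultimately show ?thesis unfolding umod_iso_def using h by blast
qed

lemma umod_iso_trans:
  assumes "umod_iso sc1 M1 act1 sc2 M2 act2" "umod_iso sc2 M2 act2 sc3 M3 act3"
  shows "umod_iso sc1 M1 act1 sc3 M3 act3"
proof -
  obtain f where f: "bij_betw f M1 M2" "\<And>x y. x \<in> M1 \<Longrightarrow> y \<in> M1 \<Longrightarrow> f (x + y) = f x + f y"
    "\<And>c x. x \<in> M1 \<Longrightarrow> f (sc1 c x) = sc2 c (f x)" "\<And>g x. x \<in> M1 \<Longrightarrow> f (act1 g x) = act2 g (f x)"
    using assms(1) unfolding umod_iso_def by blast
  obtain h where h: "bij_betw h M2 M3" "\<And>x y. x \<in> M2 \<Longrightarrow> y \<in> M2 \<Longrightarrow> h (x + y) = h x + h y"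
    "\<And>c x. x \<in> M2 \<Longrightarrow> h (sc2 c x) = sc3 c (h x)" "\<And>g x. x \<in> M2 \<Longrightarrow> h (act2 g x) = act3 g (h x)"
    using assms(2) unfolding umod_iso_def by blast
  have fM: "f x \<in> M2" if "x \<in> M1" for x using f(1) that by (auto simp: bij_betw_def)
  have "bij_betw (h \<circ> f) M1 M3" by (rule bij_betw_trans[OF f(1) h(1)])
  then show ?thesis unfolding umod_iso_def
    by (intro exI[of _ "h \<circ> f"]) (simp add: f h fM)
qed

lemma umod_iso_wspace:
  assumes "umod sc1 M1 act1" "umod_iso sc1 M1 act1 sc2 M2 act2" "x \<in> wspace sc1 M1 act1 la" "x \<noteq> 0"
  shows "\<exists>y\<in>wspace sc2 M2 act2 la. y \<noteq> 0"
proof -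
  interpret A: umodule sc1 M1 act1 using assms(1) by (rule umodule_if_umod)
  obtain f where f: "bij_betw f M1 M2" "\<forall>x\<in>M1. \<forall>y\<in>M1. f (x + y) = f x + f y"
    "\<forall>c. \<forall>x\<in>M1. f (sc1 c x) = sc2 c (f x)" "\<forall>g. \<forall>x\<in>M1. f (act1 g x) = act2 g (f x)"
    using assms(2) unfolding umod_iso_def by blast
  have x: "x \<in> M1" using assms(3) by (rule A.ws_M)
  have "f 0 = 0" using f(2)[rule_format, of 0 0] by simp
  then have "f x \<noteq> 0" using f(1) x assms(4) A.M_0 by (metis bij_betw_def inj_onD)
  moreover have "f x \<in> wspace sc2 M2 act2 la"
    using f x assms(3) unfolding wspace_def by (auto simp: bij_betw_def) (metis)
  ultimately show ?thesis by blast
qed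

lemma umod_iso_irred:
  assumes um: "umod sc1 M1 act1" and iso: "umod_iso sc1 M1 act1 sc2 M2 act2" and irr: "irred sc2 M2 act2"
  shows "irred sc1 M1 act1"
proof -
  interpret A: umodule sc1 M1 act1 using um by (rule umodule_if_umod)
  obtain f where f: "bij_betw f M1 M2" "\<And>x y. x \<in> M1 \<Longrightarrow> y \<in> M1 \<Longrightarrow> f (x + y) = f x + f y"
    "\<And>c x. x \<in> M1 \<Longrightarrow> f (sc1 c x) = sc2 c (f x)" "\<And>g x. x \<in> M1 \<Longrightarrow> f (act1 g x) = act2 g (f x)"
    using iso unfolding umod_iso_def by blast
  have f0: "f 0 = 0" using f(2)[of 0 0] by simp
  have inj: "inj_on f M1" and im: "f ` M1 = M2" using f(1) by (auto simp: bij_betw_def)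
  have "N = {0} \<or> N = M1" if N: "A.subm N" for N
  proof -
    have N': "N \<subseteq> M1" "0 \<in> N" "\<And>x y. x \<in> N \<Longrightarrow> y \<in> N \<Longrightarrow> x + y \<in> N"
      "\<And>c x. x \<in> N \<Longrightarrow> sc1 c x \<in> N" "\<And>g x. x \<in> N \<Longrightarrow> act1 g x \<in> N"
      using N unfolding A.subm_def by blast+
    have "f ` N \<subseteq> M2 \<and> 0 \<in> f ` N \<and> (\<forall>x\<in>f ` N. \<forall>y\<in>f ` N. x + y \<in> f ` N) \<and> (\<forall>c. \<forall>x\<in>f ` N. sc2 c x \<in> f ` N) \<and>
          (\<forall>g. \<forall>x\<in>f ` N. act2 g x \<in> f ` N)"
    proof (intro conjI ballI allI)
      show "f ` N \<subseteq> M2" using N'(1) im by blast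
      show "0 \<in> f ` N" using N'(2) f0 by (metis imageI)
      fix x assume "x \<in> f ` N"
      then obtain a where a: "a \<in> N" "a \<in> M1" "x = f a" using N'(1) by blast
      show "sc2 c x \<in> f ` N" for c using imageI[OF N'(4)[OF a(1)], of f c] f(3)[OF a(2)] a(3) by simp
      show "act2 g x \<in> f ` N" for g using imageI[OF N'(5)[OF a(1)], of f g] f(4)[OF a(2)] a(3) by simp
      fix y assume "y \<in> f ` N"
      then obtain b where b: "b \<in> N" "b \<in> M1" "y = f b" using N'(1) by blast
      show "x + y \<in> f ` N" using imageI[OF N'(3)[OF a(1) b(1)], of f] f(2)[OF a(2) b(2)] a(3) b(3) by simp
    qed
    then have "f ` N = {0} \<or> f ` N = M2" using irr unfolding irred_def by blast
    then show ?thesis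
    proof
      assume z: "f ` N = {0}"
      have "x = 0" if x: "x \<in> N" for x
      proof -
        have "f x = f 0" using z x f0 by auto
        then show ?thesis using inj_onD[OF inj] x N'(1) by blast
      qed
      then show ?thesis using N'(2) by blast
    next
      assume "f ` N = M2"
      then have "f ` N = f ` M1" using im by simp
      then have "N = M1" using inj_on_image_eq_iff[OF inj N'(1)] by blast
      then show ?thesis by simp
    qed
  qed
  moreover have "M1 \<noteq> {0}"
  proof
    assume "M1 = {0}"
    then have "M2 = {0}" using im f0 by auto
    then show False using irr by (simp add: irred_def)
  qed
  ultimately show ?thesis unfolding irred_def A.subm_def using um by blast
qed

lemma umod_iso_wmod:
  assumes um: "umod sc1 M1 act1" and iso: "umod_iso sc1 M1 act1 sc2 M2 act2" and w: "wmod sc2 M2 act2"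
  shows "wmod sc1 M1 act1"
proof -
  interpret A: umodule sc1 M1 act1 using um by (rule umodule_if_umod)
  have um2: "umod sc2 M2 act2" using w by (simp add: wmod_def)
  interpret B: umodule sc2 M2 act2 using um2 by (rule umodule_if_umod)
  obtain h where h: "bij_betw h M2 M1" "\<And>x y. x \<in> M2 \<Longrightarrow> y \<in> M2 \<Longrightarrow> h (x + y) = h x + h y"
    "\<And>c x. x \<in> M2 \<Longrightarrow> h (sc2 c x) = sc1 c (h x)" "\<And>g x. x \<in> M2 \<Longrightarrow> h (act2 g x) = act1 g (h x)"
    using umod_iso_sym[OF um iso] unfolding umod_iso_def by blast
  have h0: "h 0 = 0" using h(2)[of 0 0] by simp
  have hw: "h y \<in> wspace sc1 M1 act1 la" if y: "y \<in> wspace sc2 M2 act2 la" for y la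
  proof -
    have yM: "y \<in> M2" using y by (rule B.ws_M)
    then have "h y \<in> M1" using h(1) by (auto simp: bij_betw_def)
    moreover have "act1 (Kp i) (h y) = sc1 (vq powi la i) (h y)" for i
      using h(4)[OF yM, of "Kp i"] h(3)[OF yM] B.ws_K[OF y] by simp
    ultimately show ?thesis by (simp add: wspace_def)
  qed
  have hs: "sum_list ys \<in> M2 \<and> h (sum_list ys) = sum_list (map h ys)" if "set ys \<subseteq> M2" for ys
    using that by (induction ys) (auto simp: h0 h(2))
  have "\<exists>ys. x = sum_list ys \<and> (\<forall>y\<in>set ys. \<exists>la. y \<in> wspace sc1 M1 act1 la)" if x: "x \<in> M1" for x
  proof -
    obtain y where y: "y \<in> M2" "x = h y" using h(1) x by (auto simp: bij_betw_def)
    then obtain ys where ys: "y = sum_list ys" "\<forall>y\<in>set ys. \<exists>la. y \<in> wspace sc2 M2 act2 la"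
      using w unfolding wmod_def by blast
    then have "set ys \<subseteq> M2" using B.ws_M by blast
    then have "x = sum_list (map h ys)" using hs ys(1) y(2) by simp
    moreover have "\<forall>y\<in>set (map h ys). \<exists>la. y \<in> wspace sc1 M1 act1 la"
    proof
      fix y' assume "y' \<in> set (map h ys)"
      then obtain z where z: "z \<in> set ys" "y' = h z" by auto
      then obtain la where "z \<in> wspace sc2 M2 act2 la" using ys(2) by blast
      then show "\<exists>la. y' \<in> wspace sc1 M1 act1 la" using hw z(2) by blast
    qed
    ultimately show ?thesis by blast
  qed
  then show ?thesis unfolding wmod_def using um by blast
qed

lemma wmod_subm_tens:
  assumes N: "umodule.subm scT (tens r) actT N"
  shows "wmod scT N actT"
proof -
  interpret T: polmod scT "tens r" actT by (rule polmod_tens)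
  have "\<exists>ys. y = sum_list ys \<and> (\<forall>y\<in>set ys. \<exists>la. y \<in> wspace scT N actT la)" if y: "y \<in> N" for y
  proof -
    have yt: "y \<in> tens r" using y N unfolding T.subm_def by blast
    let ?A = "cont ` {w. y w \<noteq> 0}" and ?p = "\<lambda>la w. if cont w = la then y w else 0"
    have fin: "finite ?A" using tens_FS[OF yt] by (simp add: FS_def)
    have e: "y = (\<Sum>la\<in>?A. ?p la)" by (rule tens_decompose(1)[OF yt])
    have "\<forall>la\<in>?A. ?p la \<in> N"
      using e y tens_decompose(2)[OF yt] by (intro T.subm_component[OF N fin]) auto
    then have p: "\<forall>la\<in>?A. ?p la \<in> wspace scT N actT la"
      using tens_decompose(2)[OF yt] unfolding T.wspace_subm[OF N] by blast
    obtain as where as: "set as = ?A" "distinct as" using finite_distinct_list[OF fin] by blast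
    have "y = sum_list (map ?p as)"
      using e as sum_list_distinct_conv_sum_set[OF as(2), of ?p] by simp
    moreover have "\<forall>y\<in>set (map ?p as). \<exists>la. y \<in> wspace scT N actT la" using p as(1) by auto
    ultimately show ?thesis by blast
  qed
  then show ?thesis unfolding wmod_def using T.umod_subm[OF N] by blast
qed

section \<open>Modules of operators, and the Weyl module as a submodule of tensor space\<close>

lemma vector_space_scW: "vector_space scW"
  by unfold_locales (auto simp: scW_def fun_eq_iff fapp algebra_simps)

text \<open>The action composes on the left, so every relation can be checked at each value of the
  operator, inside \<open>tens r\<close>.\<close>

lemma umod_operators:
  assumes V: "\<And>\<psi> f. \<psi> \<in> V \<Longrightarrow> \<psi> f \<in> tens r" "0 \<in> V" "\<And>\<psi> \<phi>. \<psi> \<in> V \<Longrightarrow> \<phi> \<in> V \<Longrightarrow> \<psi> + \<phi> \<in> V"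
    "\<And>c \<psi>. \<psi> \<in> V \<Longrightarrow> scW c \<psi> \<in> V" "\<And>g \<psi>. \<psi> \<in> V \<Longrightarrow> actW g \<psi> \<in> V"
  shows "umod scW V actW"
proof -
  interpret T: polmod scT "tens r" actT by (rule polmod_tens)
  have w: "actW g \<psi> f = actT g (\<psi> f)" "scW c \<psi> f = scT c (\<psi> f)" for g \<psi> f c
    by (simp_all add: actW_def scW_def)
  note s = w plus_fun_apply minus_apply zero_fun_apply
  show ?thesis
    unfolding umod_def
  proof (intro conjI ballI allI impI)
    fix \<psi> i j assume \<psi>: "\<psi> \<in> V"
    note t = V(1)[OF \<psi>]
    show "actW (Kp i) (actW (Kp j) \<psi>) = actW (Kp j) (actW (Kp i) \<psi>)"
      by (rule ext) (simp only: s T.KK[OF t])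
    show "actW (Kp i) (actW (Km i) \<psi>) = \<psi>" "actW (Km i) (actW (Kp i) \<psi>) = \<psi>"
      by (rule ext, simp only: s T.KKm[OF t] T.KmK[OF t])+
    show "actW (Kp i) (actW (E j) \<psi>) = scW (vq powi (dl i j - dl i (j + 1))) (actW (E j) (actW (Kp i) \<psi>))"
      by (rule ext) (simp only: s T.KE[OF t])
    show "actW (Kp i) (actW (F j) \<psi>) = scW (vq powi (dl i (j + 1) - dl i j)) (actW (F j) (actW (Kp i) \<psi>))"
      by (rule ext) (simp only: s T.KF[OF t])
    show "actW (E i) (actW (E j) \<psi>) = actW (E j) (actW (E i) \<psi>)" "actW (F i) (actW (F j) \<psi>) = actW (F j) (actW (F i) \<psi>)"
      if "1 < \<bar>i - j\<bar>"
      by (rule ext, simp only: s T.EE[OF t that] T.FF[OF t that])+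
    show "actW (E i) (actW (F j) \<psi>) - actW (F j) (actW (E i) \<psi>) =
          (if i = j then scW (inverse (vq - inverse vq))
                (actW (Kp i) (actW (Km (i + 1)) \<psi>) - actW (Km i) (actW (Kp (i + 1)) \<psi>)) else 0)"
      by (rule ext) (simp only: s T.EF[OF t] split: if_split, blast)
    show "actW (E i) (actW (E i) (actW (E j) \<psi>)) - scW (vq + inverse vq) (actW (E i) (actW (E j) (actW (E i) \<psi>)))
             + actW (E j) (actW (E i) (actW (E i) \<psi>)) = 0" if "\<bar>i - j\<bar> = 1"
      by (rule ext) (simp only: s T.serreE[OF t that])
    show "actW (F i) (actW (F i) (actW (F j) \<psi>)) - scW (vq + inverse vq) (actW (F i) (actW (F j) (actW (F i) \<psi>)))
             + actW (F j) (actW (F i) (actW (F i) \<psi>)) = 0" if "\<bar>i - j\<bar> = 1"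
      by (rule ext) (simp only: s T.serreF[OF t that])
  next
    fix g c \<psi> \<phi> assume p: "\<psi> \<in> V" "\<phi> \<in> V"
    show "actW g (\<psi> + \<phi>) = actW g \<psi> + actW g \<phi>"
      by (rule ext) (simp only: s T.act_add[OF V(1)[OF p(1)] V(1)[OF p(2)]])
    show "actW g (scW c \<psi>) = scW c (actW g \<psi>)"
      by (rule ext) (simp only: s T.act_sc[OF V(1)[OF p(1)]])
  qed (use V vector_space_scW in auto)
qed

lemma evalp_W: "evalp scW actW p \<psi> f = evalp scT actT p (\<psi> f)"
proof -
  have "foldr actW w \<psi> f = foldr actT w (\<psi> f)" for w
    by (induction w) (auto simp: actW_def)
  then show ?thesis
    unfolding evalp_def by (induction p) (auto simp: scW_def plus_fun_apply zero_fun_apply)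
qed

lemma hlin_Send: "hlin r T \<Longrightarrow> (\<lambda>f. if f \<in> tens r then T f else 0) \<in> Send r"
  unfolding Send_iff by (auto simp: hlin_def)

context partition
begin

abbreviation W0 :: "tv set" where "W0 \<equiv> cycT alt"

lemma subm_W0: "umodule.subm scT (tens r) actT W0"
proof -
  interpret T: polmod scT "tens r" actT by (rule polmod_tens)
  show ?thesis by (rule T.subm_cyc[OF alt_tens])
qed

lemma umod_W0: "umod scT W0 actT"
proof -
  interpret T: polmod scT "tens r" actT by (rule polmod_tens)
  show ?thesis by (rule T.umod_subm[OF subm_W0])
qed

lemma wspace_W0: "x \<in> wspace scT W0 actT la \<longleftrightarrow> x \<in> W0 \<and> (\<forall>w. x w \<noteq> 0 \<longrightarrow> cont w = la)"
proof -
  interpret T: polmod scT "tens r" actT by (rule polmod_tens)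
  have "W0 \<subseteq> tens r" using subm_W0 unfolding T.subm_def by blast
  then show ?thesis unfolding T.wspace_subm[OF subm_W0] by (auto simp: wspace_tens)
qed

lemma alt_W0: "alt \<in> wspace scT W0 actT (\<lambda>i. int (mu i))"
proof -
  interpret T: polmod scT "tens r" actT by (rule polmod_tens)
  show ?thesis unfolding wspace_W0 using T.cyc_self alt_supp by blast
qed

lemma polw_W0: "polw scT W0 actT"
proof -
  interpret T: polmod scT "tens r" actT by (rule polmod_tens)
  show ?thesis using polw_tens[of r] unfolding polw_def T.wspace_subm[OF subm_W0] by blast
qed

lemma W0_dominated:
  assumes "x \<in> wspace scT W0 actT la" "x \<noteq> 0"
  shows "(\<Sum>i\<in>{1..int k}. la i) \<le> (\<Sum>i\<in>{1..int k}. int (mu i))"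
proof -
  obtain w where w: "x w \<noteq> 0" using assms(2) by (auto simp: fun_eq_iff zero_fun_apply)
  then have c: "cont w = la" and x: "x \<in> W0" using assms(1) unfolding wspace_W0 by blast+
  have "cont w i = la i" for i using c by (rule fun_cong)
  then show ?thesis using cyc_alt_dominated[of x w k] x w by simp
qed

text \<open>For \<open>i \<ge> 1\<close>, \<open>up i\<close> raises the partial sum over 1, ..., i
  by one, against dominance.\<close>

lemma W0_top:
  assumes i: "1 \<le> i" shows "wspace scT W0 actT (up i (\<lambda>i. int (mu i))) \<subseteq> {0}"
proof (rule ccontr)
  assume "\<not> ?thesis"
  then obtain x where "x \<in> wspace scT W0 actT (up i (\<lambda>i. int (mu i)))" "x \<noteq> 0" by blast
  then have "(\<Sum>j\<in>{1..int (nat i)}. up i (\<lambda>i. int (mu i)) j) \<le> (\<Sum>j\<in>{1..int (nat i)}. int (mu j))"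
    by (rule W0_dominated)
  moreover have "(\<Sum>j\<in>{1..i}. up i (\<lambda>i. int (mu i)) j) = (\<Sum>j\<in>{1..i}. int (mu j) + (if j = i then 1 else 0))"
    by (intro sum.cong) (auto simp: up_def dl_def)
  ultimately show False using i by (simp add: sum.distrib)
qed

lemma irred_W0: "irred scT W0 actT"
proof (rule irred_cyc_tens)
  show "alt \<in> wspace scT (tens r) actT (\<lambda>i. int (mu i))"
    unfolding wspace_tens using alt_tens alt_supp by blast
  show "int (mu j) = 0" if "j \<le> 0" for j using mu_low[OF that] by simp
qed (use alt_nz W0_top in auto)

lemma umu_tens: "umu r mu \<in> tens r"
  unfolding umu_alt using alt_tens by (rule tens_scT)

lemma cyc_umu: "cycT (umu r mu) = W0"
proof -
  interpret T: polmod scT "tens r" actT by (rule polmod_tens)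
  let ?c = "vq ^ ell r (wmu r mu)"
  have u: "T.subm (T.cyc (umu r mu))" by (rule T.subm_cyc[OF umu_tens])
  have "scT (inverse ?c) (umu r mu) = alt" unfolding umu_alt by simp
  then have "alt \<in> T.cyc (umu r mu)" using u T.cyc_self unfolding T.subm_def by metis
  then have "W0 \<subseteq> T.cyc (umu r mu)" by (rule T.cyc_least[OF u])
  moreover have "umu r mu \<in> W0"
    unfolding umu_alt using subm_W0 T.cyc_self unfolding T.subm_def by blast
  then have "T.cyc (umu r mu) \<subseteq> W0" by (rule T.cyc_least[OF subm_W0])
  ultimately show ?thesis by blast
qed

lemma zmu:
  "zmu r mu \<in> Send r" "\<And>w. length w = r \<Longrightarrow> mset w \<noteq> mset [1..int r] \<Longrightarrow> zmu r mu (bas w) = 0"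
  "zmu r mu (omv r) = umu r mu"
  using theI'[OF ex1_zmu[OF umu_tens]] unfolding zmu_def by blast+

lemma hlin_zmu: "hlin r (zmu r mu)"
  using zmu(1) by (simp add: Send_iff)

lemma Wc_eq: "Wc mu = (\<lambda>\<phi>. \<phi> \<circ> zmu r mu) ` Send r"
  by (simp add: Wc_def mu_rk)

text \<open>All values of \<open>zmu\<close> lie in tensor space, so cutting \<open>\<phi>\<close>
  off outside does not change the composite.\<close>

lemma WcI: "hlin r \<phi> \<Longrightarrow> \<phi> \<circ> zmu r mu \<in> Wc mu"
proof -
  assume \<phi>: "hlin r \<phi>"
  let ?e = "\<lambda>f. if f \<in> tens r then \<phi> f else 0"
  have "zmu r mu f \<in> tens r" for f using zmu(1) unfolding Send_iff hlin_def by (cases "f \<in> tens r") auto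
  then have e: "\<phi> \<circ> zmu r mu = ?e \<circ> zmu r mu" by (auto simp: fun_eq_iff)
  show ?thesis unfolding Wc_eq e by (rule imageI[OF hlin_Send[OF \<phi>]])
qed

lemma WcE:
  assumes "\<psi> \<in> Wc mu" obtains \<phi> where "hlin r \<phi>" "\<psi> = \<phi> \<circ> zmu r mu"
  using assms unfolding Wc_eq by (auto simp: Send_iff)

lemma Wc_tens: "\<psi> \<in> Wc mu \<Longrightarrow> \<psi> f \<in> tens r"
proof (erule WcE)
  fix \<phi> assume "hlin r \<phi>" "\<psi> = \<phi> \<circ> zmu r mu"
  moreover have "zmu r mu f \<in> tens r" using zmu(1) unfolding Send_iff hlin_def by (cases "f \<in> tens r") auto
  ultimately show ?thesis using hlinD(1) by auto
qed

lemma hlin_zero: "hlin r (\<lambda>x. 0)"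
  by (auto simp: hlin_def)

lemma umod_Wc: "umod scW (Wc mu) actW"
proof (rule umod_operators[of _ r])
  show "\<psi> f \<in> tens r" if "\<psi> \<in> Wc mu" for \<psi> f using Wc_tens[OF that] .
  have e: "(\<lambda>x. 0) \<circ> zmu r mu = 0" by (rule ext) (simp add: zero_fun_apply)
  show "0 \<in> Wc mu" using WcI[OF hlin_zero] unfolding e .
next
  fix \<psi> \<phi> assume "\<psi> \<in> Wc mu" "\<phi> \<in> Wc mu"
  then obtain a b where a: "hlin r a" "\<psi> = a \<circ> zmu r mu" and b: "hlin r b" "\<phi> = b \<circ> zmu r mu" by (metis WcE)
  have e: "\<psi> + \<phi> = (\<lambda>x. scT 1 (a x) + b x) \<circ> zmu r mu" by (rule ext) (simp add: a b plus_fun_apply)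
  show "\<psi> + \<phi> \<in> Wc mu" unfolding e by (rule WcI[OF hlin_add[OF a(1) b(1)]])
next
  fix c \<psi> assume "\<psi> \<in> Wc mu"
  then obtain a where a: "hlin r a" "\<psi> = a \<circ> zmu r mu" by (metis WcE)
  have "scW c \<psi> = (\<lambda>x. scT c (a x) + 0) \<circ> zmu r mu" by (rule ext) (simp add: a scW_def)
  then show "scW c \<psi> \<in> Wc mu" using WcI[OF hlin_add[OF a(1) hlin_zero]] by simp
next
  fix g \<psi> assume "\<psi> \<in> Wc mu"
  then obtain a where a: "hlin r a" "\<psi> = a \<circ> zmu r mu" by (metis WcE)
  have "actW g \<psi> = (actT g \<circ> a) \<circ> zmu r mu" by (simp only: a actW_def comp_assoc)
  then show "actW g \<psi> \<in> Wc mu" using WcI[OF hlin_comp[OF hlin_actT a(1)]] by simp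
qed

text \<open>The isomorphism is evaluation at \<open>omv r\<close>. Elements of \<open>Wc mu\<close>
  vanish on basis tensors of other contents and are determined by Hecke-linearity on the
  rearrangements of \<open>[1..int r]\<close>, which gives injectivity; \<open>hlin_cyc\<close> puts
  the image inside \<open>W0\<close>.\<close>

lemma Wc_iso: "umod_iso scW (Wc mu) actW scT W0 actT"
proof -
  interpret T: polmod scT "tens r" actT by (rule polmod_tens)
  let ?u = "umu r mu" and ?F = "\<lambda>\<psi>. \<psi> (omv r)"
  have ze: "zmu r mu f = 0" if "f \<notin> tens r" for f using zmu(1) that by (simp add: Send_iff)
  have "inj_on ?F (Wc mu)"
  proof (rule inj_onI)
    fix \<psi> \<psi>' assume "\<psi> \<in> Wc mu" "\<psi>' \<in> Wc mu" and e: "\<psi> (omv r) = \<psi>' (omv r)"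
    then obtain a b where a: "hlin r a" "\<psi> = a \<circ> zmu r mu" and b: "hlin r b" "\<psi>' = b \<circ> zmu r mu" by (metis WcE)
    have h: "hlin r \<psi>" "hlin r \<psi>'" using hlin_comp[OF _ hlin_zmu] a b by auto
    have w: "\<psi> (bas w) = \<psi>' (bas w)" if "length w = r" for w
    proof (cases "mset w = mset [1..int r]")
      case True
      then show ?thesis using hlin_eq_perm[OF h, of "[1..int r]" w] e by simp
    next
      case False
      then show ?thesis using zmu(2)[OF that] by (simp add: a(2) b(2) hlin_0[OF a(1)] hlin_0[OF b(1)])
    qed
    show "\<psi> = \<psi>'"
    proof
      fix f
      show "\<psi> f = \<psi>' f"
      proof (cases "f \<in> tens r")
        case True
        then show ?thesis using hlin_eqI[OF h True] w tens_len[OF True] by blast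
      next
        case False
        then show ?thesis by (simp add: a(2) b(2) ze hlin_0[OF a(1)] hlin_0[OF b(1)])
      qed
    qed
  qed
  moreover have "?F ` Wc mu = W0"
  proof (intro equalityI subsetI)
    fix y assume "y \<in> ?F ` Wc mu"
    then obtain a where a: "hlin r a" "y = a ?u" using zmu(3) by (auto elim!: WcE)
    have "cont (word_of r M.blk) = (\<lambda>i. int (mu i))" unfolding count_wd M.blk_fiber by simp
    then have "?u \<in> T.ws (cont (word_of r M.blk))"
      unfolding umu_alt wspace_tens using tens_scT[OF alt_tens] alt_supp by (auto simp: fapp)
    then have "a ?u \<in> cycT ?u" by (intro hlin_cyc[OF a(1) M.sorted_blk length_wd])
    then show "y \<in> W0" using a(2) cyc_umu by simp
  next
    fix y assume y: "y \<in> W0"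
    let ?S = "{a ?u | a. hlin r a}"
    \<comment> \<open>Conversely the values at the generator form a submodule containing it, hence
      all of \<open>W0\<close>.\<close>
    have "T.subm ?S"
      unfolding T.subm_def
    proof (intro conjI ballI allI)
      show "?S \<subseteq> tens r" using hlinD(1) umu_tens by blast
      show "0 \<in> ?S" by (intro CollectI exI[of _ "\<lambda>x. 0"]) (simp add: hlin_zero)
      fix x assume "x \<in> ?S"
      then obtain a where a: "hlin r a" "x = a ?u" by blast
      show "scT c x \<in> ?S" for c
        using hlin_add[OF a(1) hlin_zero, of c] a(2) by (auto intro!: exI[of _ "\<lambda>x. scT c (a x) + 0"])
      show "actT g x \<in> ?S" for g
        using hlin_comp[OF hlin_actT a(1), of g] a(2) by (auto intro!: exI[of _ "actT g \<circ> a"])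
      fix y assume "y \<in> ?S"
      then obtain b where b: "hlin r b" "y = b ?u" by blast
      show "x + y \<in> ?S"
        using hlin_add[OF a(1) b(1), of 1] a(2) b(2) by (auto intro!: exI[of _ "\<lambda>x. scT 1 (a x) + b x"])
    qed
    moreover have "?u \<in> ?S" by (intro CollectI exI[of _ "\<lambda>x. x"]) (simp add: hlin_id)
    ultimately have "W0 \<subseteq> ?S" unfolding cyc_umu[symmetric] by (rule T.cyc_least)
    then obtain a where a: "hlin r a" "y = a ?u" using y by blast
    have "y = (a \<circ> zmu r mu) (omv r)" using a(2) zmu(3) by simp
    then show "y \<in> ?F ` Wc mu" using WcI[OF a(1)] by (rule image_eqI)
  qed
  ultimately have "bij_betw ?F (Wc mu) W0" by (rule bij_betw_imageI)
  then show ?thesis unfolding umod_iso_def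
    by (intro exI[of _ ?F]) (auto simp: plus_fun_apply scW_def actW_def)
qed

lemma irred_Wc: "irred scW (Wc mu) actW"
  by (rule umod_iso_irred[OF umod_Wc Wc_iso irred_W0])

lemma wmod_Wc: "wmod scW (Wc mu) actW"
  by (rule umod_iso_wmod[OF umod_Wc Wc_iso wmod_subm_tens[OF subm_W0]])

lemma Cpol_Wc: "Cpol scW (Wc mu) actW"
  using umod_iso_wspace[OF umod_Wc Wc_iso] wmod_Wc polw_W0 unfolding Cpol_def polw_def by blast

lemma iso_Wc:
  assumes "irred sc M act" "polw sc M act" "x \<in> wspace sc M act (\<lambda>i. int (mu i))" "x \<noteq> 0"
    "\<And>i. 1 \<le> i \<Longrightarrow> wspace sc M act (up i (\<lambda>i. int (mu i))) \<subseteq> {0}"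
  shows "umod_iso sc M act scW (Wc mu) actW"
proof -
  have low: "int (mu j) = 0" if "j \<le> 0" for j using mu_low[OF that] by simp
  have "umod_iso sc M act scT W0 actT"
    by (rule irred_iso_if_same_top[OF assms(1) irred_W0 assms(2) polw_W0 assms(3,4) alt_W0 alt_nz assms(5) W0_top low])
  then show ?thesis by (rule umod_iso_trans[OF _ umod_iso_sym[OF umod_Wc Wc_iso]])
qed

end

section \<open>Separating the Weyl modules and identifying all irreducibles\<close>

lemma partitionI: "is_partition r mu \<Longrightarrow> partition r mu"
  by (simp add: partition_def)

lemma iso_dominated:
  assumes "partition r mu" "partition r' mu'" "umod_iso scW (Wc mu) actW scW (Wc mu') actW"
  shows "(\<Sum>i\<in>{1..int k}. int (mu i)) \<le> (\<Sum>i\<in>{1..int k}. int (mu' i))"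
proof -
  interpret A: partition r mu by fact
  interpret B: partition r' mu' by fact
  have "umod_iso scT A.W0 actT scW (Wc mu) actW" by (rule umod_iso_sym[OF A.umod_Wc A.Wc_iso])
  then have "umod_iso scT A.W0 actT scW (Wc mu') actW" using assms(3) by (rule umod_iso_trans)
  then have "umod_iso scT A.W0 actT scT B.W0 actT" using B.Wc_iso by (rule umod_iso_trans)
  from umod_iso_wspace[OF A.umod_W0 this A.alt_W0 A.alt_nz]
  obtain y where "y \<in> wspace scT B.W0 actT (\<lambda>i. int (mu i))" "y \<noteq> 0" by blast
  then show ?thesis by (rule B.W0_dominated)
qed

text \<open>An isomorphism carries the weight \<open>mu\<close> into the other module, so each
  partition dominates the other; equal partial sums have equal differences.\<close>

lemma Wc_iso_eq:
  assumes "is_partition r mu" "is_partition r' mu'" "umod_iso scW (Wc mu) actW scW (Wc mu') actW"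
  shows "mu = mu'"
proof
  fix i
  have A: "partition r mu" and B: "partition r' mu'" using assms by (auto intro: partitionI)
  have "umod_iso scW (Wc mu') actW scW (Wc mu) actW"
    by (rule umod_iso_sym[OF partition.umod_Wc[OF A] assms(3)])
  then have e: "(\<Sum>i\<in>{1..int k}. int (mu i)) = (\<Sum>i\<in>{1..int k}. int (mu' i))" for k
    using iso_dominated[OF A B assms(3), of k] iso_dominated[OF B A, of k] by simp
  show "mu i = mu' i"
  proof (cases "1 \<le> i")
    case True
    then obtain k where k: "i = int k + 1" by (metis add.commute nonneg_int_cases zle_iff_zadd zero_le_imp_eq_int)
    have "{1..int (Suc k)} = insert i {1..int k}" unfolding k by auto
    then show ?thesis using e[of "Suc k"] e[of k] k by simp
  next
    case False
    then show ?thesis using partition.mu_low[OF A] partition.mu_low[OF B] by simp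
  qed
qed

lemma Cpol_classification:
  assumes C: "Cpol sc M act" and irr: "irred sc M act"
  shows "\<exists>r mu. is_partition r mu \<and> umod_iso sc M act scW (Wc mu) actW \<and>
     (\<exists>y\<in>wspace sc M act (\<lambda>i. int (mu i)). y \<noteq> 0)"
proof -
  interpret polmod sc M act using C by (rule Cpol_polmod)
  obtain la x where "x \<in> ws la" "x \<noteq> 0"
    using wmod_nonzero_weight[of sc M act] C irr by (auto simp: Cpol_def irred_def)
  then obtain r mu y where mu: "is_partition r mu" "y \<in> ws (\<lambda>i. int (mu i))" "y \<noteq> 0"
    "\<And>i. 1 \<le> i \<Longrightarrow> ws (up i (\<lambda>i. int (mu i))) \<subseteq> {0}"
    using ex_top_partition by blast
  have "umod_iso sc M act scW (Wc mu) actW"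
    by (rule partition.iso_Wc[OF partitionI[OF mu(1)] irr pol mu(2-4)])
  then show ?thesis using mu by blast
qed

text \<open>Prefixing tensors by a letter far away from all indices occurring in \<open>p\<close> embeds
  \<open>tens r'\<close> compatibly with \<open>p\<close>.\<close>

lemma kernel_mono:
  assumes le: "r' \<le> r" and p: "\<forall>f\<in>tens r. evalp scT actT p f = 0" and f: "f \<in> tens r'"
  shows "evalp scT actT p f = 0"
proof -
  define ix where "ix g = (case g of E i \<Rightarrow> {i, i + 1} | F i \<Rightarrow> {i, i + 1} | Kp i \<Rightarrow> {i} | Km i \<Rightarrow> {i})" for g
  have "finite (\<Union>g\<in>(\<Union>(c, w)\<in>set p. set w). ix g)"
    by (auto simp: ix_def split: gen.split)
  \<comment> \<open>A letter avoiding all \<open>i\<close> and \<open>i + 1\<close> receives only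
    the counit from each generator in \<open>p\<close>, so prefixing it commutes with
    \<open>p\<close>.\<close>
  then obtain k where k: "k \<notin> (\<Union>g\<in>(\<Union>(c, w)\<in>set p. set w). ix g)"
    using ex_new_if_finite[OF infinite_UNIV_int] by blast
  have g: "actT g (pre k f) = pre k (actT g f)" if "k \<notin> ix g" "FS f" for g f
    using that by (cases g) (auto simp: ix_def actT_pre_E actT_pre_F kt_single actT_Kp actT_Km diag_pre)
  have w: "foldr actT w (pre k f) = pre k (foldr actT w f) \<and> FS (foldr actT w f)"
    if "\<And>g. g \<in> set w \<Longrightarrow> k \<notin> ix g" "FS f" for w f
    using that by (induction w) (auto simp: g)
  have e: "evalp scT actT q (pre k f) = pre k (evalp scT actT q f)" if "FS f" "set q \<subseteq> set p" for q f
    using that(2) unfolding evalp_def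
  proof (induction q)
    case (Cons cw q)
    obtain c u where cw: "cw = (c, u)" by (cases cw)
    have "k \<notin> ix g" if "g \<in> set u" for g using k Cons.prems that cw by fastforce
    then show ?case using Cons w[of u f] that(1) by (simp add: cw pre_add pre_scT)
  qed simp
  have "evalp scT actT p ((pre k ^^ n) f) = (pre k ^^ n) (evalp scT actT p f) \<and> (pre k ^^ n) f \<in> tens (n + r')" for n
  proof (induction n)
    case (Suc n)
    then have t: "(pre k ^^ n) f \<in> tens (n + r')" by simp
    have "pre k h \<in> tens (Suc m)" if "h \<in> tens m" for h m
      using that FS_pre[OF tens_FS[OF that], of k] by (auto simp: tens_def FS_def pre_def split: list.splits if_splits)
    then show ?case using Suc e[OF tens_FS[OF t]] by simp
  qed (use f in simp)
  \<comment> \<open>Enough copies of the letter bring \<open>f\<close> into \<open>tens r\<close>,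
    where \<open>p\<close> vanishes; prefixing is injective.\<close>
  from this[of "r - r'"] have "(pre k ^^ (r - r')) (evalp scT actT p f) = 0" using p le by (metis le_add_diff_inverse2)
  moreover have "h = 0" if "pre k h = 0" for h
  proof
    fix u
    show "h u = 0 u" using fun_cong[OF that, of "k # u"] by (simp add: pre_def zero_fun_apply)
  qed
  then have "h = 0" if "(pre k ^^ n) h = 0" for n h
    using that by (induction n) auto
  ultimately show ?thesis by blast
qed

lemma Cr_Wc:
  assumes "is_partition r' mu" "r' \<le> r" shows "Cr r scW (Wc mu) actW"
proof -
  interpret partition r' mu by (rule partitionI[OF assms(1)])
  have "evalp scW actW p \<psi> = 0" if "\<forall>f\<in>tens r. evalp scT actT p f = 0" "\<psi> \<in> Wc mu" for p \<psi>
    using kernel_mono[OF assms(2) that(1) Wc_tens[OF that(2)]]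
    by (intro ext[of _ 0]) (simp add: evalp_W zero_fun_apply)
  then show ?thesis unfolding Cr_def using wmod_Wc by blast
qed

section \<open>Weights of modules in \<open>Cr\<close>\<close>

lemma sum_count_le: "finite S \<Longrightarrow> (\<Sum>i\<in>S. count_list w i) \<le> length w"
proof (induction w)
  case (Cons a w)
  have "(\<Sum>i\<in>S. count_list (a # w) i) = (\<Sum>i\<in>S. count_list w i + (if a = i then 1 else 0))"
    by (intro sum.cong) auto
  also have "\<dots> = (\<Sum>i\<in>S. count_list w i) + (if a \<in> S then 1 else 0)"
    using Cons.prems by (simp add: sum.distrib)
  finally show ?case using Cons by simp
qed simp

text \<open>The number of letters of an r-fold tensor lying in \<open>A\<close> is one of 0, ..., r,
  so one of the \<open>r + 1\<close> factors vanishes.\<close>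

lemma kpoly_kernel:
  assumes "distinct A" "f \<in> tens r" shows "evalp scT actT (kpoly A (Suc r)) f = 0"
proof -
  interpret T: polmod scT "tens r" actT by (rule polmod_tens)
  let ?p = "kpoly A (Suc r)"
  have b: "evalp scT actT ?p (bas w) = 0" if w: "length w = r" for w
  proof -
    have ws: "bas w \<in> T.ws (cont w)" unfolding wspace_tens using w by (auto simp: bas_apply)
    let ?n = "\<Sum>i\<in>set A. count_list w i"
    have "sum_list (map (cont w) A) = int ?n"
      using sum_list_distinct_conv_sum_set[OF assms(1), of "cont w"] by simp
    moreover have "?n < Suc r" using sum_count_le[of "set A" w] w by simp
    then have "(\<Prod>j<Suc r. vq powi int ?n - vq powi int j) = 0"
      by (intro prod_zero finite_lessThan bexI[of _ ?n]) auto
    ultimately have "(\<Prod>j<Suc r. vq powi (sum_list (map (cont w) A)) - vq powi int j) = 0" by (simp only:)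
    then show ?thesis using T.evalp_kpoly[OF ws, of A "Suc r"] by simp
  qed
  have "finite B \<Longrightarrow> (\<And>w. w \<in> B \<Longrightarrow> length w = r) \<Longrightarrow> (\<Sum>w\<in>B. scT (f w) (bas w)) \<in> tens r \<and>
    evalp scT actT ?p (\<Sum>w\<in>B. scT (f w) (bas w)) = 0" for B
  proof (induction B rule: finite_induct)
    case empty
    show ?case using T.evalp_sc[of 0 ?p 0] by simp
  next
    case (insert w B)
    then have "bas w \<in> tens r" "evalp scT actT ?p (bas w) = 0" using b by auto
    then show ?case using insert T.evalp_add T.evalp_sc by (simp add: tens_add tens_scT del: kpoly.simps)
  qed
  from this[of "{w. f w \<noteq> 0}"] show ?thesis
    using FS_expand[OF tens_FS[OF assms(2)]] tens_FS[OF assms(2)] tens_len[OF assms(2)] by (simp add: FS_def)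
qed

text \<open>The kernel elements \<open>kpoly A (Suc r)\<close> force the sum of \<open>la\<close>
  over every finite set into 0, ..., r. Singletons give nonnegativity, sets of \<open>Suc r\<close>
  nonzero entries are impossible, and the support itself gives the total.\<close>

lemma Cr_weights:
  assumes C: "Cr r sc M act" and x: "x \<in> wspace sc M act la" "x \<noteq> 0"
  shows "(\<forall>i. 0 \<le> la i) \<and> finite {i. la i \<noteq> 0} \<and> (\<Sum>i\<in>{i. la i \<noteq> 0}. la i) \<le> int r"
proof -
  interpret umodule sc M act using C by (auto simp: Cr_def wmod_def intro: umodule_if_umod)
  have S: "0 \<le> (\<Sum>i\<in>S. la i) \<and> (\<Sum>i\<in>S. la i) \<le> int r" if fin: "finite S" for S
  proof -
    obtain A where A: "set A = S" "distinct A" using finite_distinct_list[OF fin] by blast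
    have "evalp sc act (kpoly A (Suc r)) x = 0"
      using C kpoly_kernel[OF A(2)] ws_M[OF x(1)] unfolding Cr_def by blast
    then have "(\<Prod>j<Suc r. vq powi (sum_list (map la A)) - vq powi int j) = 0"
      using evalp_kpoly[OF x(1), of A "Suc r"] x(2) by simp
    then obtain j where "j < Suc r" "vq powi (sum_list (map la A)) = vq powi int j"
      by (auto simp: prod_zero_iff)
    then show ?thesis using sum_list_distinct_conv_sum_set[OF A(2), of la] A(1) by simp
  qed
  have nn: "0 \<le> la i" for i using S[of "{i}"] by simp
  have fin: "finite {i. la i \<noteq> 0}"
  proof (rule ccontr)
    assume "infinite {i. la i \<noteq> 0}"
    then obtain T where T: "finite T" "card T = Suc r" "T \<subseteq> {i. la i \<noteq> 0}"
      using infinite_arbitrarily_large by blast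
    have "int (Suc r) = (\<Sum>i\<in>T. 1)" using T(2) by simp
    also have "\<dots> \<le> (\<Sum>i\<in>T. la i)"
    proof (rule sum_mono)
      fix i assume "i \<in> T"
      then have "la i \<noteq> 0" using T(3) by blast
      then show "1 \<le> la i" using nn[of i] by simp
    qed
    finally show False using S[OF T(1)] by simp
  qed
  show ?thesis using nn fin S[OF fin] by blast
qed

lemma Cr_Cpol: "Cr r sc M act \<Longrightarrow> Cpol sc M act"
  unfolding Cpol_def using Cr_weights by (auto simp: Cr_def) blast+

text \<open>The partition found by the classification is itself a weight of the module, so its size
  is bounded by \<open>Cr_weights\<close>.\<close>

lemma Cr_classification:
  assumes C: "Cr r sc M act" and irr: "irred sc M act"
  shows "\<exists>mu. (\<exists>r'\<le>r. is_partition r' mu) \<and> umod_iso sc M act scW (Wc mu) actW"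
proof -
  obtain r' mu y where mu: "is_partition r' mu" "umod_iso sc M act scW (Wc mu) actW"
    "y \<in> wspace sc M act (\<lambda>i. int (mu i))" "y \<noteq> 0"
    using Cpol_classification[OF Cr_Cpol[OF C] irr] by blast
  have "(\<Sum>i\<in>{i. int (mu i) \<noteq> 0}. int (mu i)) \<le> int r" using Cr_weights[OF C mu(3,4)] by blast
  moreover have "rk mu = r'" using mu(1) by (simp add: is_partition_def)
  ultimately have "r' \<le> r" by (simp add: rk_def flip: of_nat_sum)
  then show ?thesis using mu by blast
qed

theorem theorem11p3:
  shows
  "(\<forall>r::nat.
      (\<forall>mu. (\<exists>r'\<le>r. is_partition r' mu) \<longrightarrow> Cr r scW (Wc mu) actW \<and> irred scW (Wc mu) actW) \<and>
      (\<forall>mu mu'. (\<exists>r'\<le>r. is_partition r' mu) \<and> (\<exists>r'\<le>r. is_partition r' mu') \<and>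
           umod_iso scW (Wc mu) actW scW (Wc mu') actW \<longrightarrow> mu = mu') \<and>
      (\<forall>(sc :: qv \<Rightarrow> 'm::ab_group_add \<Rightarrow> 'm) M act. Cr r sc M act \<and> irred sc M act \<longrightarrow>
           (\<exists>mu. (\<exists>r'\<le>r. is_partition r' mu) \<and> umod_iso sc M act scW (Wc mu) actW)))
   \<and>
   ((\<forall>mu. (\<exists>r. is_partition r mu) \<longrightarrow> Cpol scW (Wc mu) actW \<and> irred scW (Wc mu) actW) \<and>
    (\<forall>mu mu'. (\<exists>r. is_partition r mu) \<and> (\<exists>r. is_partition r mu') \<and>
           umod_iso scW (Wc mu) actW scW (Wc mu') actW \<longrightarrow> mu = mu') \<and>
    (\<forall>(sc :: qv \<Rightarrow> 'm::ab_group_add \<Rightarrow> 'm) M act. Cpol sc M act \<and> irred sc M act \<longrightarrow>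
           (\<exists>mu. (\<exists>r. is_partition r mu) \<and> umod_iso sc M act scW (Wc mu) actW)))
   \<and>
   (Cpol (*) UNIV actL0 \<and> Chi (*) UNIV actL0 \<and> irred (*) UNIV actL0 \<and>
    (\<forall>(sc :: qv \<Rightarrow> 'm::ab_group_add \<Rightarrow> 'm) M act. Cpol sc M act \<and> Chi sc M act \<and> irred sc M act \<longrightarrow>
           umod_iso sc M act (*) UNIV actL0))"
proof (intro conjI allI impI)
  fix r mu assume "\<exists>r'\<le>r. is_partition r' mu"
  then obtain r' where "r' \<le> r" "is_partition r' mu" by blast
  then show "Cr r scW (Wc mu) actW" "irred scW (Wc mu) actW"
    using Cr_Wc partition.irred_Wc partitionI by blast+
next
  fix mu assume "\<exists>r. is_partition r mu"
  then obtain r where "is_partition r mu" by blast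
  then show "Cpol scW (Wc mu) actW" "irred scW (Wc mu) actW"
    using partition.Cpol_Wc partition.irred_Wc partitionI by blast+
next
  fix sc :: "qv \<Rightarrow> 'm::ab_group_add \<Rightarrow> 'm" and M act
  show "\<exists>mu. (\<exists>r'\<le>r. is_partition r' mu) \<and> umod_iso sc M act scW (Wc mu) actW"
    if "Cr r sc M act \<and> irred sc M act" for r using Cr_classification that by blast
  show "\<exists>mu. (\<exists>r. is_partition r mu) \<and> umod_iso sc M act scW (Wc mu) actW"
    if "Cpol sc M act \<and> irred sc M act" using Cpol_classification that by blast
  show "umod_iso sc M act (*) UNIV actL0" if "Cpol sc M act \<and> Chi sc M act \<and> irred sc M act"
    using Chi_irred_iso_L0 that by blast
next
  fix mu mu'
  show "mu = mu'" if "(\<exists>r'\<le>r. is_partition r' mu) \<and> (\<exists>r'\<le>r. is_partition r' mu') \<and>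
           umod_iso scW (Wc mu) actW scW (Wc mu') actW" for r using Wc_iso_eq that by blast
  show "mu = mu'" if "(\<exists>r. is_partition r mu) \<and> (\<exists>r. is_partition r mu') \<and>
           umod_iso scW (Wc mu) actW scW (Wc mu') actW" using Wc_iso_eq that by blast
qed (rule Cpol_L0 Chi_L0 irred_L0)+

end
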